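(* Let $\Omega\subset\mathbb{R}^d$ ($d\ge2$) be a bounded, simply connected Lipschitz domain. There is a constant $C>0$, independent of the mesh $\mathcal{T}$, such that the following holds for every mesh $\mathcal{T}$ of $\Omega$ and every $\boldsymbol{f}\in\boldsymbol{L}_2(\Omega)$, with $\mathfrak{U}$, $\mathfrak{V}(\mathcal{T})$, $b$, $L$ and $\mathfrak{T}$ as defined in the context. Let $\mathfrak{u}\in\mathfrak{U}$ be the unique solution of $b(\mathfrak{u},\mathfrak{v})=L(\mathfrak{v})$ for all $\mathfrak{v}\in\mathfrak{V}(\mathcal{T})$. For any finite-dimensional subspace $\mathfrak{U}_h\subset\mathfrak{U}$ there exists a unique $\mathfrak{u}_h\in\mathfrak{U}_h$ with $$b(\mathfrak{u}_h,\mathfrak{T}\delta\mathfrak{u})=L(\mathfrak{T}\delta\mathfrak{u})\qquad\forall\,\delta\mathfrak{u}\in\mathfrak{U}_h,$$ and it satisfies $$\|\mathfrak{u}-\mathfrak{u}_h\|_{\mathfrak{U}}\le C\,\|\mathfrak{u}-\mathfrak{w}\|_{\mathfrak{U}}\qquad\forall\,\mathfrak{w}\in\mathfrak{U}_h.$$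
   Context: $\Omega\subset\mathbb{R}^d$, $d\ge2$, is a bounded, simply connected Lipschitz domain with boundary $\Gamma$; $\boldsymbol{n}$ denotes the exterior unit normal vector. A mesh $\mathcal{T}=\{T\}$ is a finite collection of pairwise disjoint (open) Lipschitz domains $T\subset\Omega$ with $\bar\Omega=\bigcup_T\bar T$; its skeleton is $\mathcal{S}=\{\partial T:T\in\mathcal{T}\}$. $\boldsymbol{L}_2=(L_2)^d$; $\|\cdot\|$ is the $L_2(\Omega)$-norm, $(\cdot,\cdot)$ the $L_2(\Omega)$ inner product, $(\cdot,\cdot)_{\mathcal{T}}=\sum_T(\cdot,\cdot)_T$ with differential operators taken piecewise. For a Lipschitz domain $\omega\subset\Omega$: $\boldsymbol{H}(\nabla\mathrm{div},\omega)=\{\boldsymbol{v}\in\boldsymbol{L}_2(\omega):\nabla\operatorname{div}\boldsymbol{v}\in\boldsymbol{L}_2(\omega)\}$ with $\|\boldsymbol{v}\|_{\nabla\mathrm{div},\omega}^2=\|\boldsymbol{v}\|_\omega^2+\|\nabla\operatorname{div}\boldsymbol{v}\|_\omega^2$ (index dropped for $\omega=\Omega$); its elements satisfy $\operatorname{div}\boldsymbol{v}\in H^1(\omega)$, so the traces $\boldsymbol{v}\cdot\boldsymbol{n}$ and $\operatorname{div}\boldsymbol{v}$ on $\partial\omega$ are well defined; $\boldsymbol{H}_0(\nabla\mathrm{div},\omega)$ is the subspace where both vanish on $\partial\omega$. $\boldsymbol{H}(\nabla\mathrm{div},\mathcal{T})=\prod_T\boldsymbol{H}(\nabla\mathrm{div},T)$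 with product norm $\|\cdot\|_{\nabla\mathrm{div},\mathcal{T}}$. The trace operator $\mathrm{tr}^{\nabla\mathrm{div}}:\boldsymbol{H}(\nabla\mathrm{div},\mathcal{T})\to\boldsymbol{H}(\nabla\mathrm{div},\mathcal{T})'$ is defined by $\langle\mathrm{tr}^{\nabla\mathrm{div}}(\boldsymbol{v}),\boldsymbol{\tau}\rangle^{\nabla\mathrm{div}}_{\mathcal{S}}:=(\boldsymbol{v},\nabla\operatorname{div}\boldsymbol{\tau})_{\mathcal{T}}-(\nabla\operatorname{div}\boldsymbol{v},\boldsymbol{\tau})_{\mathcal{T}}$. Set $\boldsymbol{H}^{\nabla\mathrm{div}}(\mathcal{S})=\mathrm{tr}^{\nabla\mathrm{div}}(\boldsymbol{H}(\nabla\mathrm{div},\Omega))$, $\boldsymbol{H}^{\nabla\mathrm{div}}_0(\mathcal{S})=\mathrm{tr}^{\nabla\mathrm{div}}(\boldsymbol{H}_0(\nabla\mathrm{div},\Omega))$ with norm $\|\hat{\boldsymbol{v}}\|_{-1/2,1/2,\mathcal{S}}=\inf\{\|\boldsymbol{v}\|_{\nabla\mathrm{div}}:\boldsymbol{v}\in\boldsymbol{H}(\nabla\mathrm{div},\Omega),\ \mathrm{tr}^{\nabla\mathrm{div}}(\boldsymbol{v})=\hat{\boldsymbol{v}}\}$; $\langle\hat{\boldsymbol{v}},\boldsymbol{\tau}\rangle^{\nabla\mathrm{div}}_{\mathcal{S}}$ is the evaluation of the functional $\hat{\boldsymbol{v}}$ at $\boldsymbol{\tau}\in\boldsymbol{H}(\nabla\mathrm{div},\mathcal{T})$.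 Formulation: $\mathfrak{U}=\boldsymbol{L}_2(\Omega)\times\boldsymbol{L}_2(\Omega)\times\boldsymbol{H}^{\nabla\mathrm{div}}_0(\mathcal{S})\times\boldsymbol{H}^{\nabla\mathrm{div}}(\mathcal{S})$ with $\|(\boldsymbol{u},\boldsymbol{w},\widehat{\boldsymbol{u}},\widehat{\boldsymbol{w}})\|_{\mathfrak{U}}^2=\|\boldsymbol{u}\|^2+\|\boldsymbol{w}\|^2+\|\widehat{\boldsymbol{u}}\|_{-1/2,1/2,\mathcal{S}}^2+\|\widehat{\boldsymbol{w}}\|_{-1/2,1/2,\mathcal{S}}^2$; $\mathfrak{V}(\mathcal{T})=\boldsymbol{H}(\nabla\mathrm{div},\mathcal{T})\times\boldsymbol{H}(\nabla\mathrm{div},\mathcal{T})$ with inner product $\langle\!\langle(\boldsymbol{v}_1,\boldsymbol{v}_2),(\boldsymbol{\delta v}_1,\boldsymbol{\delta v}_2)\rangle\!\rangle_{\mathfrak{V}(\mathcal{T})}=\sum_{j=1}^2\big[(\boldsymbol{v}_j,\boldsymbol{\delta v}_j)+(\nabla\operatorname{div}\boldsymbol{v}_j,\nabla\operatorname{div}\boldsymbol{\delta v}_j)_{\mathcal{T}}\big]$. For $\mathfrak{u}=(\boldsymbol{u},\boldsymbol{w},\widehat{\boldsymbol{u}},\widehat{\boldsymbol{w}})$, $\mathfrak{v}=(\boldsymbol{v},\boldsymbol{\tau})$, $$b(\mathfrak{u},\mathfrak{v})=(\boldsymbol{u},\boldsymbol{v}-\nabla\operatorname{div}\boldsymbol{\tau})_{\mathcal{T}}-(\boldsymbol{w},\boldsymbol{\tau}+\nabla\operatorname{div}\boldsymbol{v})_{\mathcal{T}}+\langle\widehat{\boldsymbol{u}},\boldsymbol{\tau}\rangle^{\nabla\mathrm{div}}_{\mathcal{S}}+\langle\widehat{\boldsymbol{w}},\boldsymbol{v}\rangle^{\nabla\mathrm{div}}_{\mathcal{S}},\qquad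 L(\mathfrak{v})=(\boldsymbol{f},\boldsymbol{v}).$$ The trial-to-test operator $\mathfrak{T}:\mathfrak{U}\to\mathfrak{V}(\mathcal{T})$ is defined by $\langle\!\langle\mathfrak{T}\mathfrak{u},\mathfrak{v}\rangle\!\rangle_{\mathfrak{V}(\mathcal{T})}=b(\mathfrak{u},\mathfrak{v})$ for all $\mathfrak{v}\in\mathfrak{V}(\mathcal{T})$. The problem $b(\mathfrak{u},\cdot)=L$ on $\mathfrak{V}(\mathcal{T})$ has a unique solution $\mathfrak{u}\in\mathfrak{U}$. *)

theory Defs
  imports "HOL-Analysis.Analysis" "HOL-Library.Function_Algebras"
begin

section \<open>Real vector space structure on functions\<close>

text \<open>The skeleton (trace) spaces consist of real-valued functionals; the following instance makes
  \<^const>\<open>subspace\<close> and \<^const>\<open>span\<close> available for the trial space.\<close>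

instantiation "fun" :: (type, scaleR) scaleR
begin
definition scaleR_fun_def: "c *\<^sub>R f = (\<lambda>x. c *\<^sub>R f x)"
instance ..
end

instance "fun" :: (type, real_vector) real_vector
  by standard (auto simp: scaleR_fun_def fun_eq_iff algebra_simps)


section \<open>Square-integrable functions modulo equality almost everywhere\<close>

definition square_integrable :: "('a::euclidean_space \<Rightarrow> 'b::euclidean_space) \<Rightarrow> bool" where
  "square_integrable f \<longleftrightarrow> f \<in> borel_measurable lborel \<and> integrable lborel (\<lambda>x. (norm (f x))\<^sup>2)"

lemma square_integrable_zero: "square_integrable (\<lambda>_. 0)"
  by (simp add: square_integrable_def)

lemma square_integrable_scaleR: "square_integrable f \<Longrightarrow> square_integrable (\<lambda>x. c *\<^sub>R f x)"
  by (auto simp: square_integrable_def power_mult_distrib)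

lemma square_integrable_add:
  assumes "square_integrable f" "square_integrable g"
  shows "square_integrable (\<lambda>x. f x + g x)"
proof -
  have [measurable]: "f \<in> borel_measurable lborel" "g \<in> borel_measurable lborel"
    using assms by (simp_all add: square_integrable_def)
  have bound: "(norm (a + b))\<^sup>2 \<le> 2 * (norm a)\<^sup>2 + 2 * (norm b)\<^sup>2" for a b :: 'b
  proof -
    have "(norm (a + b))\<^sup>2 \<le> (norm a + norm b)\<^sup>2"
      by (intro power_mono norm_triangle_ineq norm_ge_zero)
    also have "\<dots> \<le> 2 * (norm a)\<^sup>2 + 2 * (norm b)\<^sup>2"
      using sum_squares_bound[of "norm a" "norm b"] unfolding power2_sum by linarith
    finally show ?thesis .
  qed
  have "integrable lborel (\<lambda>x. 2 * (norm (f x))\<^sup>2 + 2 * (norm (g x))\<^sup>2)"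
    using assms unfolding square_integrable_def
    by (intro Bochner_Integration.integrable_add integrable_mult_right) simp_all
  then have "integrable lborel (\<lambda>x. (norm (f x + g x))\<^sup>2)"
  proof (rule Bochner_Integration.integrable_bound)
    show "(\<lambda>x. (norm (f x + g x))\<^sup>2) \<in> borel_measurable lborel"
      by measurable
    show "AE x in lborel. norm ((norm (f x + g x))\<^sup>2)
        \<le> norm (2 * (norm (f x))\<^sup>2 + 2 * (norm (g x))\<^sup>2)"
      by (rule AE_I2) (use bound in simp)
  qed
  then show ?thesis by (simp add: square_integrable_def)
qed

lemma square_integrable_uminus: "square_integrable f \<Longrightarrow> square_integrable (\<lambda>x. - f x)"
  using square_integrable_scaleR[of f "-1"] by simp

lemma square_integrable_diff:
  "square_integrable f \<Longrightarrow> square_integrable g \<Longrightarrow> square_integrable (\<lambda>x. f x - g x)"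
  using square_integrable_add[of f "\<lambda>x. - g x"] square_integrable_uminus[of g] by simp

lemma square_integrable_indicator:
  assumes "square_integrable f" "A \<in> sets borel"
  shows "square_integrable (\<lambda>x. indicator A x *\<^sub>R f x)"
proof -
  have [measurable]: "f \<in> borel_measurable lborel" "A \<in> sets borel"
    using assms by (simp_all add: square_integrable_def)
  have "integrable lborel (\<lambda>x. (norm (f x))\<^sup>2)"
    using assms(1) by (simp add: square_integrable_def)
  then have "integrable lborel (\<lambda>x. (norm (indicator A x *\<^sub>R f x))\<^sup>2)"
  proof (rule Bochner_Integration.integrable_bound)
    show "(\<lambda>x. (norm (indicator A x *\<^sub>R f x))\<^sup>2) \<in> borel_measurable lborel"
      by measurable
    show "AE x in lborel. norm ((norm (indicator A x *\<^sub>R f x))\<^sup>2) \<le> norm ((norm (f x))\<^sup>2)"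
      by (rule AE_I2) (simp add: indicator_def)
  qed
  then show ?thesis by (simp add: square_integrable_def)
qed

lemma square_integrable_inner:
  assumes "square_integrable f" "square_integrable g"
  shows "integrable lborel (\<lambda>x. f x \<bullet> g x)"
proof -
  have [measurable]: "f \<in> borel_measurable lborel" "g \<in> borel_measurable lborel"
    using assms by (simp_all add: square_integrable_def)
  have bound: "\<bar>a \<bullet> b\<bar> \<le> (norm a)\<^sup>2 + (norm b)\<^sup>2" for a b :: 'b
  proof -
    have "\<bar>a \<bullet> b\<bar> \<le> norm a * norm b" by (rule Cauchy_Schwarz_ineq2)
    moreover have "2 * norm a * norm b \<le> (norm a)\<^sup>2 + (norm b)\<^sup>2"
      by (rule sum_squares_bound)
    moreover have "0 \<le> norm a * norm b" by simp
    ultimately show ?thesis by linarith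
  qed
  have "integrable lborel (\<lambda>x. (norm (f x))\<^sup>2 + (norm (g x))\<^sup>2)"
    using assms unfolding square_integrable_def
    by (intro Bochner_Integration.integrable_add) simp_all
  then show ?thesis
  proof (rule Bochner_Integration.integrable_bound)
    show "(\<lambda>x. f x \<bullet> g x) \<in> borel_measurable lborel"
      by measurable
    show "AE x in lborel. norm (f x \<bullet> g x) \<le> norm ((norm (f x))\<^sup>2 + (norm (g x))\<^sup>2)"
      by (rule AE_I2) (use bound in simp)
  qed
qed

definition l2rel :: "('a::euclidean_space \<Rightarrow> 'b::euclidean_space) \<Rightarrow> ('a \<Rightarrow> 'b) \<Rightarrow> bool" where
  "l2rel f g \<longleftrightarrow> square_integrable f \<and> square_integrable g \<and> (AE x in lborel. f x = g x)"

quotient_type (overloaded) ('a, 'b) l2 = "'a::euclidean_space \<Rightarrow> 'b::euclidean_space" / partial: l2rel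
proof (rule part_equivpI)
  show "\<exists>f. l2rel f f"
    using square_integrable_zero by (auto simp: l2rel_def)
  show "symp l2rel"
    by (auto simp: l2rel_def symp_def eq_commute)
  show "transp l2rel"
    unfolding l2rel_def transp_def by (fastforce elim: eventually_elim2)
qed

instantiation l2 :: (euclidean_space, euclidean_space) real_vector
begin

lift_definition zero_l2 :: "('a, 'b) l2" is "\<lambda>_. 0"
  by (auto simp: l2rel_def square_integrable_zero)

lift_definition plus_l2 :: "('a, 'b) l2 \<Rightarrow> ('a, 'b) l2 \<Rightarrow> ('a, 'b) l2" is "\<lambda>f g x. f x + g x"
  unfolding l2rel_def
  by (elim conjE, intro conjI square_integrable_add, assumption+, erule (1) eventually_elim2, simp)

lift_definition uminus_l2 :: "('a, 'b) l2 \<Rightarrow> ('a, 'b) l2" is "\<lambda>f x. - f x"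
  by (simp add: l2rel_def square_integrable_uminus)

lift_definition minus_l2 :: "('a, 'b) l2 \<Rightarrow> ('a, 'b) l2 \<Rightarrow> ('a, 'b) l2" is "\<lambda>f g x. f x - g x"
  unfolding l2rel_def
  by (elim conjE, intro conjI square_integrable_diff, assumption+, erule (1) eventually_elim2, simp)

lift_definition scaleR_l2 :: "real \<Rightarrow> ('a, 'b) l2 \<Rightarrow> ('a, 'b) l2" is "\<lambda>c f x. c *\<^sub>R f x"
  unfolding l2rel_def
  by (elim conjE, intro conjI square_integrable_scaleR, assumption+, erule eventually_mono, simp)

instance
proof
  fix a b c :: "('a, 'b) l2" and r s :: real
  show "a + b + c = a + (b + c)"
    by transfer (simp add: l2rel_def algebra_simps square_integrable_add)
  show "a + b = b + a"
    by transfer (simp add: l2rel_def algebra_simps square_integrable_add)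
  show "0 + a = a"
    by transfer (simp add: l2rel_def)
  show "- a + a = 0"
    by transfer (simp add: l2rel_def square_integrable_zero)
  show "a - b = a + - b"
    by transfer (simp add: l2rel_def square_integrable_diff)
  show "r *\<^sub>R (a + b) = r *\<^sub>R a + r *\<^sub>R b"
    by transfer (simp add: l2rel_def algebra_simps square_integrable_add square_integrable_scaleR)
  show "(r + s) *\<^sub>R a = r *\<^sub>R a + s *\<^sub>R a"
    by transfer (simp add: l2rel_def algebra_simps square_integrable_add square_integrable_scaleR)
  show "r *\<^sub>R s *\<^sub>R a = (r * s) *\<^sub>R a"
    by transfer (simp add: l2rel_def square_integrable_scaleR)
  show "1 *\<^sub>R a = a"
    by transfer (simp add: l2rel_def)
qed

end

instantiation l2 :: (euclidean_space, euclidean_space) real_inner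
begin

lift_definition inner_l2 :: "('a, 'b) l2 \<Rightarrow> ('a, 'b) l2 \<Rightarrow> real" is "\<lambda>f g. \<integral>x. f x \<bullet> g x \<partial>lborel"
  subgoal for f f' g g'
    unfolding l2rel_def square_integrable_def
    by (elim conjE, intro integral_cong_AE borel_measurable_inner, assumption+,
        erule (1) eventually_elim2, simp)
  done

definition norm_l2 :: "('a, 'b) l2 \<Rightarrow> real" where "norm_l2 f = sqrt (f \<bullet> f)"
definition sgn_l2 :: "('a, 'b) l2 \<Rightarrow> ('a, 'b) l2" where "sgn_l2 f = f /\<^sub>R norm f"
definition dist_l2 :: "('a, 'b) l2 \<Rightarrow> ('a, 'b) l2 \<Rightarrow> real" where "dist_l2 f g = norm (f - g)"
definition uniformity_l2 :: "(('a, 'b) l2 \<times> ('a, 'b) l2) filter" where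
  "uniformity_l2 = (INF e\<in>{0<..}. principal {(f, g). dist f g < e})"
definition open_l2 :: "('a, 'b) l2 set \<Rightarrow> bool" where
  "open_l2 U \<longleftrightarrow> (\<forall>x\<in>U. \<forall>\<^sub>F (x', y) in uniformity. x' = x \<longrightarrow> y \<in> U)"

instance
proof
  fix a b c :: "('a, 'b) l2" and r :: real
  show "sgn a = a /\<^sub>R norm a" by (rule sgn_l2_def)
  show "dist a b = norm (a - b)" by (rule dist_l2_def)
  show "(uniformity :: (('a, 'b) l2 \<times> ('a, 'b) l2) filter) =
      (INF e\<in>{0<..}. principal {(x, y). dist x y < e})"
    by (rule uniformity_l2_def)
  show "open U \<longleftrightarrow> (\<forall>x\<in>U. \<forall>\<^sub>F (x', y) in uniformity. x' = x \<longrightarrow> y \<in> U)"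
    for U :: "('a, 'b) l2 set"
    by (rule open_l2_def)
  show "a \<bullet> b = b \<bullet> a"
    by transfer (simp add: inner_commute)
  show "(a + b) \<bullet> c = a \<bullet> c + b \<bullet> c"
    by transfer (simp add: l2rel_def inner_add_left square_integrable_inner)
  show "r *\<^sub>R a \<bullet> b = r * (a \<bullet> b)"
    by transfer simp
  show "0 \<le> a \<bullet> a"
    by transfer simp
  show "a \<bullet> a = 0 \<longleftrightarrow> a = 0"
  proof transfer
    fix f :: "'a \<Rightarrow> 'b" assume f: "l2rel f f"
    then have "integrable lborel (\<lambda>x. f x \<bullet> f x)"
      by (simp add: l2rel_def square_integrable_inner)
    then have "(\<integral>x. f x \<bullet> f x \<partial>lborel) = 0 \<longleftrightarrow> (AE x in lborel. f x \<bullet> f x = 0)"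
      by (rule integral_nonneg_eq_0_iff_AE) auto
    then show "(\<integral>x. f x \<bullet> f x \<partial>lborel) = 0 \<longleftrightarrow> l2rel f (\<lambda>_. 0)"
      using f by (simp add: l2rel_def square_integrable_zero)
  qed
  show "norm a = sqrt (a \<bullet> a)" by (rule norm_l2_def)
qed

end

text \<open>The class of a square-integrable function (unspecified for other functions).\<close>

abbreviation l2_of :: "('a::euclidean_space \<Rightarrow> 'b::euclidean_space) \<Rightarrow> ('a, 'b) l2" where
  "l2_of \<equiv> abs_l2"

text \<open>\<open>L\<^sub>2(\<omega>)\<close> is identified, by extension by zero, with the classes that vanish almost
  everywhere outside \<open>\<omega>\<close>; hence its norm and inner product are those of \<open>l2\<close>.\<close>

lift_definition l2_vanishes_off :: "('a::euclidean_space, 'b::euclidean_space) l2 \<Rightarrow> 'a set \<Rightarrow> bool"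
  is "\<lambda>f \<omega>. AE x in lborel. x \<notin> \<omega> \<longrightarrow> f x = 0"
  subgoal for f g
    unfolding l2rel_def
    by (elim conjE, rule ext, rule iffI) (erule (1) eventually_elim2, simp)+
  done

definition L2 :: "'a::euclidean_space set \<Rightarrow> ('a, 'b::euclidean_space) l2 set" where
  "L2 \<omega> = {f. l2_vanishes_off f \<omega>}"

text \<open>Restriction to \<open>\<omega>\<close>, again extended by zero; only used for open \<open>\<omega>\<close>.\<close>

lift_definition l2_restrict :: "'a::euclidean_space set \<Rightarrow> ('a, 'b::euclidean_space) l2 \<Rightarrow> ('a, 'b) l2"
  is "\<lambda>\<omega> f x. if \<omega> \<in> sets borel then indicator \<omega> x *\<^sub>R f x else 0"
  subgoal for \<omega> f g
    unfolding l2rel_def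
    by (cases "\<omega> \<in> sets borel")
      (auto simp: square_integrable_indicator square_integrable_zero elim!: eventually_mono)
  done


section \<open>Smooth test functions and weak derivatives\<close>

primrec C_k :: "nat \<Rightarrow> ('a::euclidean_space \<Rightarrow> 'b::real_normed_vector) \<Rightarrow> bool" where
  "C_k 0 \<phi> \<longleftrightarrow> continuous_on UNIV \<phi>"
| "C_k (Suc k) \<phi> \<longleftrightarrow> (\<forall>x. \<phi> differentiable (at x)) \<and>
     (\<forall>i\<in>Basis. C_k k (\<lambda>x. frechet_derivative \<phi> (at x) i))"

text \<open>\<open>C\<^sub>c\<^sup>\<infinity>(\<omega>)\<close>, with the functions extended by zero.\<close>

definition test_fun :: "'a::euclidean_space set \<Rightarrow> ('a \<Rightarrow> 'b::real_normed_vector) set" where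
  "test_fun \<omega> = {\<phi>. (\<forall>k. C_k k \<phi>) \<and> compact (closure {x. \<phi> x \<noteq> 0}) \<and> closure {x. \<phi> x \<noteq> 0} \<subseteq> \<omega>}"

definition grad :: "('a::euclidean_space \<Rightarrow> real) \<Rightarrow> 'a \<Rightarrow> 'a" where
  "grad \<phi> x = (\<Sum>i\<in>Basis. frechet_derivative \<phi> (at x) i *\<^sub>R i)"

definition dvg :: "('a::euclidean_space \<Rightarrow> 'a) \<Rightarrow> 'a \<Rightarrow> real" where
  "dvg \<phi> x = (\<Sum>i\<in>Basis. frechet_derivative \<phi> (at x) i \<bullet> i)"

definition has_weak_grad :: "'a::euclidean_space set \<Rightarrow> ('a, real) l2 \<Rightarrow> ('a, 'a) l2 \<Rightarrow> bool" where
  "has_weak_grad \<omega> p g \<longleftrightarrow> (\<forall>\<phi>\<in>test_fun \<omega>. p \<bullet> l2_of (dvg \<phi>) = - (g \<bullet> l2_of \<phi>))"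

definition has_weak_div :: "'a::euclidean_space set \<Rightarrow> ('a, 'a) l2 \<Rightarrow> ('a, real) l2 \<Rightarrow> bool" where
  "has_weak_div \<omega> v p \<longleftrightarrow> (\<forall>\<phi>\<in>test_fun \<omega>. v \<bullet> l2_of (grad \<phi>) = - (p \<bullet> l2_of \<phi>))"

text \<open>\<open>\<nabla> div v = g\<close> in the sense of distributions on \<open>\<omega>\<close>. The distribution \<open>div v\<close> itself is not
  required to be a function.\<close>

definition has_weak_grad_div :: "'a::euclidean_space set \<Rightarrow> ('a, 'a) l2 \<Rightarrow> ('a, 'a) l2 \<Rightarrow> bool" where
  "has_weak_grad_div \<omega> v g \<longleftrightarrow> (\<forall>\<phi>\<in>test_fun \<omega>. v \<bullet> l2_of (grad (dvg \<phi>)) = g \<bullet> l2_of \<phi>)"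

text \<open>For open \<open>\<omega>\<close> the weak derivatives are unique in \<open>L\<^sub>2(\<omega>)\<close>.\<close>

definition wgrad :: "'a::euclidean_space set \<Rightarrow> ('a, real) l2 \<Rightarrow> ('a, 'a) l2" where
  "wgrad \<omega> p = (THE g. g \<in> L2 \<omega> \<and> has_weak_grad \<omega> p g)"

definition wdiv :: "'a::euclidean_space set \<Rightarrow> ('a, 'a) l2 \<Rightarrow> ('a, real) l2" where
  "wdiv \<omega> v = (THE p. p \<in> L2 \<omega> \<and> has_weak_div \<omega> v p)"

definition wgrad_div :: "'a::euclidean_space set \<Rightarrow> ('a, 'a) l2 \<Rightarrow> ('a, 'a) l2" where
  "wgrad_div \<omega> v = (THE g. g \<in> L2 \<omega> \<and> has_weak_grad_div \<omega> v g)"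


section \<open>Function spaces on a domain\<close>

definition H1 :: "'a::euclidean_space set \<Rightarrow> ('a, real) l2 set" where
  "H1 \<omega> = {p \<in> L2 \<omega>. \<exists>g\<in>L2 \<omega>. has_weak_grad \<omega> p g}"

text \<open>\<open>H\<^sup>1\<close>-functions with vanishing trace: the closure of \<open>C\<^sub>c\<^sup>\<infinity>(\<omega>)\<close> in \<open>H\<^sup>1(\<omega>)\<close>.\<close>

definition H1_0 :: "'a::euclidean_space set \<Rightarrow> ('a, real) l2 set" where
  "H1_0 \<omega> = {p \<in> H1 \<omega>. \<forall>\<epsilon>>0. \<exists>\<phi>\<in>test_fun \<omega>.
     (norm (p - l2_of \<phi>))\<^sup>2 + (norm (wgrad \<omega> p - l2_of (grad \<phi>)))\<^sup>2 < \<epsilon>\<^sup>2}"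

definition Hdiv :: "'a::euclidean_space set \<Rightarrow> ('a, 'a) l2 set" where
  "Hdiv \<omega> = {v \<in> L2 \<omega>. \<exists>p\<in>L2 \<omega>. has_weak_div \<omega> v p}"

text \<open>The normal trace \<open>v \<cdot> n\<close> of \<open>v \<in> H(div, \<omega>)\<close> as a functional on (the traces of)
  \<open>H\<^sup>1(\<omega>)\<close>, defined by Green's formula.\<close>

definition normal_trace :: "'a::euclidean_space set \<Rightarrow> ('a, 'a) l2 \<Rightarrow> ('a, real) l2 \<Rightarrow> real" where
  "normal_trace \<omega> v \<phi> = v \<bullet> wgrad \<omega> \<phi> + wdiv \<omega> v \<bullet> \<phi>"

definition Hgd :: "'a::euclidean_space set \<Rightarrow> ('a, 'a) l2 set" where
  "Hgd \<omega> = {v \<in> L2 \<omega>. \<exists>g\<in>L2 \<omega>. has_weak_grad_div \<omega> v g}"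

definition norm_gd :: "'a::euclidean_space set \<Rightarrow> ('a, 'a) l2 \<Rightarrow> real" where
  "norm_gd \<omega> v = sqrt ((norm v)\<^sup>2 + (norm (wgrad_div \<omega> v))\<^sup>2)"

text \<open>On a bounded Lipschitz domain every \<open>v \<in> H(\<nabla>div, \<omega>)\<close> has \<open>div v \<in> H\<^sup>1(\<omega>)\<close>, so there the
  restriction to \<^const>\<open>Hdiv\<close> is redundant; it only ensures that \<^const>\<open>wdiv\<close> is meaningful.\<close>

definition Hgd_0 :: "'a::euclidean_space set \<Rightarrow> ('a, 'a) l2 set" where
  "Hgd_0 \<omega> = {v \<in> Hgd \<omega> \<inter> Hdiv \<omega>. (\<forall>\<phi>\<in>H1 \<omega>. normal_trace \<omega> v \<phi> = 0) \<and> wdiv \<omega> v \<in> H1_0 \<omega>}"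


section \<open>Lipschitz domains and meshes\<close>

text \<open>Near each boundary point, \<open>\<omega>\<close> lies strictly below the graph, in some unit direction \<open>e\<close>, of a
  Lipschitz function on the hyperplane orthogonal to \<open>e\<close>; \<open>y - (y \<bullet> e) *\<^sub>R e\<close> is the projection of
  \<open>y\<close> onto that hyperplane.\<close>

definition lipschitz_domain :: "'a::euclidean_space set \<Rightarrow> bool" where
  "lipschitz_domain \<omega> \<longleftrightarrow> open \<omega> \<and> connected \<omega> \<and> \<omega> \<noteq> {} \<and>
     (\<forall>x\<in>frontier \<omega>. \<exists>r>0. \<exists>e. \<exists>\<gamma>::'a \<Rightarrow> real. \<exists>K. norm e = 1 \<and> K-lipschitz_on {z. z \<bullet> e = 0} \<gamma> \<and>
        \<omega> \<inter> ball x r = {y \<in> ball x r. y \<bullet> e < \<gamma> (y - (y \<bullet> e) *\<^sub>R e)})"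

definition mesh :: "'a::euclidean_space set \<Rightarrow> 'a set set \<Rightarrow> bool" where
  "mesh \<Omega> \<T> \<longleftrightarrow> finite \<T> \<and> (\<forall>T\<in>\<T>. lipschitz_domain T \<and> T \<subseteq> \<Omega>) \<and> pairwise disjnt \<T> \<and>
     closure \<Omega> = (\<Union>T\<in>\<T>. closure T)"


section \<open>Broken spaces and skeleton traces\<close>

definition mesh_inner ::
  "'a::euclidean_space set set \<Rightarrow> ('a, 'b::euclidean_space) l2 \<Rightarrow> ('a, 'b) l2 \<Rightarrow> real" where
  "mesh_inner \<T> f g = (\<Sum>T\<in>\<T>. l2_restrict T f \<bullet> l2_restrict T g)"

text \<open>Since the skeleton is a null set, a family \<open>(v\<^sub>T)\<^sub>T\<close> in the product of the \<open>H(\<nabla>div, T)\<close> is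
  represented by the single function on \<open>\<Omega>\<close> whose restriction to each \<open>T\<close> is \<open>v\<^sub>T\<close>.\<close>

definition broken_Hgd :: "'a::euclidean_space set \<Rightarrow> 'a set set \<Rightarrow> ('a, 'a) l2 set" where
  "broken_Hgd \<Omega> \<T> = {v \<in> L2 \<Omega>. \<forall>T\<in>\<T>. l2_restrict T v \<in> Hgd T}"

definition broken_grad_div :: "'a::euclidean_space set set \<Rightarrow> ('a, 'a) l2 \<Rightarrow> ('a, 'a) l2" where
  "broken_grad_div \<T> v = (\<Sum>T\<in>\<T>. wgrad_div T (l2_restrict T v))"

text \<open>A functional on the broken space is normalised to be \<open>0\<close> outside it, so that equality of
  functionals is equality of HOL functions.\<close>

definition tr_gd ::
  "'a::euclidean_space set \<Rightarrow> 'a set set \<Rightarrow> ('a, 'a) l2 \<Rightarrow> ('a, 'a) l2 \<Rightarrow> real" where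
  "tr_gd \<Omega> \<T> v = (\<lambda>\<tau>. if \<tau> \<in> broken_Hgd \<Omega> \<T>
     then mesh_inner \<T> v (broken_grad_div \<T> \<tau>) - mesh_inner \<T> (broken_grad_div \<T> v) \<tau>
     else 0)"

definition skel_Hgd :: "'a::euclidean_space set \<Rightarrow> 'a set set \<Rightarrow> (('a, 'a) l2 \<Rightarrow> real) set" where
  "skel_Hgd \<Omega> \<T> = tr_gd \<Omega> \<T> ` Hgd \<Omega>"

definition skel_Hgd_0 :: "'a::euclidean_space set \<Rightarrow> 'a set set \<Rightarrow> (('a, 'a) l2 \<Rightarrow> real) set" where
  "skel_Hgd_0 \<Omega> \<T> = tr_gd \<Omega> \<T> ` Hgd_0 \<Omega>"

definition skel_norm ::
  "'a::euclidean_space set \<Rightarrow> 'a set set \<Rightarrow> (('a, 'a) l2 \<Rightarrow> real) \<Rightarrow> real" where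
  "skel_norm \<Omega> \<T> vh = Inf {norm_gd \<Omega> v |v. v \<in> Hgd \<Omega> \<and> tr_gd \<Omega> \<T> v = vh}"


section \<open>The ultraweak formulation\<close>

type_synonym 'a trial =
  "('a, 'a) l2 \<times> ('a, 'a) l2 \<times> (('a, 'a) l2 \<Rightarrow> real) \<times> (('a, 'a) l2 \<Rightarrow> real)"

type_synonym 'a test = "('a, 'a) l2 \<times> ('a, 'a) l2"

definition trial_space :: "'a::euclidean_space set \<Rightarrow> 'a set set \<Rightarrow> 'a trial set" where
  "trial_space \<Omega> \<T> = L2 \<Omega> \<times> L2 \<Omega> \<times> skel_Hgd_0 \<Omega> \<T> \<times> skel_Hgd \<Omega> \<T>"

definition trial_norm :: "'a::euclidean_space set \<Rightarrow> 'a set set \<Rightarrow> 'a trial \<Rightarrow> real" where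
  "trial_norm \<Omega> \<T> = (\<lambda>(u, w, uh, wh).
     sqrt ((norm u)\<^sup>2 + (norm w)\<^sup>2 + (skel_norm \<Omega> \<T> uh)\<^sup>2 + (skel_norm \<Omega> \<T> wh)\<^sup>2))"

definition test_space :: "'a::euclidean_space set \<Rightarrow> 'a set set \<Rightarrow> 'a test set" where
  "test_space \<Omega> \<T> = broken_Hgd \<Omega> \<T> \<times> broken_Hgd \<Omega> \<T>"

definition test_inner :: "'a::euclidean_space set set \<Rightarrow> 'a test \<Rightarrow> 'a test \<Rightarrow> real" where
  "test_inner \<T> = (\<lambda>(v\<^sub>1, v\<^sub>2) (\<delta>v\<^sub>1, \<delta>v\<^sub>2).
     (v\<^sub>1 \<bullet> \<delta>v\<^sub>1 + mesh_inner \<T> (broken_grad_div \<T> v\<^sub>1) (broken_grad_div \<T> \<delta>v\<^sub>1)) +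
     (v\<^sub>2 \<bullet> \<delta>v\<^sub>2 + mesh_inner \<T> (broken_grad_div \<T> v\<^sub>2) (broken_grad_div \<T> \<delta>v\<^sub>2)))"

definition bform :: "'a::euclidean_space set set \<Rightarrow> 'a trial \<Rightarrow> 'a test \<Rightarrow> real" where
  "bform \<T> = (\<lambda>(u, w, uh, wh) (v, \<tau>).
     mesh_inner \<T> u (v - broken_grad_div \<T> \<tau>) - mesh_inner \<T> w (\<tau> + broken_grad_div \<T> v)
     + uh \<tau> + wh v)"

definition Lform :: "('a::euclidean_space, 'a) l2 \<Rightarrow> 'a test \<Rightarrow> real" where
  "Lform f = (\<lambda>(v, \<tau>). f \<bullet> v)"

definition trial_to_test :: "'a::euclidean_space set \<Rightarrow> 'a set set \<Rightarrow> 'a trial \<Rightarrow> 'a test" where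
  "trial_to_test \<Omega> \<T> \<uu> = (THE \<tt>. \<tt> \<in> test_space \<Omega> \<T> \<and>
     (\<forall>\<vv>\<in>test_space \<Omega> \<T>. test_inner \<T> \<tt> \<vv> = bform \<T> \<uu> \<vv>))"

definition finite_dim_subspace :: "'a::real_vector set \<Rightarrow> bool" where
  "finite_dim_subspace S \<longleftrightarrow> subspace S \<and> (\<exists>B. finite B \<and> S = span B)"

definition is_solution ::
  "'a::euclidean_space set \<Rightarrow> 'a set set \<Rightarrow> ('a, 'a) l2 \<Rightarrow> 'a trial \<Rightarrow> bool" where
  "is_solution \<Omega> \<T> f \<uu> \<longleftrightarrow> \<uu> \<in> trial_space \<Omega> \<T> \<and>
     (\<forall>\<vv>\<in>test_space \<Omega> \<T>. bform \<T> \<uu> \<vv> = Lform f \<vv>)"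

definition is_discrete_solution ::
  "'a::euclidean_space set \<Rightarrow> 'a set set \<Rightarrow> ('a, 'a) l2 \<Rightarrow> 'a trial set \<Rightarrow> 'a trial \<Rightarrow> bool" where
  "is_discrete_solution \<Omega> \<T> f U\<^sub>h \<uu>\<^sub>h \<longleftrightarrow> \<uu>\<^sub>h \<in> U\<^sub>h \<and>
     (\<forall>\<delta>\<uu>\<in>U\<^sub>h. bform \<T> \<uu>\<^sub>h (trial_to_test \<Omega> \<T> \<delta>\<uu>) = Lform f (trial_to_test \<Omega> \<T> \<delta>\<uu>))"

end

theory Submission
  imports Defs "HOL-Computational_Algebra.Polynomial"
begin

text \<open>Write \<open>A = \<nabla>div\<close> for the maximal operator on \<open>\<Omega>\<close>. The discrete solution is the best
  approximation of \<open>\<uu>\<close> in the energy norm \<open>\<parallel>\<TT>\<cdot>\<parallel>\<close>, so it suffices that this norm is equivalent to the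
  trial norm with absolute constants. The upper bound is Cauchy-Schwarz. For the lower bound, the
  \<open>L\<^sub>2\<close>-components are controlled by testing with the solution of the adjoint problem on \<open>\<Omega>\<close>, which
  von Neumann's splitting of \<open>L\<^sub>2 \<times> L\<^sub>2\<close> into the graph of \<open>A\<close> and the rotated graph of its adjoint
  provides with constant one; the traces are then controlled because the trace norm equals the norm
  of the functional on the broken space.

  The Lipschitz property enters twice: the skeleton is a null set, and \<open>v \<in> H(\<nabla>div, \<Omega>)\<close> has
  \<open>div v \<in> H\<^sup>1(\<Omega>)\<close>, so that elements of \<open>H\<^sub>0(\<nabla>div, \<Omega>)\<close> lie in the domain of the adjoint of \<open>A\<close>. For the
  latter, \<open>\<phi> \<mapsto> (v, \<nabla>\<phi>)\<close> is shown to be \<open>L\<^sub>2\<close>-bounded: replacing \<open>\<phi>\<close> by iterated averages along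
  directions of the interior cone costs only \<open>\<parallel>\<nabla>div v\<parallel> \<parallel>\<phi>\<parallel>\<close>, and the gradient of the averages is
  bounded by \<open>\<parallel>\<phi>\<parallel>\<close>.\<close>

section \<open>Completeness and orthogonal projections\<close>

text \<open>No mesh constant can arise because the adjoint problem is solved on \<Omega> itself and
  the mesh is seen only through a dual norm. Every existence statement (optimal test functions, the
  adjoint problem, minimal extensions of traces) is an orthogonal projection onto a graph in L2 x
  L2, and weak derivatives make these graphs closed. The obstacle is that \<open>Hgd\<close> does
  not ask div v to be a function, whereas the normal trace in \<open>Hgd_0\<close> is tested with H1
  functions only: before div \<tau> can be inserted for an arbitrary \<tau> in
  \<open>Hgd \<Omega>\<close>, it has to be shown to lie in H1. Interior regularity is not enough
  for that, since square integrability is wanted up to the boundary. This is where the cone of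
  directions pointing into \<Omega> comes from: averages of test functions along such short
  directions are again test functions on \<Omega>, also close to the boundary.\<close>

lemma square_integrable_rep_l2: "square_integrable (rep_l2 f)"
  using Quotient3_rep_reflp[OF Quotient3_l2, of f] by (simp add: l2rel_def)

lemma l2_of_rep_l2 [simp]: "l2_of (rep_l2 f) = f"
  by (rule Quotient3_abs_rep[OF Quotient3_l2])

lemma l2rel_refl [simp]: "l2rel f f \<longleftrightarrow> square_integrable f"
  by (simp add: l2rel_def)

lemma l2_of_eq_iff:
  assumes "square_integrable f" "square_integrable g"
  shows "l2_of f = l2_of g \<longleftrightarrow> (AE x in lborel. f x = g x)"
  using Quotient3_rel[OF Quotient3_l2, of f g] assms by (auto simp: l2rel_def)

lemma l2_of_add:
  "square_integrable f \<Longrightarrow> square_integrable g \<Longrightarrow> l2_of (\<lambda>x. f x + g x) = l2_of f + l2_of g"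
  by (simp add: plus_l2.abs_eq)

lemma l2_of_diff:
  "square_integrable f \<Longrightarrow> square_integrable g \<Longrightarrow> l2_of (\<lambda>x. f x - g x) = l2_of f - l2_of g"
  by (simp add: minus_l2.abs_eq)

lemma l2_of_scaleR:
  "square_integrable f \<Longrightarrow> l2_of (\<lambda>x. c *\<^sub>R f x) = c *\<^sub>R l2_of f"
  by (simp add: scaleR_l2.abs_eq)

lemma l2_of_zero: "l2_of (\<lambda>x. 0) = 0"
  by (simp add: zero_l2_def)

lemma square_integrable_sum:
  "(\<And>i. i \<in> I \<Longrightarrow> square_integrable (f i)) \<Longrightarrow> square_integrable (\<lambda>x. \<Sum>i\<in>I. f i x)"
  by (induction I rule: infinite_finite_induct)
    (auto simp: square_integrable_zero square_integrable_add)

lemma l2_of_sum: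
  "(\<And>i. i \<in> I \<Longrightarrow> square_integrable (f i)) \<Longrightarrow> l2_of (\<lambda>x. \<Sum>i\<in>I. f i x) = (\<Sum>i\<in>I. l2_of (f i))"
  by (induction I rule: infinite_finite_induct)
    (auto simp: l2_of_zero l2_of_add square_integrable_sum)

lemma inner_l2_of:
  "square_integrable f \<Longrightarrow> square_integrable g \<Longrightarrow> l2_of f \<bullet> l2_of g = (\<integral>x. f x \<bullet> g x \<partial>lborel)"
  by (simp add: inner_l2.abs_eq)

lemma norm_l2_of:
  "square_integrable f \<Longrightarrow> (norm (l2_of f))\<^sup>2 = (\<integral>x. (norm (f x))\<^sup>2 \<partial>lborel)"
  by (simp add: power2_norm_eq_inner inner_l2_of)

lemma norm_l2_of_le:
  assumes "square_integrable f" "square_integrable g" "AE x in lborel. norm (f x) \<le> norm (g x)"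
  shows "norm (l2_of f) \<le> norm (l2_of g)"
proof -
  have "(norm (l2_of f))\<^sup>2 \<le> (norm (l2_of g))\<^sup>2"
    unfolding norm_l2_of[OF assms(1)] norm_l2_of[OF assms(2)]
    using assms by (intro integral_mono_AE) (auto simp: square_integrable_def intro!: power_mono)
  then show ?thesis by (rule power2_le_imp_le) simp
qed

lemma nn_integral_norm_l2_of:
  assumes "square_integrable f"
  shows "(\<integral>\<^sup>+x. ennreal ((norm (f x))\<^sup>2) \<partial>lborel) = ennreal ((norm (l2_of f))\<^sup>2)"
  unfolding norm_l2_of[OF assms] using assms
  by (intro nn_integral_eq_integral) (auto simp: square_integrable_def)

lemma square_integrable_iff_nn_integral:
  assumes "f \<in> borel_measurable lborel"
  shows "square_integrable f \<longleftrightarrow> (\<integral>\<^sup>+x. ennreal ((norm (f x))\<^sup>2) \<partial>lborel) < \<infinity>"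
  using assms unfolding square_integrable_def by (auto simp: integrable_iff_bounded)

lemma square_integrable_bound:
  assumes "square_integrable g" "f \<in> borel_measurable lborel" "AE x in lborel. norm (f x) \<le> norm (g x)"
  shows "square_integrable f"
  unfolding square_integrable_def
proof
  have [measurable]: "f \<in> borel_measurable lborel" by fact
  show "integrable lborel (\<lambda>x. (norm (f x))\<^sup>2)"
  proof (rule Bochner_Integration.integrable_bound)
    show "integrable lborel (\<lambda>x. (norm (g x))\<^sup>2)"
      using assms(1) by (simp add: square_integrable_def)
    show "AE x in lborel. norm ((norm (f x))\<^sup>2) \<le> norm ((norm (g x))\<^sup>2)"
      using assms(3) by (rule eventually_mono) (simp add: power_mono)
  qed measurable
qed fact

text \<open>The partial sums of the pointwise norms increase and stay below 2 in L2 by the geometric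
  series; by monotone convergence the supremum of their squares is integrable, hence finite almost
  everywhere.\<close>

lemma summable_AE_if_summable_norm:
  fixes D :: "nat \<Rightarrow> 'a::euclidean_space \<Rightarrow> 'b::euclidean_space"
  assumes D: "\<And>n. square_integrable (D n)" and b: "\<And>n. norm (l2_of (D n)) \<le> (1/2)^n"
  shows "AE x in lborel. summable (\<lambda>n. norm (D n x))"
proof -
  have [measurable]: "D n \<in> borel_measurable lborel" for n
    using D by (simp add: square_integrable_def)
  have sn: "square_integrable (\<lambda>x. norm (D n x))" for n
    using D[of n] by (simp add: square_integrable_def)
  define S where "S N x = (\<Sum>n<N. norm (D n x))" for N x
  have [measurable]: "S N \<in> borel_measurable lborel" for N
    unfolding S_def by measurable
  have S0: "S N x \<ge> 0" for N x
    unfolding S_def by (intro sum_nonneg) auto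
  have "norm (l2_of (S N)) \<le> 2" for N
  proof -
    have "norm (l2_of (S N)) = norm (\<Sum>n<N. l2_of (\<lambda>x. norm (D n x)))"
      unfolding S_def using sn by (subst l2_of_sum) auto
    also have "\<dots> \<le> (\<Sum>n<N. norm (l2_of (\<lambda>x. norm (D n x))))" by (rule norm_sum)
    also have "\<dots> \<le> (\<Sum>n<N. (1/2)^n)"
      using norm_l2_of_le[OF sn D] b by (intro sum_mono) (auto intro: order_trans)
    also have "\<dots> \<le> 2" by (subst sum_gp_strict) auto
    finally show ?thesis .
  qed
  moreover have sS: "square_integrable (S N)" for N
    unfolding S_def using sn by (intro square_integrable_sum)
  ultimately have nS: "(\<integral>\<^sup>+x. ennreal ((S N x)\<^sup>2) \<partial>lborel) \<le> 4" for N
    using nn_integral_norm_l2_of[of "S N"] power_mono[of "norm (l2_of (S N))" 2 2]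
    by (auto simp: ennreal_le_iff2 simp flip: ennreal_numeral)
  have mono: "incseq (\<lambda>N x. ennreal ((S N x)\<^sup>2))"
    by (intro incseq_SucI le_funI ennreal_leI power_mono S0) (simp add: S_def)
  have "(\<integral>\<^sup>+x. (SUP N. ennreal ((S N x)\<^sup>2)) \<partial>lborel) = (SUP N. \<integral>\<^sup>+x. ennreal ((S N x)\<^sup>2) \<partial>lborel)"
    by (intro nn_integral_monotone_convergence_SUP mono) simp
  also have "\<dots> \<le> 4" using nS by (intro SUP_least)
  finally have "(\<integral>\<^sup>+x. (SUP N. ennreal ((S N x)\<^sup>2)) \<partial>lborel) \<noteq> \<infinity>"
    by (auto simp: top_unique)
  then have "AE x in lborel. (SUP N. ennreal ((S N x)\<^sup>2)) \<noteq> \<infinity>"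
    by (intro nn_integral_noteq_infinite) auto
  then show ?thesis
  proof (rule eventually_mono)
    fix x assume "(SUP N. ennreal ((S N x)\<^sup>2)) \<noteq> \<infinity>"
    then obtain c where c: "(SUP N. ennreal ((S N x)\<^sup>2)) = ennreal c" "c \<ge> 0"
      by (metis ennreal_cases infinity_ennreal_def)
    have Sc: "S N x \<le> sqrt c" for N
    proof -
      have "ennreal ((S N x)\<^sup>2) \<le> ennreal c" unfolding c(1)[symmetric] by (rule SUP_upper) simp
      then show ?thesis using c(2) by (intro real_le_rsqrt) auto
    qed
    show "summable (\<lambda>n. norm (D n x))"
      by (rule summableI_nonneg_bounded[of _ "sqrt c"]) (use Sc in \<open>auto simp: S_def\<close>)
  qed
qed

text \<open>Riesz-Fischer. A subsequence with steps at most (1/2)^k converges almost everywhere,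
  Fatou shows that the pointwise limit is also the L2 limit, and a Cauchy sequence follows its
  subsequence.\<close>

instance l2 :: (euclidean_space, euclidean_space) complete_space
proof
  fix X :: "nat \<Rightarrow> ('a, 'b) l2" assume "Cauchy X"
  then have "\<forall>e>0. \<exists>M. \<forall>m\<ge>M. \<forall>n\<ge>M. dist (X m) (X n) < e" by (simp add: Cauchy_def)
  then have "\<forall>k. \<exists>M. \<forall>m\<ge>M. \<forall>n\<ge>M. dist (X m) (X n) < (1/2)^k" by simp
  then obtain M where M: "\<And>k m n. m \<ge> M k \<Longrightarrow> n \<ge> M k \<Longrightarrow> dist (X m) (X n) < (1/2)^k" by metis
  \<comment> \<open>The sum dominates every threshold up to \<open>k\<close>, in particular
    \<open>M k\<close>, and the summand \<open>k\<close> makes \<open>s\<close> strictly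
    increasing.\<close>
  define s where "s k = (\<Sum>j\<le>k. M j) + k" for k
  have sM: "s k \<ge> M k" for k
    unfolding s_def by (rule trans_le_add1) (rule member_le_sum; simp)
  have ss: "strict_mono s" by (rule strict_mono_Suc_iff[THEN iffD2]) (simp add: s_def)
  define F where "F k = rep_l2 (X (s k))" for k
  have F: "square_integrable (F k)" for k unfolding F_def by (rule square_integrable_rep_l2)
  then have [measurable]: "F k \<in> borel_measurable lborel" for k
    by (simp add: square_integrable_def)
  have lF: "l2_of (F k) = X (s k)" for k unfolding F_def by simp
  define D where "D k x = F (Suc k) x - F k x" for k x
  have sD: "square_integrable (D k)" for k unfolding D_def by (intro square_integrable_diff F)
  have "norm (l2_of (D k)) \<le> (1/2)^k" for k
    unfolding D_def using M[of k "s (Suc k)" "s k"] sM[of k] strict_monoD[OF ss, of k "Suc k"]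
    by (simp add: l2_of_diff F lF dist_norm)
  from summable_AE_if_summable_norm[OF sD this]
  have conv: "AE x in lborel. convergent (\<lambda>k. F k x)"
  proof (rule eventually_mono)
    fix x assume "summable (\<lambda>n. norm (D n x))"
    then have "convergent (\<lambda>n. \<Sum>k<n. F (Suc k) x - F k x)"
      unfolding D_def by (simp add: summable_norm_cancel summable_iff_convergent[symmetric])
    then have "convergent (\<lambda>n. F n x - F 0 x)" by (subst (asm) sum_lessThan_telescope[of "\<lambda>k. F k x"])
    then have "convergent (\<lambda>n. (F n x - F 0 x) + F 0 x)" by (intro convergent_add) (auto simp: convergent_const)
    then show "convergent (\<lambda>k. F k x)" by simp
  qed
  define f where "f x = lim (\<lambda>k. F k x)" for x
  have [measurable]: "f \<in> borel_measurable lborel" unfolding f_def by measurable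
  have lim: "AE x in lborel. (\<lambda>k. F k x) \<longlonglongrightarrow> f x"
    using conv by (rule eventually_mono) (simp add: f_def convergent_LIMSEQ_iff)
  have bd: "(\<integral>\<^sup>+x. ennreal ((norm (f x - F k x))\<^sup>2) \<partial>lborel) \<le> ennreal (((1/2)^k)\<^sup>2)" for k
  proof -
    have "(\<integral>\<^sup>+x. ennreal ((norm (f x - F k x))\<^sup>2) \<partial>lborel)
      = (\<integral>\<^sup>+x. liminf (\<lambda>m. ennreal ((norm (F m x - F k x))\<^sup>2)) \<partial>lborel)"
    proof (rule nn_integral_cong_AE, rule eventually_mono[OF lim])
      fix x assume "(\<lambda>k. F k x) \<longlonglongrightarrow> f x"
      then have "(\<lambda>m. ennreal ((norm (F m x - F k x))\<^sup>2)) \<longlonglongrightarrow> ennreal ((norm (f x - F k x))\<^sup>2)"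
        by (intro tendsto_intros tendsto_ennrealI)
      then show "ennreal ((norm (f x - F k x))\<^sup>2) = liminf (\<lambda>m. ennreal ((norm (F m x - F k x))\<^sup>2))"
        by (rule lim_imp_Liminf[OF trivial_limit_sequentially, symmetric])
    qed
    also have "\<dots> \<le> liminf (\<lambda>m. \<integral>\<^sup>+x. ennreal ((norm (F m x - F k x))\<^sup>2) \<partial>lborel)"
      by (rule nn_integral_liminf) measurable
    also have "\<dots> \<le> ennreal (((1/2)^k)\<^sup>2)"
    proof (rule Liminf_le)
      show "\<forall>\<^sub>F m in sequentially. (\<integral>\<^sup>+x. ennreal ((norm (F m x - F k x))\<^sup>2) \<partial>lborel) \<le> ennreal (((1/2)^k)\<^sup>2)"
      proof (rule eventually_sequentiallyI[of k])
        fix m assume "k \<le> m"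
        then have "s k \<le> s m" using ss by (simp add: strict_mono_less_eq)
        then have "norm (X (s m) - X (s k)) \<le> (1/2)^k"
          using M[of k "s m" "s k"] sM[of k] by (simp add: dist_norm)
        then show "(\<integral>\<^sup>+x. ennreal ((norm (F m x - F k x))\<^sup>2) \<partial>lborel) \<le> ennreal (((1/2)^k)\<^sup>2)"
          by (subst nn_integral_norm_l2_of)
            (auto intro!: square_integrable_diff F ennreal_leI power_mono simp: l2_of_diff F lF)
      qed
    qed auto
    finally show ?thesis .
  qed
  have sf: "square_integrable (\<lambda>x. f x - F k x)" for k
    using bd[of k] by (subst square_integrable_iff_nn_integral) (auto simp: le_less_trans)
  have "square_integrable (\<lambda>x. (f x - F 0 x) + F 0 x)" by (rule square_integrable_add[OF sf F])
  then have f: "square_integrable f" by simp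
  have nb: "norm (l2_of f - X (s k)) \<le> (1/2)^k" for k
  proof -
    have "ennreal ((norm (l2_of f - X (s k)))\<^sup>2) \<le> ennreal (((1/2)^k)\<^sup>2)"
      using bd[of k] by (subst (asm) nn_integral_norm_l2_of[OF sf]) (simp add: l2_of_diff F f lF)
    then have "(norm (l2_of f - X (s k)))\<^sup>2 \<le> ((1/2)^k)\<^sup>2"
      by (subst (asm) ennreal_le_iff) (rule zero_le_power2)
    then show ?thesis by (rule power2_le_imp_le) simp
  qed
  have "(X \<circ> s) \<longlonglongrightarrow> l2_of f"
  proof (rule LIM_zero_cancel, rule Lim_null_comparison)
    show "\<forall>\<^sub>F k in sequentially. norm ((X \<circ> s) k - l2_of f) \<le> (1/2)^k"
      using nb by (intro always_eventually) (simp add: norm_minus_commute)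
    show "(\<lambda>k. (1/2::real)^k) \<longlonglongrightarrow> 0" by (rule LIMSEQ_realpow_zero) simp_all
  qed
  from Cauchy_converges_subseq[OF \<open>Cauchy X\<close> ss this]
  show "convergent X" by (auto simp: convergent_def)
qed

text \<open>A minimising sequence for the distance is Cauchy by the parallelogram law; orthogonality
  is the first-order condition at the minimum.\<close>

lemma ex_orthogonal_projection:
  fixes S :: "'a::{real_inner, complete_space} set"
  assumes S: "subspace S" "closed S"
  shows "\<exists>y\<in>S. \<forall>z\<in>S. (x - y) \<bullet> z = 0"
proof -
  define D where "D = (INF y\<in>S. (norm (x - y))\<^sup>2)"
  have bdd: "bdd_below ((\<lambda>y. (norm (x - y))\<^sup>2) ` S)" by (rule bdd_belowI[of _ 0]) auto
  have D: "D \<le> (norm (x - y))\<^sup>2" if "y \<in> S" for y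
    unfolding D_def using bdd that by (rule cINF_lower)
  have "S \<noteq> {}" using subspace_0[OF S(1)] by auto
  then have "\<exists>y\<in>S. (norm (x - y))\<^sup>2 < D + 1 / Suc n" for n
    unfolding D_def using bdd by (subst cINF_less_iff[symmetric]) auto
  then obtain y where y: "\<And>n. y n \<in> S" "\<And>n. (norm (x - y n))\<^sup>2 < D + 1 / Suc n" by metis
  have par: "(norm (y m - y n))\<^sup>2 \<le> 2 / Suc m + 2 / Suc n" for m n
  proof -
    \<comment> \<open>The midpoint competes for the minimum \<open>D\<close>, which bounds the last
      term of the parallelogram law.\<close>
    have "(1/2) *\<^sub>R (y m + y n) \<in> S" using S(1) y by (simp add: subspace_add subspace_scale)
    then have "D \<le> (norm (x - (1/2) *\<^sub>R (y m + y n)))\<^sup>2" by (rule D)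
    moreover have "(norm (y m - y n))\<^sup>2 = 2 * (norm (x - y m))\<^sup>2 + 2 * (norm (x - y n))\<^sup>2
        - 4 * (norm (x - (1/2) *\<^sub>R (y m + y n)))\<^sup>2"
      unfolding power2_norm_eq_inner by (simp add: algebra_simps inner_commute)
    ultimately show ?thesis using y(2)[of m] y(2)[of n] by (simp add: algebra_simps)
  qed
  have "Cauchy y"
  proof (rule CauchyI)
    fix e :: real assume "e > 0"
    then obtain N :: nat where N: "4 / e\<^sup>2 < N" using reals_Archimedean2 by blast
    show "\<exists>M. \<forall>m\<ge>M. \<forall>n\<ge>M. norm (y m - y n) < e"
    proof (intro exI allI impI)
      fix m n assume mn: "m \<ge> N" "n \<ge> N"
      have "4 < e\<^sup>2 * N" using N \<open>e > 0\<close> by (simp add: field_simps)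
      also have "\<dots> \<le> e\<^sup>2 * Suc k" if "k \<ge> N" for k
        using that by (intro mult_left_mono) auto
      finally have "2 / Suc k < e\<^sup>2 / 2" if "k \<ge> N" for k
        using that by (simp add: field_simps)
      from this[OF mn(1)] this[OF mn(2)] par[of m n]
      have "(norm (y m - y n))\<^sup>2 < e\<^sup>2" by linarith
      then show "norm (y m - y n) < e" using \<open>e > 0\<close> by (auto intro: power2_less_imp_less)
    qed
  qed
  then obtain l where l: "y \<longlonglongrightarrow> l" using Cauchy_convergent_iff convergent_def by blast
  have lS: "l \<in> S" using S(2) y(1) l closed_sequentially by blast
  have "(\<lambda>n. D + 1 / Suc n) \<longlonglongrightarrow> D + 0"
    by (intro tendsto_intros LIMSEQ_Suc[OF lim_const_over_n])
  then have nl: "(norm (x - l))\<^sup>2 \<le> D"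
    by (intro LIMSEQ_le[of "\<lambda>n. (norm (x - y n))\<^sup>2" _ "\<lambda>n. D + 1 / Suc n"])
      (use y(2) in \<open>auto intro!: tendsto_intros l less_imp_le\<close>)
  have "(x - l) \<bullet> z = 0" if "z \<in> S" for z
  proof (cases "z = 0")
    case False
    \<comment> \<open>The optimal step along \<open>z\<close>: it would lower the squared distance
      by the square of (x - l) \<bullet> z divided by z \<bullet> z, which must therefore be
      0.\<close>
    define t where "t = ((x - l) \<bullet> z) / (z \<bullet> z)"
    have "l + t *\<^sub>R z \<in> S" using S(1) lS that by (simp add: subspace_add subspace_scale)
    then have "(norm (x - l))\<^sup>2 \<le> (norm (x - (l + t *\<^sub>R z)))\<^sup>2" using D[of "l + t *\<^sub>R z"] nl by linarith
    also have "\<dots> = (norm (x - l))\<^sup>2 - 2 * t * ((x - l) \<bullet> z) + t * t * (z \<bullet> z)"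
      unfolding power2_norm_eq_inner by (simp add: algebra_simps inner_commute)
    also have "\<dots> = (norm (x - l))\<^sup>2 - ((x - l) \<bullet> z)\<^sup>2 / (z \<bullet> z)"
      using False by (simp add: t_def power2_eq_square)
    finally have "((x - l) \<bullet> z)\<^sup>2 / (z \<bullet> z) \<le> 0" by simp
    moreover have "z \<bullet> z > 0" using False by simp
    ultimately show ?thesis by (simp add: divide_le_0_iff)
  qed simp
  with lS show ?thesis by blast
qed

lemma subspace_closure:
  fixes S :: "'a::real_normed_vector set"
  assumes "subspace S"
  shows "subspace (closure S)"
  unfolding subspace_def
proof (intro conjI ballI allI)
  show "0 \<in> closure S" using subspace_0[OF assms] closure_subset by blast
next
  fix x y assume "x \<in> closure S" "y \<in> closure S"
  then obtain f g where "\<forall>n. f n \<in> S" "f \<longlonglongrightarrow> x" "\<forall>n. g n \<in> S" "g \<longlonglongrightarrow> y"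
    unfolding closure_sequential by blast
  then have "\<forall>n. f n + g n \<in> S" "(\<lambda>n. f n + g n) \<longlonglongrightarrow> x + y"
    using assms by (auto intro: subspace_add tendsto_add)
  then show "x + y \<in> closure S"
    unfolding closure_sequential by (intro exI[of _ "\<lambda>n. f n + g n"]) auto
next
  fix c x assume "x \<in> closure S"
  then obtain f where "\<forall>n. f n \<in> S" "f \<longlonglongrightarrow> x"
    unfolding closure_sequential by blast
  then have "\<forall>n. c *\<^sub>R f n \<in> S" "(\<lambda>n. c *\<^sub>R f n) \<longlonglongrightarrow> c *\<^sub>R x"
    using assms by (auto intro: subspace_scale tendsto_scaleR)
  then show "c *\<^sub>R x \<in> closure S"
    unfolding closure_sequential by (intro exI[of _ "\<lambda>n. c *\<^sub>R f n"]) auto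
qed

section \<open>Smooth functions\<close>

definition smooth_fun :: "('a::euclidean_space \<Rightarrow> 'b::real_normed_vector) \<Rightarrow> bool" where
  "smooth_fun \<phi> \<longleftrightarrow> (\<forall>k. C_k k \<phi>)"

definition dir_deriv :: "('a::euclidean_space \<Rightarrow> 'b::real_normed_vector) \<Rightarrow> 'a \<Rightarrow> 'a \<Rightarrow> 'b" where
  "dir_deriv \<phi> h x = frechet_derivative \<phi> (at x) h"

lemma C_k_Suc_iff:
  "C_k (Suc k) \<phi> \<longleftrightarrow> (\<forall>x. \<phi> differentiable (at x)) \<and> (\<forall>i\<in>Basis. C_k k (dir_deriv \<phi> i))"
  unfolding C_k.simps dir_deriv_def[abs_def] by (rule refl)

lemma C_k_SucI:
  assumes "\<And>x. (\<phi> has_derivative D x) (at x)" "\<And>i. i \<in> Basis \<Longrightarrow> C_k k (\<lambda>x. D x i)"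
  shows "C_k (Suc k) \<phi>"
proof -
  have "frechet_derivative \<phi> (at x) = D x" for x
    using frechet_derivative_at[OF assms(1)] by simp
  then show ?thesis using assms by (auto simp: differentiable_def)
qed

lemma C_k_SucD:
  assumes "C_k (Suc k) \<phi>"
  shows "(\<phi> has_derivative (\<lambda>h. dir_deriv \<phi> h x)) (at x)" "i \<in> Basis \<Longrightarrow> C_k k (dir_deriv \<phi> i)"
  using assms by (auto simp: dir_deriv_def[abs_def] frechet_derivative_works[symmetric])

lemma C_k_continuous: "C_k k \<phi> \<Longrightarrow> continuous_on UNIV \<phi>"
  by (cases k) (auto simp: continuous_on_eq_continuous_at dest: differentiable_imp_continuous_within)

declare C_k.simps(2) [simp del]

lemma C_k_le_Suc: "C_k (Suc k) \<phi> \<Longrightarrow> C_k k \<phi>"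
proof (induction k arbitrary: \<phi>)
  case 0
  then show ?case using C_k_continuous[OF 0] by simp
next
  case (Suc k)
  show ?case
    using Suc.prems Suc.IH unfolding C_k_Suc_iff[of k] C_k_Suc_iff[of "Suc k"] by blast
qed

lemma C_k_const: "C_k k (\<lambda>x. c)"
proof (induction k arbitrary: c)
  case (Suc k)
  show ?case by (rule C_k_SucI[where D="\<lambda>x h. 0"]) (auto simp: Suc)
qed simp

lemma C_k_bounded_linear:
  assumes "bounded_linear L"
  shows "C_k k \<phi> \<Longrightarrow> C_k k (\<lambda>x. L (\<phi> x))"
proof (induction k arbitrary: \<phi>)
  case 0
  then show ?case using bounded_linear.continuous_on[OF assms] by auto
next
  case (Suc k)
  show ?case
    by (rule C_k_SucI[where D="\<lambda>x h. L (dir_deriv \<phi> h x)"])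
      (auto intro!: bounded_linear.has_derivative[OF assms] Suc C_k_SucD[OF Suc(2)])
qed

lemma C_k_add: "C_k k \<phi> \<Longrightarrow> C_k k \<psi> \<Longrightarrow> C_k k (\<lambda>x. \<phi> x + \<psi> x)"
proof (induction k arbitrary: \<phi> \<psi>)
  case 0
  then show ?case by (simp add: continuous_on_add)
next
  case (Suc k)
  show ?case
    by (rule C_k_SucI[where D="\<lambda>x h. dir_deriv \<phi> h x + dir_deriv \<psi> h x"])
      (auto intro!: derivative_intros Suc.IH C_k_SucD[OF Suc(2)] C_k_SucD[OF Suc(3)])
qed

lemma C_k_scaleR:
  fixes \<phi> :: "'a::euclidean_space \<Rightarrow> real"
  shows "C_k k \<phi> \<Longrightarrow> C_k k \<psi> \<Longrightarrow> C_k k (\<lambda>x. \<phi> x *\<^sub>R \<psi> x)"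
proof (induction k arbitrary: \<phi> \<psi>)
  case 0
  then show ?case by (simp add: continuous_on_scaleR)
next
  case (Suc k)
  show ?case
    by (rule C_k_SucI[where D="\<lambda>x h. \<phi> x *\<^sub>R dir_deriv \<psi> h x + dir_deriv \<phi> h x *\<^sub>R \<psi> x"])
      (auto intro!: derivative_intros C_k_add Suc.IH C_k_SucD[OF Suc(2)] C_k_SucD[OF Suc(3)]
        C_k_le_Suc[OF Suc(2)] C_k_le_Suc[OF Suc(3)])
qed

lemma C_k_mult:
  fixes \<phi> :: "'a::euclidean_space \<Rightarrow> real"
  shows "C_k k \<phi> \<Longrightarrow> C_k k \<psi> \<Longrightarrow> C_k k (\<lambda>x. \<phi> x * \<psi> x)"
  using C_k_scaleR[of k \<phi> \<psi>] by simp

text \<open>The chain rule leads from \<open>G n\<close> to \<open>G (Suc n)\<close>, so the whole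
  sequence of derivatives of the outer function is carried through the induction.\<close>

lemma C_k_compose_real:
  fixes \<phi> :: "'a::euclidean_space \<Rightarrow> real" and G :: "nat \<Rightarrow> real \<Rightarrow> real"
  assumes G: "\<And>n y. (G n has_real_derivative G (Suc n) y) (at y)"
  shows "C_k k \<phi> \<Longrightarrow> C_k k (\<lambda>x. G n (\<phi> x))"
proof (induction k arbitrary: n)
  case 0
  have "continuous_on UNIV (G n)" using G by (meson DERIV_continuous_on DERIV_subset subset_UNIV)
  then show ?case using 0 by (auto intro: continuous_on_compose2)
next
  case (Suc k)
  show ?case
  proof (rule C_k_SucI[where D="\<lambda>x h. G (Suc n) (\<phi> x) * dir_deriv \<phi> h x"])
    fix x
    have "(G n has_derivative (*) (G (Suc n) (\<phi> x))) (at (\<phi> x))"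
      using G[of n "\<phi> x"] by (simp add: has_field_derivative_def)
    from has_derivative_compose[OF C_k_SucD(1)[OF Suc(2)] this]
    show "((\<lambda>x. G n (\<phi> x)) has_derivative (\<lambda>h. G (Suc n) (\<phi> x) * dir_deriv \<phi> h x)) (at x)" by simp
  qed (auto intro!: C_k_mult Suc.IH C_k_le_Suc[OF Suc(2)] C_k_SucD[OF Suc(2)])
qed

lemma C_k_inverse:
  fixes \<phi> :: "'a::euclidean_space \<Rightarrow> real"
  assumes "\<And>x. \<phi> x \<noteq> 0"
  shows "C_k k \<phi> \<Longrightarrow> C_k k (\<lambda>x. inverse (\<phi> x))"
proof (induction k)
  case 0
  then show ?case using assms by (simp add: continuous_on_inverse)
next
  case (Suc k)
  show ?case
  \<comment> \<open>The derivative contains the inverse itself, to which the induction hypothesis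
    applies; -1 stays a factor so that only products and constants occur.\<close>
  proof (rule C_k_SucI[where D="\<lambda>x h. (-1) * (inverse (\<phi> x) * dir_deriv \<phi> h x * inverse (\<phi> x))"])
    show "((\<lambda>x. inverse (\<phi> x)) has_derivative (\<lambda>h. (-1) * (inverse (\<phi> x) * dir_deriv \<phi> h x * inverse (\<phi> x)))) (at x)" for x
      using Deriv.has_derivative_inverse[OF assms C_k_SucD(1)[OF Suc(2)]] by simp
  qed (intro C_k_mult C_k_const Suc.IH C_k_le_Suc[OF Suc(2)] C_k_SucD[OF Suc(2)])+
qed

section \<open>Closure properties of smooth functions\<close>

lemma smooth_fun_const: "smooth_fun (\<lambda>x. c)"
  by (simp add: smooth_fun_def C_k_const)

lemma smooth_fun_add: "smooth_fun \<phi> \<Longrightarrow> smooth_fun \<psi> \<Longrightarrow> smooth_fun (\<lambda>x. \<phi> x + \<psi> x)"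
  by (simp add: smooth_fun_def C_k_add)

lemma smooth_fun_scaleR:
  fixes \<phi> :: "'a::euclidean_space \<Rightarrow> real"
  shows "smooth_fun \<phi> \<Longrightarrow> smooth_fun \<psi> \<Longrightarrow> smooth_fun (\<lambda>x. \<phi> x *\<^sub>R \<psi> x)"
  by (simp add: smooth_fun_def C_k_scaleR)

lemma smooth_fun_mult:
  fixes \<phi> :: "'a::euclidean_space \<Rightarrow> real"
  shows "smooth_fun \<phi> \<Longrightarrow> smooth_fun \<psi> \<Longrightarrow> smooth_fun (\<lambda>x. \<phi> x * \<psi> x)"
  by (simp add: smooth_fun_def C_k_mult)

lemma smooth_fun_bounded_linear: "bounded_linear L \<Longrightarrow> smooth_fun \<phi> \<Longrightarrow> smooth_fun (\<lambda>x. L (\<phi> x))"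
  by (simp add: smooth_fun_def C_k_bounded_linear)

lemma smooth_fun_diff: "smooth_fun \<phi> \<Longrightarrow> smooth_fun \<psi> \<Longrightarrow> smooth_fun (\<lambda>x. \<phi> x - \<psi> x)"
  using smooth_fun_add[of \<phi> "\<lambda>x. - \<psi> x"] smooth_fun_bounded_linear[of uminus \<psi>]
  by (simp add: bounded_linear_minus[OF bounded_linear_ident])

lemma smooth_fun_sum: "(\<And>i. i \<in> I \<Longrightarrow> smooth_fun (f i)) \<Longrightarrow> smooth_fun (\<lambda>x. \<Sum>i\<in>I. f i x)"
  by (induction I rule: infinite_finite_induct) (auto intro: smooth_fun_const smooth_fun_add)

lemma smooth_fun_prod:
  fixes f :: "'i \<Rightarrow> 'a::euclidean_space \<Rightarrow> real"
  shows "(\<And>i. i \<in> I \<Longrightarrow> smooth_fun (f i)) \<Longrightarrow> smooth_fun (\<lambda>x. \<Prod>i\<in>I. f i x)"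
  by (induction I rule: infinite_finite_induct) (auto intro: smooth_fun_const smooth_fun_mult)

lemma smooth_fun_continuous: "smooth_fun \<phi> \<Longrightarrow> continuous_on A \<phi>"
  unfolding smooth_fun_def by (meson C_k_continuous continuous_on_subset subset_UNIV)

lemma smooth_fun_has_derivative: "smooth_fun \<phi> \<Longrightarrow> (\<phi> has_derivative (\<lambda>h. dir_deriv \<phi> h x)) (at x)"
  unfolding smooth_fun_def using C_k_SucD(1) by blast

lemma dir_deriv_eqI: "(\<phi> has_derivative D) (at x) \<Longrightarrow> dir_deriv \<phi> h x = D h"
  unfolding dir_deriv_def using frechet_derivative_at by metis

lemma dir_deriv_basis:
  assumes "smooth_fun \<phi>"
  shows "dir_deriv \<phi> h x = (\<Sum>i\<in>Basis. (h \<bullet> i) *\<^sub>R dir_deriv \<phi> i x)"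
proof -
  have lin: "linear (\<lambda>h. dir_deriv \<phi> h x)"
    using smooth_fun_has_derivative[OF assms] has_derivative_linear by blast
  have "dir_deriv \<phi> (\<Sum>i\<in>Basis. (h \<bullet> i) *\<^sub>R i) x = (\<Sum>i\<in>Basis. (h \<bullet> i) *\<^sub>R dir_deriv \<phi> i x)"
    using linear_sum[OF lin, of "\<lambda>i. (h \<bullet> i) *\<^sub>R i" Basis] linear_scale[OF lin] by simp
  then show ?thesis by (simp add: euclidean_representation)
qed

lemma smooth_fun_dir_deriv:
  assumes "smooth_fun \<phi>"
  shows "smooth_fun (dir_deriv \<phi> h)"
proof -
  have "smooth_fun (dir_deriv \<phi> i)" if "i \<in> Basis" for i
    using assms that unfolding smooth_fun_def using C_k_SucD(2) by blast
  then have "smooth_fun (\<lambda>x. \<Sum>i\<in>Basis. (h \<bullet> i) *\<^sub>R dir_deriv \<phi> i x)"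
    by (intro smooth_fun_sum smooth_fun_scaleR smooth_fun_const)
  then show ?thesis by (subst dir_deriv_basis[OF assms, abs_def])
qed

text \<open>A coinductive rule for functions whose partial derivatives have the same form, such as
  translates and averages of smooth functions; \<open>S\<close> is the invariant.\<close>

lemma smooth_funI:
  assumes "\<phi> \<in> S"
    and "\<And>f. f \<in> S \<Longrightarrow> \<exists>D. (\<forall>x. (f has_derivative D x) (at x)) \<and> (\<forall>i\<in>Basis. (\<lambda>x. D x i) \<in> S)"
  shows "smooth_fun \<phi>"
  unfolding smooth_fun_def
proof
  fix k show "C_k k \<phi>"
    using assms(1)
  proof (induction k arbitrary: \<phi>)
    case 0
    obtain D where "\<forall>x. (\<phi> has_derivative D x) (at x)" using assms(2)[OF 0] by blast
    then have "continuous_on UNIV \<phi>"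
      by (meson continuous_at_imp_continuous_on has_derivative_continuous)
    then show ?case by simp
  next
    case (Suc k)
    obtain D where "\<forall>x. (\<phi> has_derivative D x) (at x)" "\<forall>i\<in>Basis. (\<lambda>x. D x i) \<in> S"
      using assms(2)[OF Suc(2)] by blast
    then show ?case using Suc.IH by (intro C_k_SucI) auto
  qed
qed

section \<open>Test functions and their stability\<close>

lemma test_fun_iff:
  "\<phi> \<in> test_fun U \<longleftrightarrow> smooth_fun \<phi> \<and> (\<exists>K. compact K \<and> K \<subseteq> U \<and> (\<forall>x. x \<notin> K \<longrightarrow> \<phi> x = 0))"
proof
  assume "\<phi> \<in> test_fun U"
  then show "smooth_fun \<phi> \<and> (\<exists>K. compact K \<and> K \<subseteq> U \<and> (\<forall>x. x \<notin> K \<longrightarrow> \<phi> x = 0))"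
    using closure_subset[of "{x. \<phi> x \<noteq> 0}"]
    by (intro conjI exI[of _ "closure {x. \<phi> x \<noteq> 0}"]) (auto simp: test_fun_def smooth_fun_def)
next
  assume "smooth_fun \<phi> \<and> (\<exists>K. compact K \<and> K \<subseteq> U \<and> (\<forall>x. x \<notin> K \<longrightarrow> \<phi> x = 0))"
  then obtain K where K: "smooth_fun \<phi>" "compact K" "K \<subseteq> U" "\<forall>x. x \<notin> K \<longrightarrow> \<phi> x = 0" by blast
  have "closure {x. \<phi> x \<noteq> 0} \<subseteq> K"
    by (rule closure_minimal) (use K in \<open>auto simp: compact_imp_closed\<close>)
  moreover have "bounded {x. \<phi> x \<noteq> 0}"
    by (rule bounded_subset[OF compact_imp_bounded[OF K(2)]]) (use K in auto)
  ultimately show "\<phi> \<in> test_fun U"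
    using K unfolding test_fun_def smooth_fun_def by auto
qed

lemma test_funE:
  assumes "\<phi> \<in> test_fun U"
  obtains K where "smooth_fun \<phi>" "compact K" "K \<subseteq> U" "\<And>x. x \<notin> K \<Longrightarrow> \<phi> x = 0"
  using assms unfolding test_fun_iff by blast

lemma test_funI:
  "smooth_fun \<phi> \<Longrightarrow> compact K \<Longrightarrow> K \<subseteq> U \<Longrightarrow> (\<And>x. x \<notin> K \<Longrightarrow> \<phi> x = 0) \<Longrightarrow> \<phi> \<in> test_fun U"
  unfolding test_fun_iff by blast

lemma test_fun_smooth: "\<phi> \<in> test_fun U \<Longrightarrow> smooth_fun \<phi>"
  by (simp add: test_fun_iff)

lemma test_fun_mono: "U \<subseteq> U' \<Longrightarrow> \<phi> \<in> test_fun U \<Longrightarrow> \<phi> \<in> test_fun U'"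
  unfolding test_fun_iff by blast

lemma test_fun_zero_off: "\<phi> \<in> test_fun U \<Longrightarrow> x \<notin> U \<Longrightarrow> \<phi> x = 0"
  unfolding test_fun_iff by blast

lemma test_fun_zero: "(\<lambda>x. 0) \<in> test_fun U"
  by (rule test_funI[of _ "{}"]) (auto simp: smooth_fun_const)

lemma test_fun_add:
  assumes "\<phi> \<in> test_fun U" "\<psi> \<in> test_fun U"
  shows "(\<lambda>x. \<phi> x + \<psi> x) \<in> test_fun U"
proof -
  obtain K L where "smooth_fun \<phi>" "compact K" "K \<subseteq> U" "\<And>x. x \<notin> K \<Longrightarrow> \<phi> x = 0"
      "smooth_fun \<psi>" "compact L" "L \<subseteq> U" "\<And>x. x \<notin> L \<Longrightarrow> \<psi> x = 0"
    using assms by (meson test_funE)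
  then show ?thesis by (intro test_funI[of _ "K \<union> L"]) (auto intro: smooth_fun_add)
qed

lemma test_fun_scaleR_left:
  fixes \<psi> :: "'a::euclidean_space \<Rightarrow> real"
  assumes "\<psi> \<in> test_fun U" "smooth_fun \<phi>"
  shows "(\<lambda>x. \<psi> x *\<^sub>R \<phi> x) \<in> test_fun U"
  using assms by (elim test_funE) (rule test_funI, auto intro: smooth_fun_scaleR)

lemma test_fun_scaleR_right:
  fixes \<psi> :: "'a::euclidean_space \<Rightarrow> real"
  assumes "smooth_fun \<psi>" "\<phi> \<in> test_fun U"
  shows "(\<lambda>x. \<psi> x *\<^sub>R \<phi> x) \<in> test_fun U"
  using assms(2) by (elim test_funE) (rule test_funI, auto intro: smooth_fun_scaleR assms)

lemma test_fun_sum: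
  "(\<And>i. i \<in> I \<Longrightarrow> f i \<in> test_fun U) \<Longrightarrow> (\<lambda>x. \<Sum>i\<in>I. f i x) \<in> test_fun U"
  by (induction I rule: infinite_finite_induct) (auto intro: test_fun_zero test_fun_add)

lemma test_fun_bounded_linear:
  assumes "bounded_linear L" "\<phi> \<in> test_fun U"
  shows "(\<lambda>x. L (\<phi> x)) \<in> test_fun U"
  using assms(2)
  by (elim test_funE) (rule test_funI,
    auto intro: smooth_fun_bounded_linear assms simp: linear_0[OF bounded_linear.linear[OF assms(1)]])

lemma test_fun_dir_deriv:
  assumes "\<phi> \<in> test_fun U"
  shows "dir_deriv \<phi> h \<in> test_fun U"
proof -
  obtain K where K: "smooth_fun \<phi>" "compact K" "K \<subseteq> U" "\<And>x. x \<notin> K \<Longrightarrow> \<phi> x = 0"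
    using assms by (rule test_funE) blast
  have "dir_deriv \<phi> h x = 0" if "x \<notin> K" for x
  proof -
    have "((\<lambda>x. 0) has_derivative (\<lambda>h. 0)) (at x)" by simp
    then have "(\<phi> has_derivative (\<lambda>h. 0)) (at x)"
      by (rule has_derivative_transform_within_open[of _ _ _ _ "- K"])
        (use K that in \<open>auto simp: compact_imp_closed open_Compl\<close>)
    then show ?thesis by (simp add: dir_deriv_eqI)
  qed
  then show ?thesis using K by (intro test_funI) (auto intro: smooth_fun_dir_deriv)
qed

lemma grad_eq: "grad \<phi> = (\<lambda>x. \<Sum>i\<in>Basis. dir_deriv \<phi> i x *\<^sub>R i)"
  by (simp add: grad_def[abs_def] dir_deriv_def)

lemma dvg_eq: "dvg \<phi> = (\<lambda>x. \<Sum>i\<in>Basis. dir_deriv \<phi> i x \<bullet> i)"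
  by (simp add: dvg_def[abs_def] dir_deriv_def)

lemma test_fun_grad: "\<phi> \<in> test_fun U \<Longrightarrow> grad \<phi> \<in> test_fun U"
  unfolding grad_eq
  by (intro test_fun_sum test_fun_scaleR_left test_fun_dir_deriv smooth_fun_const)

lemma test_fun_dvg: "\<phi> \<in> test_fun U \<Longrightarrow> dvg \<phi> \<in> test_fun U"
  unfolding dvg_eq
  by (intro test_fun_sum test_fun_bounded_linear[OF bounded_linear_inner_left] test_fun_dir_deriv)

lemma test_fun_L2:
  fixes \<phi> :: "'a::euclidean_space \<Rightarrow> 'b::euclidean_space"
  assumes "\<phi> \<in> test_fun U"
  shows "square_integrable \<phi>"
proof -
  obtain K where K: "smooth_fun \<phi>" "compact K" "\<And>x. x \<notin> K \<Longrightarrow> \<phi> x = 0"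
    using assms by (rule test_funE) blast
  have c: "continuous_on A \<phi>" for A using K by (intro smooth_fun_continuous)
  have "integrable lborel (\<lambda>x. indicator K x *\<^sub>R (norm (\<phi> x))\<^sup>2)"
    by (intro borel_integrable_compact continuous_intros c K)
  also have "(\<lambda>x. indicator K x *\<^sub>R (norm (\<phi> x))\<^sup>2) = (\<lambda>x. (norm (\<phi> x))\<^sup>2)"
    using K(3) by (force simp: indicator_def)
  finally show ?thesis
    using c[of UNIV] by (auto simp: square_integrable_def intro: borel_measurable_continuous_onI)
qed

lemma dir_deriv_add:
  "smooth_fun \<phi> \<Longrightarrow> smooth_fun \<psi> \<Longrightarrow> dir_deriv (\<lambda>x. \<phi> x + \<psi> x) h = (\<lambda>x. dir_deriv \<phi> h x + dir_deriv \<psi> h x)"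
  by (rule ext, rule dir_deriv_eqI[where D="\<lambda>h. dir_deriv \<phi> h x + dir_deriv \<psi> h x" for x])
    (intro derivative_intros smooth_fun_has_derivative)

lemma dir_deriv_scaleR_const:
  fixes \<phi> :: "'a::euclidean_space \<Rightarrow> 'b::real_normed_vector"
  shows "smooth_fun \<phi> \<Longrightarrow> dir_deriv (\<lambda>x. c *\<^sub>R \<phi> x) h = (\<lambda>x. c *\<^sub>R dir_deriv \<phi> h x)"
  by (rule ext, rule dir_deriv_eqI[where D="\<lambda>h. c *\<^sub>R dir_deriv \<phi> h x" for x])
    (auto intro!: derivative_eq_intros smooth_fun_has_derivative)

lemma dir_deriv_scaleR_vector:
  fixes \<phi> :: "'a::euclidean_space \<Rightarrow> real"
  shows "smooth_fun \<phi> \<Longrightarrow> dir_deriv (\<lambda>x. \<phi> x *\<^sub>R v) h = (\<lambda>x. dir_deriv \<phi> h x *\<^sub>R v)"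
  by (rule ext, rule dir_deriv_eqI[where D="\<lambda>h. dir_deriv \<phi> h x *\<^sub>R v" for x])
    (auto intro!: derivative_eq_intros smooth_fun_has_derivative)

lemma dvg_scaleR_vector:
  fixes \<phi> :: "'a::euclidean_space \<Rightarrow> real"
  assumes "smooth_fun \<phi>"
  shows "dvg (\<lambda>x. \<phi> x *\<^sub>R v) = dir_deriv \<phi> v"
proof
  fix x show "dvg (\<lambda>x. \<phi> x *\<^sub>R v) x = dir_deriv \<phi> v x"
    unfolding dvg_eq dir_deriv_scaleR_vector[OF assms] using dir_deriv_basis[OF assms, of v x]
    by (simp add: mult.commute)
qed

section \<open>Flat functions and cutoffs\<close>

definition flat_exp :: "real poly \<Rightarrow> real \<Rightarrow> real" where
  "flat_exp p x = (if x > 0 then poly p (1 / x) * exp (- 1 / x) else 0)"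

lemma poly_times_exp_tendsto_0: "((\<lambda>z::real. poly p z * exp (- z)) \<longlongrightarrow> 0) at_top"
proof -
  have "((\<lambda>z::real. \<Sum>i\<le>degree p. coeff p i * (z ^ i / exp z)) \<longlongrightarrow> (\<Sum>i\<le>degree p. coeff p i * 0)) at_top"
    by (intro tendsto_sum tendsto_mult tendsto_const tendsto_power_div_exp_0)
  then show ?thesis
    by (simp add: poly_altdef sum_distrib_right exp_minus divide_inverse mult.assoc)
qed

lemma flat_exp_tendsto_0: "(flat_exp p \<longlongrightarrow> 0) (at 0)"
  unfolding filterlim_at_split
proof
  show "(flat_exp p \<longlongrightarrow> 0) (at_left 0)"
    by (rule tendsto_eventually) (auto simp: flat_exp_def eventually_at intro!: exI[of _ 1])
  have "((\<lambda>x. poly p (inverse x) * exp (- inverse x)) \<longlongrightarrow> 0) (at_right (0::real))"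
    by (rule filterlim_compose[OF poly_times_exp_tendsto_0 filterlim_inverse_at_top_right])
  then show "(flat_exp p \<longlongrightarrow> 0) (at_right 0)"
    by (rule Lim_transform_eventually)
      (auto simp: flat_exp_def eventually_at inverse_eq_divide intro!: exI[of _ 1])
qed

text \<open>Differentiating p(1/x) exp(-1/x) gives the polynomial X^2 (p - p') in 1/x, so the family
  \<open>flat_exp p\<close> is closed under differentiation and one formula yields
  smoothness.\<close>

lemma flat_exp_has_derivative:
  "(flat_exp p has_real_derivative flat_exp ([:0, 0, 1:] * (p - pderiv p)) x) (at x)"
proof (cases x "0::real" rule: linorder_cases)
  case less
  have "((\<lambda>x. 0) has_real_derivative 0) (at x)" by simp
  then have "(flat_exp p has_real_derivative 0) (at x)"
    by (rule has_field_derivative_transform_within_open[of _ _ _ "{..<0}"])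
      (use less in \<open>auto simp: flat_exp_def\<close>)
  then show ?thesis using less by (simp add: flat_exp_def)
next
  case equal
  \<comment> \<open>Dividing by y multiplies the polynomial in 1/y by its variable, which is
    \<open>pCons 0\<close>; the difference quotient is again a flat function and tends to 0.\<close>
  have "(\<lambda>y. (flat_exp p y - flat_exp p 0) / (y - 0)) = flat_exp (pCons 0 p)"
    by (auto simp: flat_exp_def fun_eq_iff)
  then show ?thesis
    using flat_exp_tendsto_0[of "pCons 0 p"] equal by (simp add: has_field_derivative_iff flat_exp_def)
next
  case greater
  have "((\<lambda>x. poly p (1 / x) * exp (- 1 / x)) has_real_derivative
      poly ([:0, 0, 1:] * (p - pderiv p)) (1 / x) * exp (- 1 / x)) (at x)"
    using greater
    by (auto intro!: derivative_eq_intros DERIV_chain2[OF poly_DERIV] simp: field_simps power2_eq_square)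
  then have "(flat_exp p has_real_derivative
      poly ([:0, 0, 1:] * (p - pderiv p)) (1 / x) * exp (- 1 / x)) (at x)"
    by (rule has_field_derivative_transform_within_open[of _ _ _ "{0<..}"])
      (use greater in \<open>auto simp: flat_exp_def\<close>)
  then show ?thesis using greater by (simp add: flat_exp_def)
qed

lemma smooth_fun_flat_exp:
  fixes \<phi> :: "'a::euclidean_space \<Rightarrow> real"
  assumes "smooth_fun \<phi>"
  shows "smooth_fun (\<lambda>x. flat_exp p (\<phi> x))"
  unfolding smooth_fun_def
proof
  fix k
  define G where "G n = flat_exp (((\<lambda>p. [:0, 0, 1:] * (p - pderiv p)) ^^ n) p)" for n
  have "(G n has_real_derivative G (Suc n) y) (at y)" for n y
    unfolding G_def funpow.simps o_apply by (rule flat_exp_has_derivative)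
  then have "C_k k (\<lambda>x. G 0 (\<phi> x))"
    by (rule C_k_compose_real) (use assms in \<open>simp add: smooth_fun_def\<close>)
  then show "C_k k (\<lambda>x. flat_exp p (\<phi> x))" by (simp add: G_def)
qed

lemma flat_exp_1_bounds:
  "0 \<le> flat_exp 1 x" "flat_exp 1 x \<le> 1" "x > 0 \<Longrightarrow> flat_exp 1 x > 0" "x \<le> 0 \<Longrightarrow> flat_exp 1 x = 0"
  by (auto simp: flat_exp_def)

lemma smooth_fun_inner: "smooth_fun (\<lambda>x. x \<bullet> a)"
  unfolding smooth_fun_def
proof
  fix k show "C_k k (\<lambda>x. x \<bullet> a)"
  proof (cases k)
    case 0
    then show ?thesis by (simp add: continuous_on_inner)
  next
    case (Suc n)
    show ?thesis unfolding Suc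
      by (rule C_k_SucI[where D="\<lambda>x h. h \<bullet> a"])
        (auto intro: C_k_const bounded_linear_imp_has_derivative bounded_linear_inner_left)
  qed
qed

lemma smooth_fun_power2_dist:
  fixes x :: "'a::euclidean_space"
  shows "smooth_fun (\<lambda>y. (dist x y)\<^sup>2)"
proof -
  have "(\<lambda>y. (dist x y)\<^sup>2) = (\<lambda>y. \<Sum>i\<in>Basis. (x \<bullet> i - y \<bullet> i) * (x \<bullet> i - y \<bullet> i))"
    unfolding dist_norm power2_norm_eq_inner by (rule ext, subst euclidean_inner) (simp add: inner_diff_left)
  then show ?thesis
    by (simp only:) (intro smooth_fun_sum smooth_fun_mult smooth_fun_diff smooth_fun_const smooth_fun_inner)
qed

lemma smooth_fun_inverse:
  fixes \<phi> :: "'a::euclidean_space \<Rightarrow> real"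
  shows "(\<And>x. \<phi> x \<noteq> 0) \<Longrightarrow> smooth_fun \<phi> \<Longrightarrow> smooth_fun (\<lambda>x. inverse (\<phi> x))"
  by (simp add: smooth_fun_def C_k_inverse)

text \<open>\<open>a\<close> vanishes off the ball of radius r and \<open>b\<close> on the ball of
  radius r / 2. They never vanish together, so a / (a + b) is smooth, equal to 1 where
  \<open>b\<close> vanishes and to 0 where \<open>a\<close> does.\<close>

lemma smooth_cutoff:
  fixes x :: "'a::euclidean_space"
  assumes "r > 0"
  obtains \<psi> :: "'a \<Rightarrow> real" where "smooth_fun \<psi>" "\<And>y. 0 \<le> \<psi> y" "\<And>y. \<psi> y \<le> 1"
    "\<And>y. dist x y \<le> r / 2 \<Longrightarrow> \<psi> y = 1" "\<And>y. dist x y \<ge> r \<Longrightarrow> \<psi> y = 0"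
proof
  define a where "a y = flat_exp 1 (r\<^sup>2 - (dist x y)\<^sup>2)" for y
  define b where "b y = flat_exp 1 ((dist x y)\<^sup>2 - (r / 2)\<^sup>2)" for y
  define \<psi> where "\<psi> y = a y * inverse (a y + b y)" for y
  have ab: "a y \<ge> 0" "b y \<ge> 0" for y by (simp_all add: a_def b_def flat_exp_1_bounds)
  have pos: "a y + b y > 0" for y
  proof (cases "dist x y < r")
    case True
    then have "(dist x y)\<^sup>2 < r\<^sup>2" by (intro power_strict_mono) auto
    then have "a y > 0" by (simp add: a_def flat_exp_1_bounds)
    then show ?thesis using ab(2)[of y] by linarith
  next
    case False
    then have "r / 2 < dist x y" using assms by simp
    then have "(r / 2)\<^sup>2 < (dist x y)\<^sup>2" using assms by (intro power_strict_mono) auto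
    then have "b y > 0" by (simp add: b_def flat_exp_1_bounds)
    then show ?thesis using ab(1)[of y] by linarith
  qed
  have sm: "smooth_fun a" "smooth_fun b"
    unfolding a_def b_def
    by (intro smooth_fun_flat_exp smooth_fun_diff smooth_fun_const smooth_fun_power2_dist)+
  have "smooth_fun (\<lambda>y. inverse (a y + b y))"
    using pos by (intro smooth_fun_inverse smooth_fun_add sm) (metis less_irrefl)
  then show "smooth_fun \<psi>" unfolding \<psi>_def by (intro smooth_fun_mult sm)
  show "0 \<le> \<psi> y" for y using ab pos[of y] by (simp add: \<psi>_def)
  show "\<psi> y \<le> 1" for y using ab pos[of y] by (simp add: \<psi>_def field_simps)
  show "\<psi> y = 1" if "dist x y \<le> r / 2" for y
  proof -
    have "(dist x y)\<^sup>2 \<le> (r / 2)\<^sup>2" using that by (intro power_mono) auto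
    then have "b y = 0" by (simp add: b_def flat_exp_1_bounds)
    then show ?thesis using pos[of y] by (simp add: \<psi>_def)
  qed
  show "\<psi> y = 0" if "dist x y \<ge> r" for y
  proof -
    have "r\<^sup>2 \<le> (dist x y)\<^sup>2" using that assms by (intro power_mono) auto
    then show ?thesis by (simp add: \<psi>_def a_def flat_exp_1_bounds)
  qed
qed

section \<open>The fundamental lemma of the calculus of variations\<close>

lemma l2_vanishes_off_l2_of:
  "square_integrable f \<Longrightarrow> l2_vanishes_off (l2_of f) U \<longleftrightarrow> (AE x in lborel. x \<notin> U \<longrightarrow> f x = 0)"
  by (simp add: l2_vanishes_off.abs_eq)

lemma in_L2_iff: "g \<in> L2 U \<longleftrightarrow> (AE x in lborel. x \<notin> U \<longrightarrow> rep_l2 g x = 0)"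
  using l2_vanishes_off_l2_of[OF square_integrable_rep_l2[of g]] by (simp add: L2_def)

lemma AE_lborel_negligible:
  assumes "negligible N"
  shows "AE x in lborel. x \<notin> N"
proof -
  obtain N' where "N' \<in> null_sets lborel" "N \<subseteq> N'"
    using assms unfolding negligible_iff_null_sets null_sets_completion_iff2 by blast
  then show ?thesis by (intro AE_I'[of N']) auto
qed

text \<open>Rescaling steepens the flat function to a unit step with value 0 at 0; products of such
  steps yield the indicator of an open box.\<close>

lemma flat_exp_scaled_tendsto: "(\<lambda>k. flat_exp 1 (real k * x)) \<longlonglongrightarrow> (if x > 0 then 1 else 0)"
proof (cases "x > 0")
  case True
  have "(\<lambda>k. exp (- inverse (real k) / x)) \<longlonglongrightarrow> exp (- 0 / x)"
    using True by (intro tendsto_intros LIMSEQ_inverse_real_of_nat[THEN LIMSEQ_imp_Suc] lim_inverse_n) auto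
  then have "(\<lambda>k. flat_exp 1 (real k * x)) \<longlonglongrightarrow> exp (- 0 / x)"
    by (rule Lim_transform_eventually)
      (use True in \<open>auto simp: flat_exp_def eventually_sequentially field_simps intro!: exI[of _ 1]\<close>)
  then show ?thesis using True by simp
next
  case False
  then have "real k * x \<le> 0" for k by (simp add: mult_nonneg_nonpos)
  then show ?thesis using False by (simp add: flat_exp_1_bounds)
qed

lemma square_integrable_indicator_cbox: "square_integrable (\<lambda>x. indicator (cbox a b) x :: real)"
proof -
  have eq: "(\<lambda>x. (norm (indicator (cbox a b) x :: real))\<^sup>2) = indicator (cbox a b)"
    by (auto simp: indicator_def)
  show ?thesis
    unfolding square_integrable_def eq
    by (intro conjI integrable_real_indicator emeasure_lborel_cbox_finite) auto
qed

text \<open>The test functions \<open>q k\<close> are supported in the closed box and tend boundedly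
  to the indicator of the open one, so dominated convergence applies.\<close>

lemma integral_box_eq_0_if_orthogonal:
  fixes f :: "'a::euclidean_space \<Rightarrow> real"
  assumes f: "square_integrable f" and cb: "cbox a b \<subseteq> U"
    and orth: "\<And>\<phi>. \<phi> \<in> test_fun U \<Longrightarrow> (\<integral>x. f x * \<phi> x \<partial>lborel) = 0"
  shows "integrable lborel (\<lambda>x. indicator (cbox a b) x * f x)" "(\<integral>x. indicator (box a b) x * f x \<partial>lborel) = 0"
proof -
  have [measurable]: "f \<in> borel_measurable lborel" using f by (simp add: square_integrable_def)
  define q where "q k x = (\<Prod>j\<in>Basis. flat_exp 1 (real k * (x \<bullet> j - a \<bullet> j)) * flat_exp 1 (real k * (b \<bullet> j - x \<bullet> j)))"
    for k x
  have sq: "smooth_fun (q k)" for k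
    unfolding q_def
    by (intro smooth_fun_prod smooth_fun_mult smooth_fun_flat_exp smooth_fun_diff smooth_fun_const smooth_fun_inner)
  have q0: "q k x = 0" if "x \<notin> cbox a b" for k x
  proof -
    have "\<exists>j\<in>Basis. x \<bullet> j < a \<bullet> j \<or> b \<bullet> j < x \<bullet> j"
      using that by (force simp: mem_box not_le)
    then obtain j where j: "j \<in> Basis" "x \<bullet> j < a \<bullet> j \<or> b \<bullet> j < x \<bullet> j" by blast
    then have "real k * (x \<bullet> j - a \<bullet> j) \<le> 0 \<or> real k * (b \<bullet> j - x \<bullet> j) \<le> 0"
      by (auto intro: mult_nonneg_nonpos)
    then have "\<exists>j\<in>Basis. flat_exp 1 (real k * (x \<bullet> j - a \<bullet> j)) * flat_exp 1 (real k * (b \<bullet> j - x \<bullet> j)) = 0"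
      using j(1) by (auto simp: flat_exp_1_bounds intro!: bexI[of _ j])
    then show ?thesis unfolding q_def by (simp add: prod_zero_iff)
  qed
  have q01: "0 \<le> q k x" "q k x \<le> 1" for k x
    unfolding q_def by (auto intro!: prod_nonneg prod_le_1 mult_le_one simp: flat_exp_1_bounds)
  have tq: "q k \<in> test_fun U" for k
    using sq q0 cb by (intro test_funI[of _ "cbox a b"]) auto
  have [measurable]: "q k \<in> borel_measurable lborel" for k
    using test_fun_L2[OF tq] by (simp add: square_integrable_def)
  from square_integrable_inner[OF square_integrable_indicator_cbox f]
  show int: "integrable lborel (\<lambda>x. indicator (cbox a b) x * f x)" by simp
  have "(\<lambda>k. \<integral>x. f x * q k x \<partial>lborel) \<longlonglongrightarrow> (\<integral>x. indicator (box a b) x * f x \<partial>lborel)"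
  proof (rule integral_dominated_convergence[where w="\<lambda>x. \<bar>indicator (cbox a b) x * f x\<bar>"])
    show "AE x in lborel. (\<lambda>k. f x * q k x) \<longlonglongrightarrow> indicator (box a b) x * f x"
    proof (rule AE_I2)
      fix x
      have "(\<lambda>k. q k x) \<longlonglongrightarrow> (\<Prod>j\<in>Basis. (if x \<bullet> j - a \<bullet> j > 0 then 1 else 0) * (if b \<bullet> j - x \<bullet> j > 0 then 1 else 0))"
        unfolding q_def by (intro tendsto_prod tendsto_mult flat_exp_scaled_tendsto)
      also have "(\<Prod>j\<in>Basis. (if x \<bullet> j - a \<bullet> j > 0 then 1 else 0) * (if b \<bullet> j - x \<bullet> j > 0 then 1 else 0))
          = (indicator (box a b) x :: real)"
        by (auto simp: indicator_def mem_box prod_zero_iff intro!: prod.neutral)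
      finally have "(\<lambda>k. q k x) \<longlonglongrightarrow> indicator (box a b) x" .
      from tendsto_mult_left[OF this, of "f x"]
      show "(\<lambda>k. f x * q k x) \<longlonglongrightarrow> indicator (box a b) x * f x" by (simp add: mult.commute)
    qed
    show "AE x in lborel. norm (f x * q k x) \<le> \<bar>indicator (cbox a b) x * f x\<bar>" for k
    proof (rule AE_I2)
      fix x show "norm (f x * q k x) \<le> \<bar>indicator (cbox a b) x * f x\<bar>"
        using q0[of x k] q01[of k x] by (cases "x \<in> cbox a b") (auto simp: abs_mult mult_left_le)
    qed
    show "integrable lborel (\<lambda>x. \<bar>indicator (cbox a b) x * f x\<bar>)" using int by (rule integrable_abs)
  qed measurable
  then show "(\<integral>x. indicator (box a b) x * f x \<partial>lborel) = 0"
    using orth[OF tq] LIMSEQ_unique[OF _ tendsto_const] by auto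
qed

text \<open>Lebesgue differentiation takes the place of mollification: almost every value f x is the
  limit of the means over the cubes with lower corner x, and these means vanish for small
  cubes.\<close>

lemma AE_zero_if_orthogonal:
  fixes f :: "'a::euclidean_space \<Rightarrow> real"
  assumes f: "square_integrable f" and "open U"
    and orth: "\<And>\<phi>. \<phi> \<in> test_fun U \<Longrightarrow> (\<integral>x. f x * \<phi> x \<partial>lborel) = 0"
  shows "AE x in lborel. x \<in> U \<longrightarrow> f x = 0"
proof -
  have int: "set_integrable lborel (cbox a b) f" for a b
  proof -
    from square_integrable_inner[OF square_integrable_indicator_cbox f] show ?thesis by (simp add: set_integrable_def)
  qed
  then have "f integrable_on cbox a b" for a b by (rule set_borel_integral_eq_integral)
  then obtain N where N: "negligible N"
    "\<And>x e. \<lbrakk>x \<notin> N; 0 < e\<rbrakk> \<Longrightarrow> \<exists>d>0. \<forall>h. 0 < h \<and> h < d \<longrightarrow>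
        norm (integral (cbox x (x + h *\<^sub>R One)) f /\<^sub>R h ^ DIM('a) - f x) < e"
    by (rule integrable_ccontinuous_explicit) blast
  have "f x = 0" if x: "x \<in> U" "x \<notin> N" for x
  proof (rule ccontr)
    assume "f x \<noteq> 0"
    then obtain d where d: "d > 0" "\<And>h. 0 < h \<Longrightarrow> h < d \<Longrightarrow>
        norm (integral (cbox x (x + h *\<^sub>R One)) f /\<^sub>R h ^ DIM('a) - f x) < \<bar>f x\<bar>"
      using N(2)[OF x(2), of "\<bar>f x\<bar>"] by auto
    obtain r where r: "r > 0" "cball x r \<subseteq> U" using x(1) \<open>open U\<close> open_contains_cball by blast
    \<comment> \<open>\<open>d / 2\<close> keeps \<open>h\<close> strictly below \<open>d\<close>;
      \<open>r / DIM('a)\<close> keeps the cube in the ball of radius \<open>r\<close>, as the norm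
      is at most the sum of the absolute coordinates.\<close>
    define h where "h = min (d / 2) (r / DIM('a))"
    have h: "0 < h" "h < d" "h * DIM('a) \<le> r"
      using d(1) r(1) by (auto simp: h_def min_def field_simps)
    have sub: "cbox x (x + h *\<^sub>R One) \<subseteq> U"
    proof
      fix y assume y: "y \<in> cbox x (x + h *\<^sub>R One)"
      have "norm (y - x) \<le> (\<Sum>i\<in>Basis. \<bar>(y - x) \<bullet> i\<bar>)" by (rule norm_le_l1)
      also have "\<dots> \<le> (\<Sum>i\<in>(Basis::'a set). h)"
        using y by (intro sum_mono) (auto simp: mem_box inner_simps)
      also have "\<dots> \<le> r" using h(3) by (simp add: mult.commute)
      finally show "y \<in> U" using r(2) by (auto simp: dist_norm norm_minus_commute)
    qed
    \<comment> \<open>The integral is known to vanish for open boxes only; the boundary is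
      negligible.\<close>
    have "integral (cbox x (x + h *\<^sub>R One)) f = integral (box x (x + h *\<^sub>R One)) f"
      by (rule integral_subset_negligible[symmetric, OF box_subset_cbox negligible_frontier_interval])
    also have "\<dots> = (LINT y:box x (x + h *\<^sub>R One)|lborel. f y)"
      by (rule set_borel_integral_eq_integral(2)[symmetric],
          rule set_integrable_subset[OF int _ box_subset_cbox]) simp
    also have "\<dots> = 0"
      using integral_box_eq_0_if_orthogonal(2)[OF f sub orth] by (simp add: set_lebesgue_integral_def)
    finally show False using d(2)[OF h(1,2)] by simp
  qed
  then show ?thesis using AE_lborel_negligible[OF N(1)] by (auto elim: eventually_mono)
qed

lemma l2_eq_zeroI:
  fixes g :: "('a::euclidean_space, 'b::euclidean_space) l2"
  assumes "g \<in> L2 U" "open U" and orth: "\<And>\<phi>. \<phi> \<in> test_fun U \<Longrightarrow> g \<bullet> l2_of \<phi> = 0"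
  shows "g = 0"
proof -
  define f where "f = rep_l2 g"
  have f: "square_integrable f" unfolding f_def by (rule square_integrable_rep_l2)
  have [measurable]: "f \<in> borel_measurable lborel" using f by (simp add: square_integrable_def)
  have "AE x in lborel. x \<in> U \<longrightarrow> f x \<bullet> i = 0" if i: "i \<in> Basis" for i
  proof (rule AE_zero_if_orthogonal)
    show "square_integrable (\<lambda>x. f x \<bullet> i)"
      using i by (intro square_integrable_bound[OF f]) (auto intro: Basis_le_norm)
    fix \<phi> :: "'a \<Rightarrow> real" assume \<phi>: "\<phi> \<in> test_fun U"
    then have t: "(\<lambda>x. \<phi> x *\<^sub>R i) \<in> test_fun U" by (intro test_fun_scaleR_left smooth_fun_const)
    have "l2_of f \<bullet> l2_of (\<lambda>x. \<phi> x *\<^sub>R i) = 0" using orth[OF t] by (simp add: f_def)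
    then show "(\<integral>x. (f x \<bullet> i) * \<phi> x \<partial>lborel) = 0"
      using inner_l2_of[OF f test_fun_L2[OF t]] by (simp add: mult.commute)
  qed fact
  then have "AE x in lborel. \<forall>i\<in>Basis. x \<in> U \<longrightarrow> f x \<bullet> i = 0"
    by (intro AE_finite_allI) auto
  moreover have "AE x in lborel. x \<notin> U \<longrightarrow> f x = 0" using assms(1) by (simp add: in_L2_iff f_def)
  ultimately have "AE x in lborel. f x = 0"
    by eventually_elim (metis euclidean_all_zero_iff)
  then have "l2_of f = l2_of (\<lambda>x. 0)" using f square_integrable_zero by (subst l2_of_eq_iff) auto
  then show ?thesis by (simp add: f_def l2_of_zero)
qed

section \<open>Weak derivatives and the graph of the broken operator\<close>

lemma l2_restrict_l2_of:
  "U \<in> sets borel \<Longrightarrow> square_integrable f \<Longrightarrow> l2_restrict U (l2_of f) = l2_of (\<lambda>x. indicator U x *\<^sub>R f x)"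
  by (simp add: l2_restrict.abs_eq)

lemma l2_restrict_rep:
  "U \<in> sets borel \<Longrightarrow> l2_restrict U f = l2_of (\<lambda>x. indicator U x *\<^sub>R rep_l2 f x)"
  using l2_restrict_l2_of[OF _ square_integrable_rep_l2, of U f] by simp

text \<open>Self-adjointness lets linearity of the restriction be checked against inner products,
  without returning to representatives.\<close>

lemma inner_l2_restrict:
  assumes "U \<in> sets borel"
  shows "l2_restrict U f \<bullet> g = f \<bullet> l2_restrict U g"
proof -
  have "l2_of (\<lambda>x. indicator U x *\<^sub>R rep_l2 f x) \<bullet> l2_of (rep_l2 g)
      = l2_of (rep_l2 f) \<bullet> l2_of (\<lambda>x. indicator U x *\<^sub>R rep_l2 g x)"
    by (simp add: inner_l2_of square_integrable_rep_l2 square_integrable_indicator assms del: l2_of_rep_l2)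
  then show ?thesis by (simp add: l2_restrict_rep[OF assms])
qed

lemma l2_restrict_in_L2:
  assumes "U \<in> sets borel"
  shows "l2_restrict U f \<in> L2 U"
  unfolding L2_def mem_Collect_eq l2_restrict_rep[OF assms]
  by (subst l2_vanishes_off_l2_of) (auto intro: square_integrable_indicator square_integrable_rep_l2 assms)

lemma l2_restrict_eq_self_iff:
  assumes "U \<in> sets borel"
  shows "l2_restrict U f = f \<longleftrightarrow> f \<in> L2 U"
proof
  assume "f \<in> L2 U"
  then have "AE x in lborel. x \<notin> U \<longrightarrow> rep_l2 f x = 0" by (simp add: in_L2_iff)
  then have "AE x in lborel. indicator U x *\<^sub>R rep_l2 f x = rep_l2 f x"
    by eventually_elim (auto simp: indicator_def)
  then have "l2_of (\<lambda>x. indicator U x *\<^sub>R rep_l2 f x) = l2_of (rep_l2 f)"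
    by (subst l2_of_eq_iff) (auto intro: square_integrable_indicator square_integrable_rep_l2 assms)
  then show "l2_restrict U f = f" by (simp add: l2_restrict_rep[OF assms])
qed (use l2_restrict_in_L2[OF assms, of f] in simp)

lemma L2_mono: "U \<subseteq> U' \<Longrightarrow> f \<in> L2 U \<Longrightarrow> f \<in> L2 U'"
  unfolding in_L2_iff by (erule eventually_mono) auto

lemma linear_l2_restrict:
  assumes "U \<in> sets borel"
  shows "linear (l2_restrict U :: ('a::euclidean_space, 'b::euclidean_space) l2 \<Rightarrow> _)"
proof
  fix f g :: "('a, 'b) l2" and c :: real
  have "(l2_restrict U (f + g) - (l2_restrict U f + l2_restrict U g)) \<bullet> h = 0" for h
    by (simp add: inner_diff_left inner_add_left inner_l2_restrict[OF assms])
  then show "l2_restrict U (f + g) = l2_restrict U f + l2_restrict U g"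
    by (metis inner_eq_zero_iff right_minus_eq)
  have "(l2_restrict U (c *\<^sub>R f) - c *\<^sub>R l2_restrict U f) \<bullet> h = 0" for h
    by (simp add: inner_diff_left inner_l2_restrict[OF assms])
  then show "l2_restrict U (c *\<^sub>R f) = c *\<^sub>R l2_restrict U f"
    by (metis inner_eq_zero_iff right_minus_eq)
qed

lemma subspace_L2:
  assumes "open U"
  shows "subspace (L2 U :: ('a::euclidean_space, 'b::euclidean_space) l2 set)"
proof -
  have b: "U \<in> sets borel" using assms by simp
  show ?thesis
    unfolding subspace_def using l2_restrict_eq_self_iff[OF b, where 'b='b]
    by (simp flip: l2_restrict_eq_self_iff[OF b] add: linear_0[OF linear_l2_restrict[OF b]] linear_add[OF linear_l2_restrict[OF b]]
      linear_scale[OF linear_l2_restrict[OF b]])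
qed

lemma closed_L2:
  assumes "open U"
  shows "closed (L2 U :: ('a::euclidean_space, 'b::euclidean_space) l2 set)"
proof -
  have b: "U \<in> sets borel" using assms by simp
  \<comment> \<open>Vanishing off \<open>U\<close> becomes a family of continuous linear equations,
    from which closedness is immediate.\<close>
  have "L2 U = (\<Inter>h. {f :: ('a, 'b) l2. f \<bullet> l2_restrict U h = f \<bullet> h})"
  proof (intro set_eqI iffI)
    fix f :: "('a, 'b) l2" assume "f \<in> L2 U"
    then show "f \<in> (\<Inter>h. {f. f \<bullet> l2_restrict U h = f \<bullet> h})"
      unfolding l2_restrict_eq_self_iff[OF b, symmetric] by (simp flip: inner_l2_restrict[OF b])
  next
    fix f :: "('a, 'b) l2" assume "f \<in> (\<Inter>h. {f. f \<bullet> l2_restrict U h = f \<bullet> h})"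
    then have "(l2_restrict U f - f) \<bullet> h = 0" for h
      by (simp add: inner_l2_restrict[OF b] inner_diff_left)
    then show "f \<in> L2 U"
      unfolding l2_restrict_eq_self_iff[OF b, symmetric] by (metis inner_eq_zero_iff right_minus_eq)
  qed
  then show ?thesis by (simp only:) (intro closed_INT ballI closed_Collect_eq continuous_intros)
qed

lemma l2_of_test_fun_in_L2:
  assumes "\<phi> \<in> test_fun U"
  shows "l2_of \<phi> \<in> L2 U"
  using test_fun_zero_off[OF assms]
  by (simp add: L2_def l2_vanishes_off_l2_of test_fun_L2[OF assms])

lemma inner_l2_restrict_test_fun:
  assumes "open T" "\<phi> \<in> test_fun T"
  shows "l2_restrict T f \<bullet> l2_of \<phi> = f \<bullet> l2_of \<phi>"
proof -
  have b: "T \<in> sets borel" using assms by simp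
  have "l2_restrict T (l2_of \<phi>) = l2_of \<phi>"
    using l2_of_test_fun_in_L2[OF assms(2)] by (simp add: l2_restrict_eq_self_iff[OF b])
  then show ?thesis by (simp add: inner_l2_restrict[OF b])
qed

lemma inner_eq_0_if_L2_disjoint:
  assumes "f \<in> L2 S" "g \<in> L2 T" "S \<inter> T = {}"
  shows "f \<bullet> g = 0"
proof -
  have "AE x in lborel. rep_l2 f x \<bullet> rep_l2 g x = 0"
    using assms(1,2) unfolding in_L2_iff
    by eventually_elim (use assms(3) in auto)
  then have "(\<integral>x. rep_l2 f x \<bullet> rep_l2 g x \<partial>lborel) = 0" by (rule integral_eq_zero_AE)
  then show ?thesis
    using inner_l2_of[OF square_integrable_rep_l2[of f] square_integrable_rep_l2[of g]] by simp
qed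

section \<open>Uniqueness of weak derivatives\<close>

lemma L2_eqI:
  fixes g g' :: "('a::euclidean_space, 'b::euclidean_space) l2"
  assumes "open U" "g \<in> L2 U" "g' \<in> L2 U"
    and "\<And>\<phi>. \<phi> \<in> test_fun U \<Longrightarrow> g \<bullet> l2_of \<phi> = g' \<bullet> l2_of \<phi>"
  shows "g = g'"
proof -
  have "g - g' = 0"
    by (rule l2_eq_zeroI[OF _ assms(1)])
      (use assms subspace_diff[OF subspace_L2[OF assms(1)]] in \<open>auto simp: inner_diff_left\<close>)
  then show ?thesis by simp
qed

lemma wgrad_div_eqI:
  assumes "open U" "g \<in> L2 U" "has_weak_grad_div U v g"
  shows "wgrad_div U v = g"
  unfolding wgrad_div_def
  by (rule the_equality) (use assms in \<open>auto simp: has_weak_grad_div_def intro!: L2_eqI[of U]\<close>)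

lemma wgrad_eqI:
  assumes "open U" "g \<in> L2 U" "has_weak_grad U p g"
  shows "wgrad U p = g"
  unfolding wgrad_def
proof (rule the_equality)
  fix g' assume g': "g' \<in> L2 U \<and> has_weak_grad U p g'"
  show "g' = g"
  proof (rule L2_eqI[OF assms(1)])
    fix \<phi> :: "'a \<Rightarrow> 'a" assume \<phi>: "\<phi> \<in> test_fun U"
    show "g' \<bullet> l2_of \<phi> = g \<bullet> l2_of \<phi>"
      using assms(3) g' \<phi> unfolding has_weak_grad_def by (metis neg_equal_iff_equal)
  qed (use assms g' in auto)
qed (use assms in auto)

lemma wdiv_eqI:
  assumes "open U" "p \<in> L2 U" "has_weak_div U v p"
  shows "wdiv U v = p"
  unfolding wdiv_def
proof (rule the_equality)
  fix p' assume p': "p' \<in> L2 U \<and> has_weak_div U v p'"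
  show "p' = p"
  proof (rule L2_eqI[OF assms(1)])
    fix \<phi> :: "'a \<Rightarrow> real" assume \<phi>: "\<phi> \<in> test_fun U"
    show "p' \<bullet> l2_of \<phi> = p \<bullet> l2_of \<phi>"
      using assms(3) p' \<phi> unfolding has_weak_div_def by (metis neg_equal_iff_equal)
  qed (use assms p' in auto)
qed (use assms in auto)

lemma HgdD:
  assumes "open U" "v \<in> Hgd U"
  shows "v \<in> L2 U" "wgrad_div U v \<in> L2 U" "has_weak_grad_div U v (wgrad_div U v)"
  using assms wgrad_div_eqI[OF assms(1)] by (auto simp: Hgd_def)

lemma HgdI: "v \<in> L2 U \<Longrightarrow> g \<in> L2 U \<Longrightarrow> has_weak_grad_div U v g \<Longrightarrow> v \<in> Hgd U"
  by (auto simp: Hgd_def)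

lemma HdivD:
  assumes "open U" "v \<in> Hdiv U"
  shows "v \<in> L2 U" "wdiv U v \<in> L2 U" "has_weak_div U v (wdiv U v)"
  using assms wdiv_eqI[OF assms(1)] by (auto simp: Hdiv_def)

lemma H1D:
  assumes "open U" "p \<in> H1 U"
  shows "p \<in> L2 U" "wgrad U p \<in> L2 U" "has_weak_grad U p (wgrad U p)"
  using assms wgrad_eqI[OF assms(1)] by (auto simp: H1_def)

text \<open>One function on \<Omega> collects all elementwise derivatives. The mesh
  \<open>{\<Omega>}\<close> gives the graph of the maximal operator on \<Omega>, so the broken and
  the global operator share closedness and projections.\<close>

definition grad_div_graph ::
  "'a::euclidean_space set \<Rightarrow> 'a set set \<Rightarrow> (('a, 'a) l2 \<times> ('a, 'a) l2) set" where
  "grad_div_graph \<Omega> \<T> = {(v, a). v \<in> L2 \<Omega> \<and> a \<in> L2 \<Omega> \<and> (\<forall>T\<in>\<T>. has_weak_grad_div T v a)}"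

lemma subspace_grad_div_graph:
  assumes "open \<Omega>"
  shows "subspace (grad_div_graph \<Omega> \<T>)"
  using subspace_L2[OF assms, where 'b='a] unfolding subspace_def grad_div_graph_def has_weak_grad_div_def
  by (auto simp: inner_add_left zero_prod_def)

lemma closed_grad_div_graph:
  fixes \<Omega> :: "'a::euclidean_space set"
  assumes "open \<Omega>"
  shows "closed (grad_div_graph \<Omega> \<T>)"
proof -
  have "grad_div_graph \<Omega> \<T> = (L2 \<Omega> \<times> L2 \<Omega>) \<inter>
    (\<Inter>T\<in>\<T>. \<Inter>\<phi>\<in>test_fun T. {z. fst z \<bullet> l2_of (grad (dvg \<phi>)) = snd z \<bullet> l2_of \<phi>})"
    by (auto simp: grad_div_graph_def has_weak_grad_div_def)
  then show ?thesis
    by (simp only:) (intro closed_Int closed_Times closed_L2 assms closed_INT ballI closed_Collect_eq continuous_intros)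
qed

lemma grad_div_graph_unbroken:
  assumes "open \<Omega>"
  shows "(v, a) \<in> grad_div_graph \<Omega> {\<Omega>} \<longleftrightarrow> v \<in> Hgd \<Omega> \<and> wgrad_div \<Omega> v = a"
  using assms HgdD[OF assms] by (auto simp: grad_div_graph_def intro: HgdI wgrad_div_eqI)

text \<open>What is kept of a mesh: of the Lipschitz property of the elements only their openness
  and \<open>AE_covered\<close> survive.\<close>

locale open_partition =
  fixes \<Omega> :: "'a::euclidean_space set" and \<T> :: "'a set set"
  assumes open_domain: "open \<Omega>" and finite_mesh: "finite \<T>"
    and elements: "T \<in> \<T> \<Longrightarrow> open T" "T \<in> \<T> \<Longrightarrow> T \<subseteq> \<Omega>"
    and disjoint_elements: "pairwise disjnt \<T>"
    and AE_covered: "AE x in lborel. x \<in> \<Omega> \<longrightarrow> x \<in> \<Union>\<T>"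
begin

lemma borel_element: "T \<in> \<T> \<Longrightarrow> T \<in> sets borel"
  using elements(1) by simp

lemma sum_l2_restrict:
  fixes f :: "('a, 'b::euclidean_space) l2"
  assumes "f \<in> L2 \<Omega>"
  shows "(\<Sum>T\<in>\<T>. l2_restrict T f) = f"
proof -
  define F where "F = rep_l2 f"
  have F: "square_integrable F" unfolding F_def by (rule square_integrable_rep_l2)
  have si: "square_integrable (\<lambda>x. indicator T x *\<^sub>R F x)" if "T \<in> \<T>" for T
    using that by (intro square_integrable_indicator F borel_element)
  have "(\<Sum>T\<in>\<T>. l2_restrict T f) = (\<Sum>T\<in>\<T>. l2_of (\<lambda>x. indicator T x *\<^sub>R F x))"
    unfolding F_def by (intro sum.cong refl l2_restrict_rep borel_element)
  also have "\<dots> = l2_of (\<lambda>x. \<Sum>T\<in>\<T>. indicator T x *\<^sub>R F x)"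
    using si by (rule l2_of_sum[symmetric])
  also have "\<dots> = l2_of F"
  proof (subst l2_of_eq_iff)
    show "square_integrable (\<lambda>x. \<Sum>T\<in>\<T>. indicator T x *\<^sub>R F x)"
      using si by (rule square_integrable_sum)
    have "AE x in lborel. x \<notin> \<Omega> \<longrightarrow> F x = 0" using assms by (simp add: in_L2_iff F_def)
    then show "AE x in lborel. (\<Sum>T\<in>\<T>. indicator T x *\<^sub>R F x) = F x"
      using AE_covered
    proof eventually_elim
      fix x assume x: "x \<notin> \<Omega> \<longrightarrow> F x = 0" "x \<in> \<Omega> \<longrightarrow> x \<in> \<Union>\<T>"
      show "(\<Sum>T\<in>\<T>. indicator T x *\<^sub>R F x) = F x"
      proof (cases "x \<in> \<Omega>")
        case True
        then obtain S where S: "S \<in> \<T>" "x \<in> S" using x by auto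
        have "indicator T x *\<^sub>R F x = (if T = S then F x else 0)" if "T \<in> \<T>" for T
          using disjoint_elements S that by (auto simp: pairwise_def disjnt_def indicator_def)
        then have "(\<Sum>T\<in>\<T>. indicator T x *\<^sub>R F x) = (\<Sum>T\<in>\<T>. if T = S then F x else 0)"
          by (intro sum.cong) auto
        then show ?thesis using S finite_mesh by simp
      qed (use x in auto)
    qed
  qed (rule F)
  finally show ?thesis by (simp add: F_def)
qed

lemma mesh_inner_eq:
  assumes "g \<in> L2 \<Omega>"
  shows "mesh_inner \<T> f g = f \<bullet> g" "mesh_inner \<T> g f = g \<bullet> f"
proof -
  have "l2_restrict T f \<bullet> l2_restrict T g = f \<bullet> l2_restrict T g" if "T \<in> \<T>" for T f
    using l2_restrict_in_L2[OF borel_element[OF that], of g]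
    unfolding l2_restrict_eq_self_iff[OF borel_element[OF that], symmetric]
    by (simp add: inner_l2_restrict[OF borel_element[OF that], of f])
  then have *: "mesh_inner \<T> f g = f \<bullet> g" for f
    unfolding mesh_inner_def using sum_l2_restrict[OF assms] by (simp flip: inner_sum_right)
  then show "mesh_inner \<T> f g = f \<bullet> g" .
  show "mesh_inner \<T> g f = g \<bullet> f"
    using * by (simp add: mesh_inner_def inner_commute)
qed

text \<open>A test function on T only sees the restriction to T, so the elementwise derivatives and
  their sum carry the same information. This trades the \<open>THE\<close> in
  \<open>wgrad_div\<close> for membership in a closed subspace.\<close>

lemma grad_div_graph_iff:
  "(v, a) \<in> grad_div_graph \<Omega> \<T> \<longleftrightarrow> v \<in> broken_Hgd \<Omega> \<T> \<and> broken_grad_div \<T> v = a"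
proof
  assume "(v, a) \<in> grad_div_graph \<Omega> \<T>"
  then have va: "v \<in> L2 \<Omega>" "a \<in> L2 \<Omega>" "\<And>T. T \<in> \<T> \<Longrightarrow> has_weak_grad_div T v a"
    by (auto simp: grad_div_graph_def)
  have w: "has_weak_grad_div T (l2_restrict T v) (l2_restrict T a)" if "T \<in> \<T>" for T
    using va(3)[OF that] elements(1)[OF that]
    by (auto simp: has_weak_grad_div_def inner_l2_restrict_test_fun test_fun_grad test_fun_dvg)
  have "l2_restrict T v \<in> Hgd T" if "T \<in> \<T>" for T
    using w[OF that] l2_restrict_in_L2[OF borel_element[OF that]] by (intro HgdI)
  moreover have "wgrad_div T (l2_restrict T v) = l2_restrict T a" if "T \<in> \<T>" for T
    using w[OF that] l2_restrict_in_L2[OF borel_element[OF that]] elements(1)[OF that] by (intro wgrad_div_eqI)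
  ultimately show "v \<in> broken_Hgd \<Omega> \<T> \<and> broken_grad_div \<T> v = a"
    using va sum_l2_restrict[OF va(2)] by (simp add: broken_Hgd_def broken_grad_div_def)
next
  assume *: "v \<in> broken_Hgd \<Omega> \<T> \<and> broken_grad_div \<T> v = a"
  define g where "g T = wgrad_div T (l2_restrict T v)" for T
  have g: "g T \<in> L2 T" "has_weak_grad_div T (l2_restrict T v) (g T)" if "T \<in> \<T>" for T
    unfolding g_def using HgdD[of T "l2_restrict T v"] elements(1)[OF that] * that
    by (auto simp: broken_Hgd_def)
  have a: "a = (\<Sum>T\<in>\<T>. g T)" using * by (simp add: broken_grad_div_def g_def)
  have "a \<in> L2 \<Omega>"
    unfolding a using g(1) elements(2) by (intro subspace_sum subspace_L2 open_domain) (blast intro: L2_mono)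
  moreover have "has_weak_grad_div T v a" if T: "T \<in> \<T>" for T
    unfolding has_weak_grad_div_def
  proof
    fix \<phi> :: "'a \<Rightarrow> 'a" assume \<phi>: "\<phi> \<in> test_fun T"
    have "g S \<bullet> l2_of \<phi> = (if S = T then g T \<bullet> l2_of \<phi> else 0)" if "S \<in> \<T>" for S
      using inner_eq_0_if_L2_disjoint[OF g(1)[OF that] l2_of_test_fun_in_L2[OF \<phi>]]
        disjoint_elements that T by (auto simp: pairwise_def disjnt_def)
    then have "a \<bullet> l2_of \<phi> = (\<Sum>S\<in>\<T>. if S = T then g T \<bullet> l2_of \<phi> else 0)"
      unfolding a inner_sum_left by (intro sum.cong) auto
    also have "\<dots> = g T \<bullet> l2_of \<phi>" using T finite_mesh by simp
    also have "\<dots> = v \<bullet> l2_of (grad (dvg \<phi>))"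
      using g(2)[OF T] \<phi> inner_l2_restrict_test_fun[OF elements(1)[OF T] test_fun_grad[OF test_fun_dvg[OF \<phi>]], of v]
      by (simp add: has_weak_grad_div_def)
    finally show "v \<bullet> l2_of (grad (dvg \<phi>)) = a \<bullet> l2_of \<phi>" by simp
  qed
  ultimately show "(v, a) \<in> grad_div_graph \<Omega> \<T>" using * by (auto simp: grad_div_graph_def broken_Hgd_def)
qed

lemma grad_div_graph_unbroken_subset: "grad_div_graph \<Omega> {\<Omega>} \<subseteq> grad_div_graph \<Omega> \<T>"
  using elements(2) test_fun_mono by (auto simp: grad_div_graph_def has_weak_grad_div_def) blast

end

section \<open>Lipschitz domains\<close>

lemma lipschitz_domainE:
  fixes U :: "'a::euclidean_space set"
  assumes "lipschitz_domain U" "x \<in> frontier U"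
  obtains r e \<gamma> K where "r > 0" "norm e = 1" "K-lipschitz_on {z. z \<bullet> e = 0} \<gamma>"
    "U \<inter> ball x r = {y \<in> ball x r. y \<bullet> e < \<gamma> (y - (y \<bullet> e) *\<^sub>R e)}"
proof -
  have "\<forall>x\<in>frontier U. \<exists>r>0. \<exists>e. \<exists>\<gamma>::'a \<Rightarrow> real. \<exists>K. norm e = 1 \<and> K-lipschitz_on {z. z \<bullet> e = 0} \<gamma> \<and>
      U \<inter> ball x r = {y \<in> ball x r. y \<bullet> e < \<gamma> (y - (y \<bullet> e) *\<^sub>R e)}"
    using assms(1) unfolding lipschitz_domain_def by (elim conjE)
  from bspec[OF this assms(2)] show thesis using that by (elim exE conjE) (rule that)
qed

text \<open>A point of the ball below the graph would belong to the open set \<open>U\<close>;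
  strictly above it, continuity of \<gamma> gives a neighbourhood that misses
  \<open>U\<close>.\<close>

lemma frontier_lipschitz_domain:
  assumes "open U" "norm e = 1" "K-lipschitz_on {z. z \<bullet> e = 0} \<gamma>"
    and graph: "U \<inter> ball x r = {y \<in> ball x r. y \<bullet> e < \<gamma> (y - (y \<bullet> e) *\<^sub>R e)}"
    and y: "y \<in> frontier U" "y \<in> ball x r"
  shows "y \<bullet> e = \<gamma> (y - (y \<bullet> e) *\<^sub>R e)"
proof (rule ccontr)
  assume ne: "y \<bullet> e \<noteq> \<gamma> (y - (y \<bullet> e) *\<^sub>R e)"
  have ee: "e \<bullet> e = 1" using assms(2) by (simp add: dot_square_norm)
  have "y \<notin> U" using y(1) assms(1) by (simp add: frontier_def interior_open)
  then have "\<not> y \<bullet> e < \<gamma> (y - (y \<bullet> e) *\<^sub>R e)" using graph y(2) by blast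
  then have gt: "\<gamma> (y - (y \<bullet> e) *\<^sub>R e) < y \<bullet> e" using ne by linarith
  have "continuous_on {z. z \<bullet> e = 0} \<gamma>" using assms(3) by (rule lipschitz_on_continuous_on)
  then have "continuous_on UNIV (\<lambda>y. \<gamma> (y - (y \<bullet> e) *\<^sub>R e))"
    by (rule continuous_on_compose2) (auto intro!: continuous_intros simp: inner_diff_left ee)
  then have "open {y. \<gamma> (y - (y \<bullet> e) *\<^sub>R e) < y \<bullet> e}"
    by (intro open_Collect_less continuous_intros)
  then have op: "open ({y. \<gamma> (y - (y \<bullet> e) *\<^sub>R e) < y \<bullet> e} \<inter> ball x r)" by auto
  have "U \<inter> ({y. \<gamma> (y - (y \<bullet> e) *\<^sub>R e) < y \<bullet> e} \<inter> ball x r) = {}"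
    using graph by (blast dest: less_asym)
  moreover have "y \<in> closure U" using y(1) by (simp add: frontier_def)
  moreover have "y \<in> {y. \<gamma> (y - (y \<bullet> e) *\<^sub>R e) < y \<bullet> e} \<inter> ball x r" using gt y(2) by simp
  ultimately show False using open_Int_closure_eq_empty[OF op, of U] by blast
qed

text \<open>The translates of a piece of the graph in the direction \<open>e\<close> are disjoint, have equal measure
  and stay in a bounded set.\<close>

lemma negligible_if_disjoint_translates:
  fixes G :: "'a::euclidean_space set"
  assumes "compact G" and disj: "\<And>y t. y \<in> G \<Longrightarrow> y + t *\<^sub>R e \<in> G \<Longrightarrow> t = 0"
  shows "negligible G"
proof -
  define A where "A k = (+) ((1 / Suc k) *\<^sub>R e) ` G" for k :: nat
  define B where "B = (\<lambda>(y, t). y + t *\<^sub>R e) ` (G \<times> {0..1})"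
  have mG: "G \<in> lmeasurable" using assms(1) by (rule lmeasurable_compact)
  have mA: "A k \<in> lmeasurable" for k unfolding A_def using mG by (rule measurable_translation)
  have "compact B"
    unfolding B_def by (intro compact_continuous_image compact_Times assms(1) compact_Icc)
      (auto simp: case_prod_unfold intro!: continuous_intros)
  then have mB: "B \<in> lmeasurable" by (rule lmeasurable_compact)
  have "disjnt (A j) (A k)" if "j \<noteq> k" for j k
    unfolding disjnt_iff A_def
  proof (intro allI notI, elim conjE imageE)
    fix z y y' assume *: "z = (1 / Suc j) *\<^sub>R e + y" "y \<in> G" "z = (1 / Suc k) *\<^sub>R e + y'" "y' \<in> G"
    then have "y' = y + (1 / Suc j - 1 / Suc k) *\<^sub>R e" by (simp add: algebra_simps)
    then have "1 / real (Suc j) - 1 / real (Suc k) = 0" using disj[of y] * by blast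
    then have "inverse (real (Suc j)) = inverse (real (Suc k))" by (simp add: inverse_eq_divide)
    then show False using that inverse_eq_iff_eq by (metis Suc_inject of_nat_eq_iff)
  qed
  then have dj: "pairwise (\<lambda>j k. disjnt (A j) (A k)) I" for I by (simp add: pairwise_def)
  have sub: "A k \<subseteq> B" for k
  proof
    fix z assume "z \<in> A k"
    then obtain y where "y \<in> G" "z = (\<lambda>(y, t). y + t *\<^sub>R e) (y, 1 / Suc k)"
      unfolding A_def by (auto simp: add.commute)
    moreover have "1 / real (Suc k) \<in> {0..1}" by simp
    ultimately show "z \<in> B" unfolding B_def by blast
  qed
  have "real n * measure lebesgue G \<le> measure lebesgue B" for n
  proof -
    have "real n * measure lebesgue G = (\<Sum>k<n. measure lebesgue (A k))"
      by (simp add: A_def measure_translation)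
    also have "\<dots> = measure lebesgue (\<Union>k<n. A k)"
      by (rule measure_UNION'[symmetric]) (use mA dj in auto)
    also have "\<dots> \<le> measure lebesgue B"
      by (rule measure_mono_fmeasurable) (use sub mA mB in \<open>auto intro!: fmeasurableD\<close>)
    finally show ?thesis .
  qed
  then have "\<not> measure lebesgue G > 0" using reals_Archimedean3 not_le by blast
  then have "measure lebesgue G = 0" using measure_nonneg[of lebesgue G] by linarith
  then show ?thesis using mG by (simp add: negligible_iff_measure)
qed

lemma negligible_frontier_lipschitz_domain:
  fixes U :: "'a::euclidean_space set"
  assumes "lipschitz_domain U" "bounded U"
  shows "negligible (frontier U)"
proof -
  have "open U" using assms(1) by (simp add: lipschitz_domain_def)
  have "\<exists>r>0. negligible (frontier U \<inter> cball x r)" if x: "x \<in> frontier U" for x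
  proof -
    obtain r e \<gamma> K where r: "r > 0" "norm e = 1" "K-lipschitz_on {z. z \<bullet> e = 0} \<gamma>"
      and graph: "U \<inter> ball x r = {y \<in> ball x r. y \<bullet> e < \<gamma> (y - (y \<bullet> e) *\<^sub>R e)}"
      using assms(1) x by (rule lipschitz_domainE)
    have ee: "e \<bullet> e = 1" using r(2) by (simp add: dot_square_norm)
    \<comment> \<open>The closed ball makes the piece compact, and half the radius keeps it inside
      the open ball in which the graph describes \<open>U\<close>.\<close>
    have "negligible (frontier U \<inter> cball x (r / 2))"
    proof (rule negligible_if_disjoint_translates)
      show "compact (frontier U \<inter> cball x (r / 2))" by (simp add: closed_Int_compact)
      fix y t assume *: "y \<in> frontier U \<inter> cball x (r / 2)" "y + t *\<^sub>R e \<in> frontier U \<inter> cball x (r / 2)"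
      have eq: "z \<bullet> e = \<gamma> (z - (z \<bullet> e) *\<^sub>R e)" if "z \<in> frontier U \<inter> cball x (r / 2)" for z
        by (rule frontier_lipschitz_domain[OF \<open>open U\<close> r(2,3) graph]) (use that r(1) in auto)
      \<comment> \<open>Both points lie over the same base point, where the boundary has only one
        height.\<close>
      have "(y + t *\<^sub>R e) - ((y + t *\<^sub>R e) \<bullet> e) *\<^sub>R e = y - (y \<bullet> e) *\<^sub>R e"
        by (simp add: inner_add_left ee algebra_simps)
      then have "(y + t *\<^sub>R e) \<bullet> e = y \<bullet> e" using eq[OF *(1)] eq[OF *(2)] by metis
      then show "t = 0" by (simp add: inner_add_left ee)
    qed
    then show ?thesis using r(1) by (intro exI[of _ "r / 2"]) auto
  qed
  then obtain r where r: "\<And>x. x \<in> frontier U \<Longrightarrow> r x > 0"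
      "\<And>x. x \<in> frontier U \<Longrightarrow> negligible (frontier U \<inter> cball x (r x))" by metis
  have "compact (frontier U)" using assms(2) by (simp add: compact_frontier_bounded)
  then obtain F where F: "F \<subseteq> frontier U" "finite F" "frontier U \<subseteq> (\<Union>x\<in>F. ball x (r x))"
    by (rule compactE_image[of "frontier U" "frontier U" "\<lambda>x. ball x (r x)"]) (use r in auto)
  have "negligible (\<Union>x\<in>F. frontier U \<inter> cball x (r x))"
    using F r by (intro negligible_Union) auto
  then show ?thesis by (rule negligible_subset) (use F(3) in force)
qed

text \<open>A point of \<Omega> on no element boundary lies in the closure of some element, hence in
  that open element; the boundaries together are negligible.\<close>

lemma open_partition_mesh:
  assumes "open \<Omega>" "bounded \<Omega>" "mesh \<Omega> \<T>"
  shows "open_partition \<Omega> \<T>"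
proof
  have T: "lipschitz_domain T" "T \<subseteq> \<Omega>" if "T \<in> \<T>" for T
    using assms(3) that by (auto simp: mesh_def)
  show T_open: "open T" if "T \<in> \<T>" for T using T(1)[OF that] by (simp add: lipschitz_domain_def)
  have "negligible (\<Union>T\<in>\<T>. frontier T)"
    using assms(3) T bounded_subset[OF assms(2)]
    by (intro negligible_Union) (auto simp: mesh_def intro!: negligible_frontier_lipschitz_domain)
  from AE_lborel_negligible[OF this] show "AE x in lborel. x \<in> \<Omega> \<longrightarrow> x \<in> \<Union>\<T>"
  proof (rule eventually_mono, intro impI)
    fix x assume x: "x \<notin> (\<Union>T\<in>\<T>. frontier T)" "x \<in> \<Omega>"
    then have "x \<in> closure \<Omega>" using closure_subset by blast
    then have "x \<in> (\<Union>T\<in>\<T>. closure T)" using assms(3) by (simp add: mesh_def)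
    then show "x \<in> \<Union>\<T>" using x(1) T_open by (auto simp: frontier_def interior_open)
  qed
qed (use assms in \<open>auto simp: mesh_def\<close>)

text \<open>An interior cone condition with one axis for all points of \<open>U\<close> near x:
  \<gamma> has slope at most K, so a descent by s makes room for any further move of length
  proportional to s.\<close>

lemma lipschitz_domain_cone:
  fixes U :: "'a::euclidean_space set"
  assumes U: "lipschitz_domain U" and x: "x \<in> closure U"
  obtains r e \<eta> \<delta> where "r > 0" "\<eta> > 0" "\<delta> > 0"
    "\<And>y s w. y \<in> U \<Longrightarrow> dist x y \<le> r \<Longrightarrow> 0 \<le> s \<Longrightarrow> s \<le> \<delta> \<Longrightarrow> norm w \<le> \<eta> * s \<Longrightarrow> y - s *\<^sub>R e + w \<in> U"
proof (cases "x \<in> U")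
  case True
  obtain \<rho> where \<rho>: "\<rho> > 0" "ball x \<rho> \<subseteq> U"
    using U True unfolding lipschitz_domain_def by (meson open_contains_ball)
  show thesis
  \<comment> \<open>In the interior the axis may be 0: the displacement is then \<open>w\<close>
    alone, and \<rho> / 2 + \<rho> / 4 < \<rho>.\<close>
  proof (rule that[of "\<rho> / 2" 1 "\<rho> / 4" 0])
    fix y w :: 'a and s :: real
    assume *: "dist x y \<le> \<rho> / 2" "s \<le> \<rho> / 4" "norm w \<le> 1 * s"
    have "dist x (y - s *\<^sub>R 0 + w) \<le> dist x y + norm w"
      using norm_triangle_ineq4[of "x - y" w] by (simp add: dist_norm algebra_simps)
    then show "y - s *\<^sub>R 0 + w \<in> U" using \<rho> * by (intro subsetD[OF \<rho>(2)]) auto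
  qed (use \<rho> in auto)
next
  case False
  then have "x \<in> frontier U" using x U by (simp add: frontier_def lipschitz_domain_def interior_open)
  with U obtain r e \<gamma> K where r: "r > 0" "norm e = 1" and lip: "K-lipschitz_on {z. z \<bullet> e = 0} \<gamma>"
      and graph: "U \<inter> ball x r = {y \<in> ball x r. y \<bullet> e < \<gamma> (y - (y \<bullet> e) *\<^sub>R e)}"
    by (rule lipschitz_domainE)
  have ee: "e \<bullet> e = 1" using r(2) by (simp add: dot_square_norm)
  have hp: "u - (u \<bullet> e) *\<^sub>R e \<in> {z. z \<bullet> e = 0}" for u by (simp add: inner_diff_left ee)
  have K: "K \<ge> 0" using lip by (rule lipschitz_on_nonneg)
  \<comment> \<open>A move of length at most \<eta> s raises the point by at most \<eta> s and
    lowers the graph beneath it by at most K \<eta> s; this \<eta> makes the total equal to the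
    descent s.\<close>
  define \<eta> where "\<eta> = 1 / (1 + K)"
  have \<eta>: "0 < \<eta>" "\<eta> \<le> 1" "\<eta> + K * \<eta> = 1" using K by (auto simp: \<eta>_def field_simps)
  show thesis
  \<comment> \<open>r / 2 + r / 8 + r / 8 < r, so the moved point stays in the ball of the
    graph.\<close>
  proof (rule that[of "r / 2" \<eta> "r / 8" e])
    fix y w :: 'a and s :: real
    assume *: "y \<in> U" "dist x y \<le> r / 2" "0 \<le> s" "s \<le> r / 8" "norm w \<le> \<eta> * s"
    define z where "z = y - s *\<^sub>R e + w"
    have ws: "norm w \<le> s" using * \<eta> by (smt (verit) mult_left_le_one_le)
    have "dist x z \<le> dist x y + norm (s *\<^sub>R e) + norm w"
      unfolding dist_norm z_def using norm_triangle_ineq4[of "x - y + s *\<^sub>R e" w] norm_triangle_ineq[of "x - y" "s *\<^sub>R e"]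
      by (simp add: algebra_simps)
    also have "\<dots> < r" using * r ws by simp
    finally have zb: "z \<in> ball x r" by simp
    have yb: "y \<in> ball x r" using * r by simp
    have yl: "y \<bullet> e < \<gamma> (y - (y \<bullet> e) *\<^sub>R e)" using graph *(1) yb by blast
    have pz: "z - (z \<bullet> e) *\<^sub>R e = (y - (y \<bullet> e) *\<^sub>R e) + (w - (w \<bullet> e) *\<^sub>R e)"
      by (simp add: z_def inner_simps ee algebra_simps)
    have we: "\<bar>w \<bullet> e\<bar> \<le> norm w" using Cauchy_Schwarz_ineq2[of w e] r(2) by simp
    have "(norm (w - (w \<bullet> e) *\<^sub>R e))\<^sup>2 = (norm w)\<^sup>2 - (w \<bullet> e)\<^sup>2"
      unfolding power2_norm_eq_inner by (simp add: inner_simps ee inner_commute power2_eq_square)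
    then have "(norm (w - (w \<bullet> e) *\<^sub>R e))\<^sup>2 \<le> (norm w)\<^sup>2" by simp
    then have "norm (w - (w \<bullet> e) *\<^sub>R e) \<le> norm w" by (rule power2_le_imp_le) simp
    moreover have "\<bar>\<gamma> (z - (z \<bullet> e) *\<^sub>R e) - \<gamma> (y - (y \<bullet> e) *\<^sub>R e)\<bar> \<le> K * norm (w - (w \<bullet> e) *\<^sub>R e)"
      using lipschitz_onD[OF lip hp hp, of z y] by (simp add: dist_norm pz)
    ultimately have g: "\<bar>\<gamma> (z - (z \<bullet> e) *\<^sub>R e) - \<gamma> (y - (y \<bullet> e) *\<^sub>R e)\<bar> \<le> K * (\<eta> * s)"
      using K * by (meson mult_left_mono order_trans)
    have "\<eta> * s + K * (\<eta> * s) = s" using \<eta>(3) by (metis distrib_right mult.assoc mult_1)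
    moreover have "z \<bullet> e = y \<bullet> e - s + w \<bullet> e" by (simp add: z_def inner_simps ee)
    ultimately have "z \<bullet> e < \<gamma> (z - (z \<bullet> e) *\<^sub>R e)" using yl g we * by linarith
    then show "y - s *\<^sub>R e + w \<in> U" using graph zb unfolding z_def by blast
  qed (use r \<eta> in auto)
qed

section \<open>The divergence of a function in \<open>H(\<nabla>div, \<Omega>)\<close>\<close>

text \<open>A weighted mean over the segment from x back to x - h, so that supports grow forward
  along h. Along h, the derivative of the mean with weight 1 is a difference of \<phi>, and that of
  the mean with weight 1 - s is \<phi> minus the plain mean.\<close>

definition avg_along :: "(real \<Rightarrow> real) \<Rightarrow> 'a::euclidean_space \<Rightarrow> ('a \<Rightarrow> real) \<Rightarrow> 'a \<Rightarrow> real" where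
  "avg_along w h \<phi> x = integral {0..1} (\<lambda>s. w s * \<phi> (x - s *\<^sub>R h))"

lemma dir_deriv_grad:
  fixes \<phi> :: "'a::euclidean_space \<Rightarrow> real"
  assumes "smooth_fun \<phi>"
  shows "dir_deriv \<phi> v x = v \<bullet> grad \<phi> x"
  using dir_deriv_basis[OF assms, of v x] by (simp add: grad_eq inner_sum_right mult.commute)

lemma smooth_fun_grad: "smooth_fun \<phi> \<Longrightarrow> smooth_fun (grad \<phi>)"
  unfolding grad_eq by (intro smooth_fun_sum smooth_fun_scaleR smooth_fun_dir_deriv smooth_fun_const)

lemma continuous_on_along:
  assumes "smooth_fun \<phi>"
  shows "continuous_on A (\<lambda>s. \<phi> (x - s *\<^sub>R h))"
  by (rule continuous_on_compose2[OF smooth_fun_continuous[OF assms, of UNIV]])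
    (auto intro!: continuous_intros)

lemma avg_along_has_derivative:
  assumes w: "continuous_on {0..1} w" and \<phi>: "smooth_fun \<phi>"
  shows "(avg_along w h \<phi> has_derivative (\<lambda>v. avg_along w h (dir_deriv \<phi> v) x)) (at x)"
proof -
  \<comment> \<open>The Leibniz rule takes the derivative as a bounded linear map, jointly
    continuous in (x, s); the inner product with the gradient provides it.\<close>
  define D where "D x s = w s *\<^sub>R blinfun_inner_left (grad \<phi> (x - s *\<^sub>R h))" for x s
  have cg: "continuous_on A (\<lambda>z. grad \<phi> (fst z - snd z *\<^sub>R h))" for A
    by (rule continuous_on_compose2[OF smooth_fun_continuous[OF smooth_fun_grad[OF \<phi>], of UNIV]])
      (auto intro!: continuous_intros)
  have contD: "continuous_on (UNIV \<times> cbox 0 1) (\<lambda>(x, s). D x s)"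
    unfolding D_def case_prod_unfold
    by (intro continuous_on_scaleR bounded_linear.continuous_on[OF bounded_linear_blinfun_inner_left] cg)
      (auto intro!: continuous_on_compose2[OF w] continuous_intros)
  have "((\<lambda>x. integral (cbox 0 1) (\<lambda>s. w s * \<phi> (x - s *\<^sub>R h))) has_derivative integral (cbox 0 1) (D x)) (at x within UNIV)"
  proof (rule leibniz_rule[OF _ _ contD])
    fix x s
    have "((\<lambda>x. \<phi> (x - s *\<^sub>R h)) has_derivative (\<lambda>v. dir_deriv \<phi> v (x - s *\<^sub>R h))) (at x)"
      by (rule has_derivative_compose[OF _ smooth_fun_has_derivative[OF \<phi>]])
        (auto intro!: derivative_eq_intros)
    then have "((\<lambda>x. w s * \<phi> (x - s *\<^sub>R h)) has_derivative (\<lambda>v. w s * dir_deriv \<phi> v (x - s *\<^sub>R h))) (at x)"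
      by (rule has_derivative_mult_right)
    moreover have "blinfun_apply (D x s) = (\<lambda>v. w s * dir_deriv \<phi> v (x - s *\<^sub>R h))"
      by (rule ext) (simp add: D_def dir_deriv_grad[OF \<phi>] blinfun.bilinear_simps)
    ultimately show "((\<lambda>x. w s * \<phi> (x - s *\<^sub>R h)) has_derivative D x s) (at x within UNIV)"
      by simp
    show "(\<lambda>s. w s * \<phi> (x - s *\<^sub>R h)) integrable_on cbox 0 1"
      by (rule integrable_continuous) (intro continuous_intros continuous_on_along \<phi>, simp add: w)
  qed auto
  moreover have "(integral (cbox 0 1) (D x)) v = avg_along w h (dir_deriv \<phi> v) x" for v
  proof -
    have "continuous_on (cbox 0 1) (D x)"
      using contD by (rule continuous_on_compose2[where f="Pair x" and g="\<lambda>(x, s). D x s", simplified])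
        (auto intro!: continuous_intros)
    then have "D x integrable_on cbox 0 1" by (rule integrable_continuous)
    then have "integral (cbox 0 1) (\<lambda>s. D x s v) = integral (cbox 0 1) (D x) v"
      using integral_linear[of "D x" "cbox 0 1" "\<lambda>f. blinfun_apply f v"]
      by (simp add: o_def blinfun.bounded_linear_left)
    then show ?thesis by (simp add: avg_along_def D_def dir_deriv_grad[OF \<phi>] blinfun.bilinear_simps)
  qed
  then have "blinfun_apply (integral (cbox 0 1) (D x)) = (\<lambda>v. avg_along w h (dir_deriv \<phi> v) x)"
    by (rule ext)
  ultimately show ?thesis by (simp add: avg_along_def[abs_def])
qed

lemma dir_deriv_avg_along:
  "continuous_on {0..1} w \<Longrightarrow> smooth_fun \<phi> \<Longrightarrow> dir_deriv (avg_along w h \<phi>) v = avg_along w h (dir_deriv \<phi> v)"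
  by (rule ext, rule dir_deriv_eqI[OF avg_along_has_derivative])

lemma smooth_fun_avg_along:
  assumes w: "continuous_on {0..1} w" and \<phi>: "smooth_fun \<phi>"
  shows "smooth_fun (avg_along w h \<phi>)"
proof (rule smooth_funI[of _ "avg_along w h ` Collect smooth_fun"])
  fix f assume "f \<in> avg_along w h ` Collect smooth_fun"
  then obtain \<psi> where \<psi>: "f = avg_along w h \<psi>" "smooth_fun \<psi>" by auto
  show "\<exists>D. (\<forall>x. (f has_derivative D x) (at x)) \<and> (\<forall>i\<in>Basis. (\<lambda>x. D x i) \<in> avg_along w h ` Collect smooth_fun)"
  proof (intro exI[of _ "\<lambda>x v. avg_along w h (dir_deriv \<psi> v) x"] conjI allI ballI)
    show "(f has_derivative (\<lambda>v. avg_along w h (dir_deriv \<psi> v) x)) (at x)" for x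
      unfolding \<psi>(1) by (rule avg_along_has_derivative[OF w \<psi>(2)])
    show "(\<lambda>x. avg_along w h (dir_deriv \<psi> i) x) \<in> avg_along w h ` Collect smooth_fun" for i
      using smooth_fun_dir_deriv[OF \<psi>(2), of i] by auto
  qed
qed (use \<phi> in auto)

lemma has_real_derivative_along:
  fixes \<phi> :: "'a::euclidean_space \<Rightarrow> real"
  assumes "smooth_fun \<phi>"
  shows "((\<lambda>s. \<phi> (x - s *\<^sub>R h)) has_real_derivative - dir_deriv \<phi> h (x - s *\<^sub>R h)) (at s within A)"
proof -
  have "((\<lambda>s. x - s *\<^sub>R h) has_derivative (\<lambda>t. - (t *\<^sub>R h))) (at s within A)"
    by (auto intro!: derivative_eq_intros)
  note D = has_derivative_compose[OF this smooth_fun_has_derivative[OF assms]]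
  have "(\<lambda>t. dir_deriv \<phi> (- (t *\<^sub>R h)) (x - s *\<^sub>R h)) = (*) (- dir_deriv \<phi> h (x - s *\<^sub>R h))"
    by (rule ext) (simp add: dir_deriv_grad[OF assms])
  with D show ?thesis by (simp add: has_field_derivative_def)
qed

lemma dir_deriv_avg_along_1:
  assumes "smooth_fun \<phi>"
  shows "dir_deriv (avg_along (\<lambda>s. 1) h \<phi>) h x = \<phi> x - \<phi> (x - h)"
proof -
  have "((\<lambda>s. dir_deriv \<phi> h (x - s *\<^sub>R h)) has_integral (- \<phi> (x - 1 *\<^sub>R h) - (- \<phi> (x - 0 *\<^sub>R h)))) {0..1}"
    by (rule fundamental_theorem_of_calculus)
      (auto intro!: derivative_eq_intros has_real_derivative_along assms
        simp flip: has_real_derivative_iff_has_vector_derivative)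
  then show ?thesis by (simp add: dir_deriv_avg_along[OF _ assms] avg_along_def integral_unique)
qed

text \<open>Integration by parts in s: the weight vanishes at s = 1, so the only boundary term is
  \<phi> x, from s = 0.\<close>

lemma dir_deriv_avg_along_1_minus:
  assumes "smooth_fun \<phi>"
  shows "dir_deriv (avg_along (\<lambda>s. 1 - s) h \<phi>) h x = \<phi> x - avg_along (\<lambda>s. 1) h \<phi> x"
proof -
  have "((\<lambda>s. \<phi> (x - s *\<^sub>R h) + (1 - s) * dir_deriv \<phi> h (x - s *\<^sub>R h)) has_integral
      (- ((1 - 1) * \<phi> (x - 1 *\<^sub>R h)) - (- ((1 - 0) * \<phi> (x - 0 *\<^sub>R h))))) {0..1}"
    by (rule fundamental_theorem_of_calculus)
      (auto intro!: derivative_eq_intros has_real_derivative_along assms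
        simp flip: has_real_derivative_iff_has_vector_derivative)
  then have "integral {0..1} (\<lambda>s. \<phi> (x - s *\<^sub>R h) + (1 - s) * dir_deriv \<phi> h (x - s *\<^sub>R h)) = \<phi> x"
    by (simp add: integral_unique)
  moreover have "integral {0..1} (\<lambda>s. \<phi> (x - s *\<^sub>R h) + (1 - s) * dir_deriv \<phi> h (x - s *\<^sub>R h))
    = integral {0..1} (\<lambda>s. \<phi> (x - s *\<^sub>R h)) + integral {0..1} (\<lambda>s. (1 - s) * dir_deriv \<phi> h (x - s *\<^sub>R h))"
    by (intro Henstock_Kurzweil_Integration.integral_add integrable_continuous_interval continuous_intros
        continuous_on_along assms smooth_fun_dir_deriv)
  moreover have "continuous_on {0..1} (\<lambda>s::real. 1 - s)" by (intro continuous_intros)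
  ultimately show ?thesis by (simp add: dir_deriv_avg_along[OF _ assms] avg_along_def)
qed

lemma avg_along_zero_off:
  assumes "\<And>x. x \<notin> K \<Longrightarrow> \<phi> x = 0" "x \<notin> (\<lambda>(y, s). y + s *\<^sub>R h) ` (K \<times> {0..1})"
  shows "avg_along w h \<phi> x = 0"
proof -
  have zero: "\<phi> (x - s *\<^sub>R h) = 0" if "s \<in> {0..1}" for s
  proof (rule assms(1), rule notI)
    assume "x - s *\<^sub>R h \<in> K"
    then have "(\<lambda>(y, s). y + s *\<^sub>R h) (x - s *\<^sub>R h, s) \<in> (\<lambda>(y, s). y + s *\<^sub>R h) ` (K \<times> {0..1})"
      using that by (intro imageI) auto
    then show False using assms(2) by simp
  qed
  have "avg_along w h \<phi> x = integral {0..1} (\<lambda>s::real. 0)"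
    unfolding avg_along_def by (rule Henstock_Kurzweil_Integration.integral_cong) (simp add: zero)
  then show ?thesis by simp
qed

text \<open>Jensen's inequality, in the form that the variance of the weighted integrand over [0, 1]
  is nonnegative.\<close>

lemma avg_along_power2_le:
  assumes w: "continuous_on {0..1} w" "\<And>s. s \<in> {0..1} \<Longrightarrow> \<bar>w s\<bar> \<le> 1" and \<phi>: "smooth_fun \<phi>"
  shows "(avg_along w h \<phi> x)\<^sup>2 \<le> integral {0..1} (\<lambda>s. (\<phi> (x - s *\<^sub>R h))\<^sup>2)"
proof -
  define m where "m = avg_along w h \<phi> x"
  define g where "g s = w s * \<phi> (x - s *\<^sub>R h)" for s
  have cg: "continuous_on {0..1} g"
    unfolding g_def by (intro continuous_intros continuous_on_along \<phi> w)
  have ig: "integral {0..1} g = m" by (simp add: m_def avg_along_def g_def[abs_def])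
  have "0 \<le> integral {0..1} (\<lambda>s. (g s - m)\<^sup>2)"
    by (intro integral_nonneg integrable_continuous_interval continuous_intros cg) auto
  also have "\<dots> = integral {0..1} (\<lambda>s. (g s)\<^sup>2 - 2 * m * g s + m\<^sup>2)"
    by (simp add: power2_diff algebra_simps)
  also have "\<dots> = integral {0..1} (\<lambda>s. (g s)\<^sup>2) - 2 * m * m + m\<^sup>2"
    by (subst Henstock_Kurzweil_Integration.integral_add Henstock_Kurzweil_Integration.integral_diff;
        (intro integrable_continuous_interval continuous_intros cg)?)+ (simp add: ig)
  finally have "m\<^sup>2 \<le> integral {0..1} (\<lambda>s. (g s)\<^sup>2)" by (simp add: power2_eq_square)
  also have "\<dots> \<le> integral {0..1} (\<lambda>s. (\<phi> (x - s *\<^sub>R h))\<^sup>2)"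
  proof (rule integral_le)
    fix s :: real assume "s \<in> {0..1}"
    then have "(w s)\<^sup>2 \<le> 1" using w(2) by (simp add: abs_square_le_1)
    then show "(g s)\<^sup>2 \<le> (\<phi> (x - s *\<^sub>R h))\<^sup>2"
      by (simp add: g_def power_mult_distrib mult_left_le_one_le)
  qed (intro integrable_continuous_interval continuous_intros cg continuous_on_along \<phi>)+
  finally show ?thesis by (simp add: m_def)
qed

section \<open>Translations and averages in L2\<close>

lemma nn_integral_lborel_translation:
  assumes [measurable]: "f \<in> borel_measurable borel"
  shows "(\<integral>\<^sup>+x. f (x - c) \<partial>lborel) = (\<integral>\<^sup>+x. f x \<partial>(lborel :: 'a::euclidean_space measure))"
proof -
  have "(\<integral>\<^sup>+x. f x \<partial>lborel) = (\<integral>\<^sup>+x. f x \<partial>distr lborel borel ((+) (- c)))"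
    by (simp add: lborel_distr_plus)
  also have "\<dots> = (\<integral>\<^sup>+x. f (- c + x) \<partial>lborel)" by (rule nn_integral_distr) auto
  finally show ?thesis by simp
qed

lemma test_fun_translation:
  assumes "\<phi> \<in> test_fun UNIV"
  shows "(\<lambda>x. \<phi> (x - h)) \<in> test_fun UNIV"
proof -
  obtain K where K: "smooth_fun \<phi>" "compact K" "\<And>x. x \<notin> K \<Longrightarrow> \<phi> x = 0"
    using assms by (rule test_funE) blast
  have "smooth_fun (\<lambda>x. \<phi> (x - h))"
  proof (rule smooth_funI[of _ "(\<lambda>f x. f (x - h)) ` Collect smooth_fun"])
    fix f assume "f \<in> (\<lambda>f x. f (x - h)) ` Collect smooth_fun"
    then obtain \<psi> where \<psi>: "f = (\<lambda>x. \<psi> (x - h))" "smooth_fun \<psi>" by auto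
    show "\<exists>D. (\<forall>x. (f has_derivative D x) (at x)) \<and> (\<forall>i\<in>Basis. (\<lambda>x. D x i) \<in> (\<lambda>f x. f (x - h)) ` Collect smooth_fun)"
    proof (intro exI[of _ "\<lambda>x v. dir_deriv \<psi> v (x - h)"] conjI allI ballI)
      show "(f has_derivative (\<lambda>v. dir_deriv \<psi> v (x - h))) (at x)" for x
        unfolding \<psi>(1) by (rule has_derivative_compose[OF _ smooth_fun_has_derivative[OF \<psi>(2)]])
          (auto intro!: derivative_eq_intros)
      show "(\<lambda>x. dir_deriv \<psi> i (x - h)) \<in> (\<lambda>f x. f (x - h)) ` Collect smooth_fun" for i
        using smooth_fun_dir_deriv[OF \<psi>(2), of i] by (auto intro!: image_eqI[of _ _ "dir_deriv \<psi> i"])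
    qed
  qed (use K in auto)
  then show ?thesis
  proof (rule test_funI[of _ "(+) h ` K"])
    fix x assume "x \<notin> (+) h ` K"
    then have "x - h \<notin> K" using image_eqI[of x "(+) h" "x - h" K] by auto
    then show "\<phi> (x - h) = 0" by (rule K(3))
  qed (use K in \<open>auto intro: compact_translation\<close>)
qed

lemma norm_l2_of_translation:
  fixes \<phi> :: "'a::euclidean_space \<Rightarrow> real"
  assumes "\<phi> \<in> test_fun UNIV"
  shows "norm (l2_of (\<lambda>x. \<phi> (x - h))) = norm (l2_of \<phi>)"
proof -
  have [measurable]: "\<phi> \<in> borel_measurable borel"
    using test_fun_L2[OF assms] by (simp add: square_integrable_def)
  have "ennreal ((norm (l2_of (\<lambda>x. \<phi> (x - h))))\<^sup>2) = ennreal ((norm (l2_of \<phi>))\<^sup>2)"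
    using nn_integral_lborel_translation[of "\<lambda>x. ennreal ((norm (\<phi> x))\<^sup>2)" h]
      nn_integral_norm_l2_of[OF test_fun_L2[OF assms]]
      nn_integral_norm_l2_of[OF test_fun_L2[OF test_fun_translation[OF assms]], of h]
    by simp
  then show ?thesis by (simp add: power2_eq_iff_nonneg)
qed

text \<open>The pointwise bound by a mean of squares, Tonelli and translation invariance make
  averaging a contraction.\<close>

lemma norm_l2_of_avg_along_le:
  assumes w: "continuous_on {0..1} w" "\<And>s. s \<in> {0..1} \<Longrightarrow> \<bar>w s\<bar> \<le> 1" and \<phi>: "\<phi> \<in> test_fun UNIV"
    and av: "avg_along w h \<phi> \<in> test_fun UNIV"
  shows "norm (l2_of (avg_along w h \<phi>)) \<le> norm (l2_of \<phi>)"
proof -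
  have [measurable]: "\<phi> \<in> borel_measurable borel"
    using test_fun_L2[OF \<phi>] by (simp add: square_integrable_def)
  have sm: "smooth_fun \<phi>" using \<phi> by (rule test_fun_smooth)
  have "ennreal ((norm (l2_of (avg_along w h \<phi>)))\<^sup>2) = (\<integral>\<^sup>+x. ennreal ((avg_along w h \<phi> x)\<^sup>2) \<partial>lborel)"
    using nn_integral_norm_l2_of[OF test_fun_L2[OF av]] by simp
  also have "\<dots> \<le> (\<integral>\<^sup>+x. \<integral>\<^sup>+s. ennreal ((\<phi> (x - s *\<^sub>R h))\<^sup>2) * indicator {0..1} s \<partial>lborel \<partial>lborel)"
  proof (rule nn_integral_mono)
    fix x
    have "(\<lambda>s. (\<phi> (x - s *\<^sub>R h))\<^sup>2) integrable_on {0..1}"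
      by (intro integrable_continuous_interval continuous_intros continuous_on_along sm)
    then have "(\<integral>\<^sup>+s. ennreal ((\<phi> (x - s *\<^sub>R h))\<^sup>2) * indicator {0..1} s \<partial>lborel)
        = ennreal (integral {0..1} (\<lambda>s. (\<phi> (x - s *\<^sub>R h))\<^sup>2))"
      by (intro nn_integral_has_integral_lebesgue') (auto simp: has_integral_integral)
    then show "ennreal ((avg_along w h \<phi> x)\<^sup>2) \<le> (\<integral>\<^sup>+s. ennreal ((\<phi> (x - s *\<^sub>R h))\<^sup>2) * indicator {0..1} s \<partial>lborel)"
      using avg_along_power2_le[OF w sm] by (simp add: ennreal_leI)
  qed
  also have "\<dots> = (\<integral>\<^sup>+s. \<integral>\<^sup>+x. ennreal ((\<phi> (x - s *\<^sub>R h))\<^sup>2) * indicator {0..1} s \<partial>lborel \<partial>lborel)"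
    by (rule lborel_pair.Fubini'[symmetric]) measurable
  also have "\<dots> = (\<integral>\<^sup>+s. ennreal ((norm (l2_of \<phi>))\<^sup>2) * indicator {0..1} (s::real) \<partial>lborel)"
  proof (rule nn_integral_cong)
    fix s :: real
    have "(\<integral>\<^sup>+x. ennreal ((\<phi> (x - s *\<^sub>R h))\<^sup>2) * indicator {0..1} s \<partial>lborel)
        = (\<integral>\<^sup>+x. ennreal ((\<phi> (x - s *\<^sub>R h))\<^sup>2) \<partial>lborel) * indicator {0..1} s"
      by (rule nn_integral_multc) measurable
    also have "(\<integral>\<^sup>+x. ennreal ((\<phi> (x - s *\<^sub>R h))\<^sup>2) \<partial>lborel) = ennreal ((norm (l2_of \<phi>))\<^sup>2)"
      using nn_integral_lborel_translation[of "\<lambda>x. ennreal ((\<phi> x)\<^sup>2)" "s *\<^sub>R h"]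
        nn_integral_norm_l2_of[OF test_fun_L2[OF \<phi>]] by simp
    finally show "(\<integral>\<^sup>+x. ennreal ((\<phi> (x - s *\<^sub>R h))\<^sup>2) * indicator {0..1} s \<partial>lborel)
        = ennreal ((norm (l2_of \<phi>))\<^sup>2) * indicator {0..1} s" .
  qed
  also have "\<dots> = ennreal ((norm (l2_of \<phi>))\<^sup>2)" by (simp add: nn_integral_cmult_indicator)
  finally have "(norm (l2_of (avg_along w h \<phi>)))\<^sup>2 \<le> (norm (l2_of \<phi>))\<^sup>2" by simp
  then show ?thesis by (rule power2_le_imp_le) simp
qed

text \<open>Riesz representation read off from a graph, which avoids extending the functional to a
  dense or complete domain. Projecting (0, 1) onto the closure of \<open>G\<close> leaves a normal
  vector (a, c), and the representative is -a / c.\<close>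

lemma bounded_functional_graph_representable:
  fixes G :: "('a::{real_inner, complete_space} \<times> real) set"
  assumes G: "subspace G" and bound: "\<And>x t. (x, t) \<in> G \<Longrightarrow> \<bar>t\<bar> \<le> C * norm x"
  obtains p where "\<And>x t. (x, t) \<in> G \<Longrightarrow> t = p \<bullet> x"
proof -
  obtain q where q: "q \<in> closure G" "\<And>z. z \<in> closure G \<Longrightarrow> ((0, 1) - q) \<bullet> z = 0"
    using ex_orthogonal_projection[of "closure G" "(0, 1)"] G by (auto simp: subspace_closure)
  obtain a c where ac: "(0, 1) - q = (a, c)" by (cases "(0, 1) - q") auto
  have cl: "closed {z :: 'a \<times> real. \<bar>snd z\<bar> \<le> C * norm (fst z)}"
    by (intro closed_Collect_le continuous_intros)
  have "closure G \<subseteq> {z. \<bar>snd z\<bar> \<le> C * norm (fst z)}"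
    by (rule closure_minimal[OF _ cl]) (use bound in auto)
  with q(1) have "q \<noteq> (0, 1)" by auto
  moreover have "(a, c) \<bullet> q = 0" using q(2)[OF q(1)] ac by simp
  \<comment> \<open>If c were 0, then q = (-a, 1); orthogonality to (a, 0) would give a = 0 and q =
    (0, 1), where the bound, valid on the closure too, fails.\<close>
  ultimately have "c \<noteq> 0" using ac by (cases q) auto
  have "t = ((- 1 / c) *\<^sub>R a) \<bullet> x" if "(x, t) \<in> G" for x t
  proof -
    have "(x, t) \<in> closure G" using that closure_subset by blast
    from q(2)[OF this] have "a \<bullet> x + c * t = 0" unfolding ac by simp
    then have "t = - (a \<bullet> x) / c" using \<open>c \<noteq> 0\<close>
      by (metis add_eq_0_iff nonzero_mult_div_cancel_left)
    then show ?thesis by simp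
  qed
  then show thesis by (rule that)
qed

text \<open>Controls supports: if \<phi> vanishes off \<open>K\<close>, then
  \<open>steklov hs \<phi>\<close> vanishes off \<open>sweep hs K\<close>. Both recursions consume
  the list from the front, so inductions run with \<open>K\<close> and \<phi> arbitrary.\<close>

fun sweep :: "'a::real_vector list \<Rightarrow> 'a set \<Rightarrow> 'a set" where
  "sweep [] K = K"
| "sweep (h # hs) K = sweep hs ((\<lambda>(y, s). y + s *\<^sub>R h) ` (K \<times> {0..1}))"

fun steklov :: "'a::euclidean_space list \<Rightarrow> ('a \<Rightarrow> real) \<Rightarrow> 'a \<Rightarrow> real" where
  "steklov [] \<phi> = \<phi>"
| "steklov (h # hs) \<phi> = steklov hs (avg_along (\<lambda>s. 1) h \<phi>)"

lemma subset_sweep_1: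
  fixes K :: "'a::real_vector set"
  shows "K \<subseteq> (\<lambda>(y, s). y + s *\<^sub>R h) ` (K \<times> {0..1::real})"
proof
  fix y assume "y \<in> K"
  then show "y \<in> (\<lambda>(y, s). y + s *\<^sub>R h) ` (K \<times> {0..1::real})"
    by (intro image_eqI[of _ _ "(y, 0)"]) auto
qed

lemma subset_sweep: "K \<subseteq> sweep hs K"
proof (induction hs arbitrary: K)
  case (Cons h hs)
  show ?case unfolding sweep.simps by (rule order_trans[OF subset_sweep_1 Cons.IH])
qed simp

lemma compact_sweep_1:
  fixes K :: "'a::real_normed_vector set"
  assumes "compact K"
  shows "compact ((\<lambda>(y, s). y + s *\<^sub>R h) ` (K \<times> {0..1::real}))"
  by (intro compact_continuous_image compact_Times assms compact_Icc)
    (auto simp: case_prod_unfold intro!: continuous_intros)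

lemma compact_sweep:
  fixes K :: "'a::real_normed_vector set"
  shows "compact K \<Longrightarrow> compact (sweep hs K)"
  by (induction hs arbitrary: K) (auto simp: compact_sweep_1)

lemma avg_along_test_fun:
  assumes "continuous_on {0..1} w" "smooth_fun \<phi>" "compact K" "\<And>x. x \<notin> K \<Longrightarrow> \<phi> x = 0"
    and "(\<lambda>(y, s). y + s *\<^sub>R h) ` (K \<times> {0..1}) \<subseteq> U"
  shows "avg_along w h \<phi> \<in> test_fun U"
  by (rule test_funI[OF smooth_fun_avg_along[OF assms(1,2)] compact_sweep_1[OF assms(3), of h] assms(5)])
    (rule avg_along_zero_off[OF assms(4)])

lemma avg_along_test_fun_UNIV:
  assumes "continuous_on {0..1} w" "\<phi> \<in> test_fun UNIV"
  shows "avg_along w h \<phi> \<in> test_fun UNIV"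
proof -
  obtain K where "smooth_fun \<phi>" "compact K" "\<And>x. x \<notin> K \<Longrightarrow> \<phi> x = 0"
    using assms(2) by (rule test_funE) blast
  then show ?thesis using assms(1) by (intro avg_along_test_fun) auto
qed

lemma smooth_fun_steklov: "smooth_fun \<phi> \<Longrightarrow> smooth_fun (steklov hs \<phi>)"
  by (induction hs arbitrary: \<phi>) (auto simp: smooth_fun_avg_along)

lemma steklov_zero_off: "(\<And>x. x \<notin> K \<Longrightarrow> \<phi> x = 0) \<Longrightarrow> x \<notin> sweep hs K \<Longrightarrow> steklov hs \<phi> x = 0"
proof (induction hs arbitrary: K \<phi>)
  case (Cons h hs)
  show ?case unfolding steklov.simps
    by (rule Cons.IH[OF avg_along_zero_off[OF Cons.prems(1)]]) (use Cons.prems(2) in auto)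
qed auto

lemma steklov_test_fun:
  assumes "smooth_fun \<phi>" "compact K" "\<And>x. x \<notin> K \<Longrightarrow> \<phi> x = 0" "sweep hs K \<subseteq> U"
  shows "steklov hs \<phi> \<in> test_fun U"
  by (rule test_funI[OF smooth_fun_steklov[OF assms(1)] compact_sweep[OF assms(2)] assms(4)])
    (rule steklov_zero_off[OF assms(3)])

lemma norm_steklov_le:
  "\<phi> \<in> test_fun UNIV \<Longrightarrow> norm (l2_of (steklov hs \<phi>)) \<le> norm (l2_of \<phi>)"
proof (induction hs arbitrary: \<phi>)
  case (Cons h hs)
  have av: "avg_along (\<lambda>s. 1) h \<phi> \<in> test_fun UNIV"
    using Cons.prems by (intro avg_along_test_fun_UNIV) auto
  have "norm (l2_of (avg_along (\<lambda>s. 1) h \<phi>)) \<le> norm (l2_of \<phi>)"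
    by (rule norm_l2_of_avg_along_le) (use Cons.prems av in auto)
  then show ?case using Cons.IH[OF av] by simp
qed simp

lemma dir_deriv_steklov: "smooth_fun \<phi> \<Longrightarrow> dir_deriv (steklov hs \<phi>) v = steklov hs (dir_deriv \<phi> v)"
  by (induction hs arbitrary: \<phi>) (auto simp: smooth_fun_avg_along dir_deriv_avg_along)

text \<open>Differentiation commutes with averaging, and an average along h turns the derivative
  along h into the difference of \<phi> and a translate, whence the 2. The remaining averages are
  contractions.\<close>

lemma norm_dir_deriv_steklov_le:
  "\<phi> \<in> test_fun UNIV \<Longrightarrow> h \<in> set hs \<Longrightarrow> norm (l2_of (dir_deriv (steklov hs \<phi>) h)) \<le> 2 * norm (l2_of \<phi>)"
proof (induction hs arbitrary: \<phi>)
  case (Cons k hs)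
  have sm: "smooth_fun \<phi>" using Cons.prems(1) by (rule test_fun_smooth)
  have av: "avg_along (\<lambda>s. 1) k \<phi> \<in> test_fun UNIV"
    using Cons.prems by (intro avg_along_test_fun_UNIV) auto
  have le: "norm (l2_of (avg_along (\<lambda>s. 1) k \<phi>)) \<le> norm (l2_of \<phi>)"
    by (rule norm_l2_of_avg_along_le) (use Cons.prems av in auto)
  show ?case
  proof (cases "h \<in> set hs")
    case True
    then show ?thesis using Cons.IH[OF av] le by simp
  next
    case False
    then have "h = k" using Cons.prems by simp
    then have d: "dir_deriv (avg_along (\<lambda>s. 1) k \<phi>) h = (\<lambda>x. \<phi> x - \<phi> (x - k))"
      using dir_deriv_avg_along_1[OF sm] by auto
    have "norm (l2_of (dir_deriv (steklov hs (avg_along (\<lambda>s. 1) k \<phi>)) h))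
        \<le> norm (l2_of (dir_deriv (avg_along (\<lambda>s. 1) k \<phi>) h))"
      using norm_steklov_le[OF test_fun_dir_deriv[OF av]] dir_deriv_steklov[OF test_fun_smooth[OF av]] by metis
    also have "\<dots> = norm (l2_of \<phi> - l2_of (\<lambda>x. \<phi> (x - k)))"
      unfolding d by (subst l2_of_diff)
        (auto intro: test_fun_L2[OF Cons.prems(1)]
          test_fun_L2[OF test_fun_translation[OF Cons.prems(1)]])
    also have "\<dots> \<le> norm (l2_of \<phi>) + norm (l2_of (\<lambda>x. \<phi> (x - k)))" by (rule norm_triangle_ineq4)
    also have "\<dots> = 2 * norm (l2_of \<phi>)" by (simp add: norm_l2_of_translation[OF Cons.prems(1)])
    finally show ?thesis by simp
  qed
qed simp

section \<open>Bounding the divergence as a functional on test functions\<close>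

lemma dir_deriv_diff:
  "smooth_fun \<phi> \<Longrightarrow> smooth_fun \<psi> \<Longrightarrow> dir_deriv (\<lambda>x. \<phi> x - \<psi> x) h = (\<lambda>x. dir_deriv \<phi> h x - dir_deriv \<psi> h x)"
  by (rule ext, rule dir_deriv_eqI[where D="\<lambda>h. dir_deriv \<phi> h x - dir_deriv \<psi> h x" for x])
    (intro derivative_intros smooth_fun_has_derivative)

lemma grad_add: "smooth_fun \<phi> \<Longrightarrow> smooth_fun \<psi> \<Longrightarrow> grad (\<lambda>x. \<phi> x + \<psi> x) = (\<lambda>x. grad \<phi> x + grad \<psi> x)"
  by (simp add: grad_eq dir_deriv_add scaleR_add_left sum.distrib)

lemma grad_diff: "smooth_fun \<phi> \<Longrightarrow> smooth_fun \<psi> \<Longrightarrow> grad (\<lambda>x. \<phi> x - \<psi> x) = (\<lambda>x. grad \<phi> x - grad \<psi> x)"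
  by (simp add: grad_eq dir_deriv_diff scaleR_diff_left sum_subtractf)

lemma grad_cmult:
  assumes "smooth_fun \<phi>"
  shows "grad (\<lambda>x. c * \<phi> x) = (\<lambda>x. c *\<^sub>R grad \<phi> x)"
  using dir_deriv_scaleR_const[OF assms, of c] by (simp add: grad_eq scaleR_sum_right)

lemma norm_l2_of_scaleR_vector:
  fixes \<phi> :: "'a::euclidean_space \<Rightarrow> real" and v :: "'b::euclidean_space"
  assumes "\<phi> \<in> test_fun U"
  shows "norm (l2_of (\<lambda>x. \<phi> x *\<^sub>R v)) = norm v * norm (l2_of \<phi>)"
proof -
  have t: "(\<lambda>x. \<phi> x *\<^sub>R v) \<in> test_fun U" by (intro test_fun_scaleR_left assms smooth_fun_const)
  have "(norm (l2_of (\<lambda>x. \<phi> x *\<^sub>R v)))\<^sup>2 = (norm v)\<^sup>2 * (norm (l2_of \<phi>))\<^sup>2"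
    by (simp add: norm_l2_of test_fun_L2[OF t] test_fun_L2[OF assms]
      power_mult_distrib mult.commute)
  then have "(norm (l2_of (\<lambda>x. \<phi> x *\<^sub>R v)))\<^sup>2 = (norm v * norm (l2_of \<phi>))\<^sup>2"
    by (simp add: power_mult_distrib)
  then show ?thesis by (simp add: power2_eq_iff_nonneg)
qed

lemma grad_dir_deriv_weak:
  fixes W :: "'a::euclidean_space \<Rightarrow> real"
  assumes "has_weak_grad_div \<Omega> \<tau> g" "W \<in> test_fun \<Omega>"
  shows "\<tau> \<bullet> l2_of (grad (dir_deriv W h)) = g \<bullet> l2_of (\<lambda>x. W x *\<^sub>R h)"
proof -
  have "(\<lambda>x. W x *\<^sub>R h) \<in> test_fun \<Omega>" by (intro test_fun_scaleR_left assms smooth_fun_const)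
  then have "\<tau> \<bullet> l2_of (grad (dvg (\<lambda>x. W x *\<^sub>R h))) = g \<bullet> l2_of (\<lambda>x. W x *\<^sub>R h)"
    using assms(1) by (simp add: has_weak_grad_div_def)
  then show ?thesis by (simp add: dvg_scaleR_vector test_fun_smooth[OF assms(2)])
qed

text \<open>Each averaging step changes \<open>\<phi>\<close> by a derivative along \<open>h\<close>, that is, by the divergence of a test
  field \<open>W h\<close>, on which \<open>\<tau>\<close> acts through \<open>g\<close>.\<close>

lemma steklov_diff_bound:
  fixes \<phi> :: "'a::euclidean_space \<Rightarrow> real"
  assumes wgd: "has_weak_grad_div \<Omega> \<tau> g"
  shows "smooth_fun \<phi> \<Longrightarrow> compact K \<Longrightarrow> (\<And>x. x \<notin> K \<Longrightarrow> \<phi> x = 0) \<Longrightarrow> sweep hs K \<subseteq> \<Omega> \<Longrightarrow>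
    \<bar>\<tau> \<bullet> l2_of (grad \<phi>) - \<tau> \<bullet> l2_of (grad (steklov hs \<phi>))\<bar> \<le> norm g * (\<Sum>h\<leftarrow>hs. norm h) * norm (l2_of \<phi>)"
proof (induction hs arbitrary: \<phi> K)
  case (Cons h hs)
  define K1 where "K1 = (\<lambda>(y, s). y + s *\<^sub>R h) ` (K \<times> {0..1::real})"
  define W where "W = avg_along (\<lambda>s. 1 - s) h \<phi>"
  define a where "a = avg_along (\<lambda>s. 1) h \<phi>"
  have cw: "continuous_on {0..1::real} (\<lambda>s. 1 - s)" by (intro continuous_intros)
  have K1: "compact K1" "sweep hs K1 \<subseteq> \<Omega>"
    using Cons.prems by (auto simp: K1_def compact_sweep_1)
  then have K1\<Omega>: "K1 \<subseteq> \<Omega>" using subset_sweep by blast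
  have t\<phi>: "\<phi> \<in> test_fun \<Omega>"
    using Cons.prems K1\<Omega> subset_sweep_1[of K h] by (intro test_funI[of _ K]) (auto simp: K1_def)
  have tW: "W \<in> test_fun \<Omega>"
    unfolding W_def using Cons.prems K1\<Omega> cw by (intro avg_along_test_fun) (auto simp: K1_def)
  have ta: "a \<in> test_fun \<Omega>"
    unfolding a_def using Cons.prems K1\<Omega> by (intro avg_along_test_fun) (auto simp: K1_def)
  have nW: "norm (l2_of W) \<le> norm (l2_of \<phi>)" unfolding W_def
    by (rule norm_l2_of_avg_along_le) (use cw tW t\<phi> in \<open>auto simp: W_def intro: test_fun_mono[of \<Omega>]\<close>)
  have na: "norm (l2_of a) \<le> norm (l2_of \<phi>)" unfolding a_def
    by (rule norm_l2_of_avg_along_le) (use ta t\<phi> in \<open>auto simp: a_def intro: test_fun_mono[of \<Omega>]\<close>)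
  have "dir_deriv W h = (\<lambda>x. \<phi> x - a x)"
    unfolding W_def a_def using dir_deriv_avg_along_1_minus[OF Cons.prems(1)] by auto
  then have "g \<bullet> l2_of (\<lambda>x. W x *\<^sub>R h) = \<tau> \<bullet> l2_of (\<lambda>x. grad \<phi> x - grad a x)"
    using grad_dir_deriv_weak[OF wgd tW, of h] by (simp add: grad_diff test_fun_smooth[OF t\<phi>] test_fun_smooth[OF ta])
  also have "\<dots> = \<tau> \<bullet> l2_of (grad \<phi>) - \<tau> \<bullet> l2_of (grad a)"
    by (simp add: l2_of_diff test_fun_L2[OF test_fun_grad[OF t\<phi>]]
        test_fun_L2[OF test_fun_grad[OF ta]] inner_diff_right)
  finally have "\<bar>\<tau> \<bullet> l2_of (grad \<phi>) - \<tau> \<bullet> l2_of (grad a)\<bar> \<le> norm g * norm (l2_of (\<lambda>x. W x *\<^sub>R h))"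
    using Cauchy_Schwarz_ineq2 by metis
  also have "\<dots> \<le> norm g * (norm h * norm (l2_of \<phi>))"
    unfolding norm_l2_of_scaleR_vector[OF tW] using nW by (intro mult_left_mono) auto
  finally have 1: "\<bar>\<tau> \<bullet> l2_of (grad \<phi>) - \<tau> \<bullet> l2_of (grad a)\<bar> \<le> norm g * (norm h * norm (l2_of \<phi>))" .
  have "\<bar>\<tau> \<bullet> l2_of (grad a) - \<tau> \<bullet> l2_of (grad (steklov hs a))\<bar> \<le> norm g * (\<Sum>h\<leftarrow>hs. norm h) * norm (l2_of a)"
    by (rule Cons.IH[of a K1])
      (use K1 test_fun_smooth[OF ta] Cons.prems(3) in \<open>auto simp: a_def K1_def intro: avg_along_zero_off\<close>)
  also have "\<dots> \<le> norm g * (\<Sum>h\<leftarrow>hs. norm h) * norm (l2_of \<phi>)"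
    using na by (intro mult_left_mono mult_nonneg_nonneg sum_list_nonneg) auto
  finally show ?case using 1 by (simp add: a_def[symmetric] algebra_simps)
qed simp

text \<open>Every direction in \<open>hs\<close> is -c e up to an error of length \<eta> c. Moving
  by fractions t_i in [0, 1] of these directions descends by s = c times the sum of the t_i, with
  total error at most \<eta> s.\<close>

lemma sweep_cone:
  fixes K :: "'a::real_normed_vector set"
  assumes "c \<ge> 0"
  shows "(\<And>h. h \<in> set hs \<Longrightarrow> norm (h + c *\<^sub>R e) \<le> \<eta> * c) \<Longrightarrow> z \<in> sweep hs K \<Longrightarrow>
    \<exists>y\<in>K. \<exists>s w. 0 \<le> s \<and> s \<le> c * length hs \<and> norm w \<le> \<eta> * s \<and> z = y - s *\<^sub>R e + w"
proof (induction hs arbitrary: K)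
  case Nil
  then show ?case by (intro bexI[of _ z] exI[of _ 0]) auto
next
  case (Cons h hs)
  obtain y1 s w where y1: "y1 \<in> (\<lambda>(y, s). y + s *\<^sub>R h) ` (K \<times> {0..1::real})"
    and s: "0 \<le> s" "s \<le> c * length hs" "norm w \<le> \<eta> * s" "z = y1 - s *\<^sub>R e + w"
    using Cons.IH[of "(\<lambda>(y, s). y + s *\<^sub>R h) ` (K \<times> {0..1::real})"] Cons.prems by auto
  from y1 obtain y t where y: "y \<in> K" "0 \<le> t" "t \<le> 1" "y1 = y + t *\<^sub>R h" by auto
  show ?case
  proof (intro bexI[of _ y] exI[of _ "s + t * c"] exI[of _ "w + t *\<^sub>R (h + c *\<^sub>R e)"] conjI)
    have "t * c \<le> c" using y assms by (simp add: mult_left_le_one_le)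
    then show "s + t * c \<le> c * length (h # hs)" using s(2) by (simp add: algebra_simps)
    have "norm (t *\<^sub>R (h + c *\<^sub>R e)) \<le> t * (\<eta> * c)"
      using y Cons.prems(1)[of h] by (simp add: mult_left_mono)
    then show "norm (w + t *\<^sub>R (h + c *\<^sub>R e)) \<le> \<eta> * (s + t * c)"
      using s(3) by (intro norm_triangle_le) (simp add: algebra_simps)
  qed (use s y assms in \<open>auto simp: algebra_simps\<close>)
qed

text \<open>The averaging directions have to point into \<Omega> and still span the whole space. The
  perturbations of -e by small basis vectors do both: they lie in the cone, and their differences
  are multiples of the basis vectors.\<close>

lemma local_div_bound:
  fixes \<Omega> :: "'a::euclidean_space set"
  assumes wgd: "has_weak_grad_div \<Omega> \<tau> g" and lip: "lipschitz_domain \<Omega>" and x: "x \<in> closure \<Omega>"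
  shows "\<exists>r>0. \<exists>C. \<forall>\<phi>\<in>test_fun \<Omega>. (\<forall>y. dist x y > r \<longrightarrow> \<phi> y = 0) \<longrightarrow>
    \<bar>\<tau> \<bullet> l2_of (grad \<phi>)\<bar> \<le> C * norm (l2_of \<phi>)"
proof -
  obtain r e \<eta> \<delta> where pos: "r > 0" "\<eta> > 0" "\<delta> > 0" and cone:
    "\<And>y s w. y \<in> \<Omega> \<Longrightarrow> dist x y \<le> r \<Longrightarrow> 0 \<le> s \<Longrightarrow> s \<le> \<delta> \<Longrightarrow> norm w \<le> \<eta> * s \<Longrightarrow> y - s *\<^sub>R e + w \<in> \<Omega>"
    using lip x by (rule lipschitz_domain_cone) blast
  obtain bs where bs: "set bs = (Basis :: 'a set)" using finite_list[OF finite_Basis] by blast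
  \<comment> \<open>One averaging direction for each basis vector and one along the axis; together
    they descend by \<delta>, the depth of the cone.\<close>
  define c where "c = \<delta> / Suc (length bs)"
  have c: "c > 0" using pos by (simp add: c_def)
  \<comment> \<open>The entry 0 contributes -c e, which subtracted from the other directions leaves
    c \<eta> i.\<close>
  define hs where "hs = map (\<lambda>i. (c * \<eta>) *\<^sub>R i - c *\<^sub>R e) (0 # bs)"
  have c_len: "c * length hs = \<delta>" by (simp add: c_def hs_def field_simps)
  have hs_set: "- (c *\<^sub>R e) \<in> set hs" "\<And>i. i \<in> Basis \<Longrightarrow> (c * \<eta>) *\<^sub>R i - c *\<^sub>R e \<in> set hs"
    by (auto simp: hs_def bs)
  have hs_norm: "norm (h + c *\<^sub>R e) \<le> \<eta> * c" if "h \<in> set hs" for h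
    using that c pos by (auto simp: hs_def bs abs_mult)
  define C where "C = norm g * (\<Sum>h\<leftarrow>hs. norm h) + norm \<tau> * (DIM('a) * (4 / (c * \<eta>)))"
  have "\<bar>\<tau> \<bullet> l2_of (grad \<phi>)\<bar> \<le> C * norm (l2_of \<phi>)"
    if \<phi>: "\<phi> \<in> test_fun \<Omega>" "\<forall>y. dist x y > r \<longrightarrow> \<phi> y = 0" for \<phi>
  proof -
    obtain K0 where K0: "smooth_fun \<phi>" "compact K0" "K0 \<subseteq> \<Omega>" "\<And>y. y \<notin> K0 \<Longrightarrow> \<phi> y = 0"
      using \<phi>(1) by (rule test_funE) blast
    define K where "K = K0 \<inter> cball x r"
    have K: "compact K" "\<And>y. y \<notin> K \<Longrightarrow> \<phi> y = 0"
      using K0 \<phi>(2) by (auto simp: K_def compact_Int_closed not_le)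
    have sw: "sweep hs K \<subseteq> \<Omega>"
    proof
      fix z assume "z \<in> sweep hs K"
      then obtain y s w where "y \<in> K" "0 \<le> s" "s \<le> \<delta>" "norm w \<le> \<eta> * s" "z = y - s *\<^sub>R e + w"
        using sweep_cone[of c hs e \<eta> z K] c hs_norm unfolding c_len by auto
      then show "z \<in> \<Omega>" using cone K0(3) by (auto simp: K_def)
    qed
    define \<psi> where "\<psi> = steklov hs \<phi>"
    have \<phi>U: "\<phi> \<in> test_fun UNIV" using \<phi>(1) test_fun_mono by blast
    have t\<psi>: "\<psi> \<in> test_fun \<Omega>" unfolding \<psi>_def using K0 K sw by (intro steklov_test_fun)
    have s\<psi>: "smooth_fun \<psi>" using t\<psi> by (rule test_fun_smooth)
    \<comment> \<open>The derivative along a basis vector is 1 / (c \<eta>) times a difference of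
      derivatives along two averaging directions, each of norm at most twice that of \<phi>; hence
      the 4.\<close>
    have d: "norm (l2_of (dir_deriv \<psi> i)) \<le> 4 / (c * \<eta>) * norm (l2_of \<phi>)" if i: "i \<in> Basis" for i
    proof -
      define h where "h = (c * \<eta>) *\<^sub>R i - c *\<^sub>R e"
      define k where "k = - (c *\<^sub>R e)"
      have "i = (1 / (c * \<eta>)) *\<^sub>R (h - k)" using c pos by (simp add: h_def k_def)
      then have eq: "dir_deriv \<psi> i = (\<lambda>x. (1 / (c * \<eta>)) *\<^sub>R (dir_deriv \<psi> h x - dir_deriv \<psi> k x))"
        by (simp add: dir_deriv_grad[OF s\<psi>, abs_def] inner_diff_left fun_eq_iff)
      have si: "square_integrable (\<lambda>x. dir_deriv \<psi> h x - dir_deriv \<psi> k x)"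
        by (intro square_integrable_diff test_fun_L2[OF test_fun_dir_deriv[OF t\<psi>]])
      have "l2_of (dir_deriv \<psi> i) = (1 / (c * \<eta>)) *\<^sub>R (l2_of (dir_deriv \<psi> h) - l2_of (dir_deriv \<psi> k))"
        unfolding eq l2_of_scaleR[OF si]
        by (simp only: l2_of_diff test_fun_L2[OF test_fun_dir_deriv[OF t\<psi>]])
      then have "norm (l2_of (dir_deriv \<psi> i)) = 1 / (c * \<eta>) * norm (l2_of (dir_deriv \<psi> h) - l2_of (dir_deriv \<psi> k))"
        using c pos by simp
      also have "\<dots> \<le> 1 / (c * \<eta>) * (2 * norm (l2_of \<phi>) + 2 * norm (l2_of \<phi>))"
      proof (intro mult_left_mono order_trans[OF norm_triangle_ineq4] add_mono)
        show "norm (l2_of (dir_deriv \<psi> h)) \<le> 2 * norm (l2_of \<phi>)"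
          unfolding \<psi>_def using norm_dir_deriv_steklov_le[OF \<phi>U] hs_set(2)[OF i] by (simp add: h_def)
        show "norm (l2_of (dir_deriv \<psi> k)) \<le> 2 * norm (l2_of \<phi>)"
          unfolding \<psi>_def using norm_dir_deriv_steklov_le[OF \<phi>U] hs_set(1) by (simp add: k_def)
      qed (use c pos in auto)
      finally show ?thesis by simp
    qed
    have gi: "(\<lambda>x. dir_deriv \<psi> i x *\<^sub>R i) \<in> test_fun \<Omega>" for i
      by (intro test_fun_scaleR_left test_fun_dir_deriv t\<psi> smooth_fun_const)
    have "norm (l2_of (grad \<psi>)) \<le> (\<Sum>i\<in>Basis. norm (l2_of (\<lambda>x. dir_deriv \<psi> i x *\<^sub>R i)))"
      unfolding grad_eq by (subst l2_of_sum) (auto intro: norm_sum test_fun_L2[OF gi])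
    also have "\<dots> \<le> (\<Sum>i\<in>(Basis::'a set). 4 / (c * \<eta>) * norm (l2_of \<phi>))"
      using d by (intro sum_mono) (simp add: norm_l2_of_scaleR_vector[OF test_fun_dir_deriv[OF t\<psi>]])
    finally have "norm (l2_of (grad \<psi>)) \<le> DIM('a) * (4 / (c * \<eta>)) * norm (l2_of \<phi>)" by simp
    then have "norm \<tau> * norm (l2_of (grad \<psi>)) \<le> norm \<tau> * (DIM('a) * (4 / (c * \<eta>)) * norm (l2_of \<phi>))"
      by (rule mult_left_mono) simp
    with Cauchy_Schwarz_ineq2[of \<tau> "l2_of (grad \<psi>)"]
    have "\<bar>\<tau> \<bullet> l2_of (grad \<psi>)\<bar> \<le> norm \<tau> * (DIM('a) * (4 / (c * \<eta>)) * norm (l2_of \<phi>))" by linarith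
    moreover have "\<bar>\<tau> \<bullet> l2_of (grad \<phi>) - \<tau> \<bullet> l2_of (grad \<psi>)\<bar> \<le> norm g * (\<Sum>h\<leftarrow>hs. norm h) * norm (l2_of \<phi>)"
      unfolding \<psi>_def by (rule steklov_diff_bound[OF wgd K0(1) K sw])
    ultimately show ?thesis by (simp add: C_def algebra_simps)
  qed
  then show ?thesis using pos(1) by blast
qed

text \<open>The bound involves only the L2 norm of \<phi>, which a cutoff with values in [0, 1] does
  not increase. Local bounds can thus be glued along a finite cover, one ball at a time, and no
  derivative of a cutoff appears.\<close>

lemma global_div_bound:
  fixes \<Omega> :: "'a::euclidean_space set"
  assumes wgd: "has_weak_grad_div \<Omega> \<tau> g" and lip: "lipschitz_domain \<Omega>" and bdd: "bounded \<Omega>"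
  shows "\<exists>C. \<forall>\<phi>\<in>test_fun \<Omega>. \<bar>\<tau> \<bullet> l2_of (grad \<phi>)\<bar> \<le> C * norm (l2_of \<phi>)"
proof -
  have "\<forall>x\<in>closure \<Omega>. \<exists>r>0. \<exists>C. \<forall>\<phi>\<in>test_fun \<Omega>. (\<forall>y. dist x y > r \<longrightarrow> \<phi> y = 0) \<longrightarrow>
    \<bar>\<tau> \<bullet> l2_of (grad \<phi>)\<bar> \<le> C * norm (l2_of \<phi>)"
    using local_div_bound[OF wgd lip] by blast
  then obtain r C where r: "\<And>x. x \<in> closure \<Omega> \<Longrightarrow> r x > 0"
    and C: "\<And>x \<phi>. x \<in> closure \<Omega> \<Longrightarrow> \<phi> \<in> test_fun \<Omega> \<Longrightarrow> (\<And>y. dist x y > r x \<Longrightarrow> \<phi> y = 0) \<Longrightarrow>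
      \<bar>\<tau> \<bullet> l2_of (grad \<phi>)\<bar> \<le> C x * norm (l2_of \<phi>)"
    by metis
  have "compact (closure \<Omega>)" using bdd by simp
  \<comment> \<open>The half balls have to cover, because the cutoff is 1 only there: the rest of
    \<phi> then vanishes on the half ball, and the part cut out lives in the full ball.\<close>
  then obtain A where A: "A \<subseteq> closure \<Omega>" "finite A" "closure \<Omega> \<subseteq> (\<Union>x\<in>A. ball x (r x / 2))"
    by (rule compactE_image[of "closure \<Omega>" "closure \<Omega>" "\<lambda>x. ball x (r x / 2)"]) (use r in auto)
  have "\<exists>C. \<forall>\<phi>\<in>test_fun \<Omega>. (\<forall>y. y \<notin> (\<Union>x\<in>A. ball x (r x / 2)) \<longrightarrow> \<phi> y = 0) \<longrightarrow>
      \<bar>\<tau> \<bullet> l2_of (grad \<phi>)\<bar> \<le> C * norm (l2_of \<phi>)"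
    using A(2,1)
  proof (induction A rule: finite_induct)
    case empty
    have "\<tau> \<bullet> l2_of (grad \<phi>) = 0" if "\<forall>y. \<phi> y = 0" for \<phi> :: "'a \<Rightarrow> real"
    proof -
      have "\<phi> = (\<lambda>x. 0)" using that by auto
      moreover have "dir_deriv (\<lambda>x::'a. 0::real) i x = 0" for i x by (rule dir_deriv_eqI) simp
      ultimately have "grad \<phi> = (\<lambda>x. 0)" by (simp add: grad_eq)
      then show ?thesis by (simp add: l2_of_zero)
    qed
    then show ?case by (intro exI[of _ 0]) auto
  next
    case (insert x A)
    then obtain D where D: "\<And>\<phi>. \<phi> \<in> test_fun \<Omega> \<Longrightarrow> (\<forall>y. y \<notin> (\<Union>x\<in>A. ball x (r x / 2)) \<longrightarrow> \<phi> y = 0) \<Longrightarrow>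
      \<bar>\<tau> \<bullet> l2_of (grad \<phi>)\<bar> \<le> D * norm (l2_of \<phi>)" by auto
    have x: "x \<in> closure \<Omega>" using insert by simp
    obtain \<rho> :: "'a \<Rightarrow> real" where \<rho>: "smooth_fun \<rho>" "\<And>y. 0 \<le> \<rho> y" "\<And>y. \<rho> y \<le> 1"
        "\<And>y. dist x y \<le> r x / 2 \<Longrightarrow> \<rho> y = 1" "\<And>y. dist x y \<ge> r x \<Longrightarrow> \<rho> y = 0"
      using smooth_cutoff[OF r[OF x], of x] by blast
    show ?case
    proof (intro exI[of _ "\<bar>C x\<bar> + \<bar>D\<bar>"] ballI impI)
      fix \<phi> :: "'a \<Rightarrow> real"
      assume \<phi>: "\<phi> \<in> test_fun \<Omega>" "\<forall>y. y \<notin> (\<Union>x\<in>insert x A. ball x (r x / 2)) \<longrightarrow> \<phi> y = 0"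
      define \<phi>1 where "\<phi>1 y = \<rho> y * \<phi> y" for y
      define \<phi>2 where "\<phi>2 y = (1 - \<rho> y) * \<phi> y" for y
      have t1: "\<phi>1 \<in> test_fun \<Omega>"
        using test_fun_scaleR_right[OF \<rho>(1) \<phi>(1)] by (simp add: \<phi>1_def[abs_def])
      have t2: "\<phi>2 \<in> test_fun \<Omega>"
        using test_fun_scaleR_right[OF smooth_fun_diff[OF smooth_fun_const[of 1] \<rho>(1)] \<phi>(1)]
        by (simp add: \<phi>2_def[abs_def])
      have \<phi>12: "\<phi> = (\<lambda>y. \<phi>1 y + \<phi>2 y)" by (auto simp: \<phi>1_def \<phi>2_def algebra_simps)
      have n1: "norm (l2_of \<phi>1) \<le> norm (l2_of \<phi>)"
        by (rule norm_l2_of_le) (use t1 \<phi> \<rho> in \<open>auto simp: \<phi>1_def abs_mult mult_left_le_one_le intro: test_fun_L2\<close>)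
      have n2: "norm (l2_of \<phi>2) \<le> norm (l2_of \<phi>)"
        by (rule norm_l2_of_le) (use t2 \<phi> \<rho> in \<open>auto simp: \<phi>2_def abs_mult mult_left_le_one_le intro: test_fun_L2\<close>)
      have "\<tau> \<bullet> l2_of (grad \<phi>) = \<tau> \<bullet> l2_of (grad \<phi>1) + \<tau> \<bullet> l2_of (grad \<phi>2)"
        unfolding \<phi>12 grad_add[OF test_fun_smooth[OF t1] test_fun_smooth[OF t2]]
        by (simp add: l2_of_add test_fun_L2[OF test_fun_grad[OF t1]]
            test_fun_L2[OF test_fun_grad[OF t2]] inner_add_right)
      moreover have "\<bar>\<tau> \<bullet> l2_of (grad \<phi>1)\<bar> \<le> C x * norm (l2_of \<phi>1)"
        by (rule C[OF x t1]) (simp add: \<phi>1_def \<rho>)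
      moreover have "C x * norm (l2_of \<phi>1) \<le> \<bar>C x\<bar> * norm (l2_of \<phi>)"
        using n1 by (intro mult_mono) auto
      moreover have "\<bar>\<tau> \<bullet> l2_of (grad \<phi>2)\<bar> \<le> D * norm (l2_of \<phi>2)"
      proof (rule D[OF t2], intro allI impI)
        fix y assume "y \<notin> (\<Union>x\<in>A. ball x (r x / 2))"
        then show "\<phi>2 y = 0" using \<phi>(2) \<rho>(4)[of y] by (cases "dist x y < r x / 2") (auto simp: \<phi>2_def)
      qed
      moreover have "D * norm (l2_of \<phi>2) \<le> \<bar>D\<bar> * norm (l2_of \<phi>)"
        using n2 by (intro mult_mono) auto
      ultimately show "\<bar>\<tau> \<bullet> l2_of (grad \<phi>)\<bar> \<le> (\<bar>C x\<bar> + \<bar>D\<bar>) * norm (l2_of \<phi>)"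
        by (simp add: algebra_simps)
    qed
  qed
  moreover have "\<phi> y = 0" if "\<phi> \<in> test_fun \<Omega>" "y \<notin> (\<Union>x\<in>A. ball x (r x / 2))" for \<phi> :: "'a \<Rightarrow> real" and y
    using test_fun_zero_off[OF that(1), of y] that(2) A(3) closure_subset[of \<Omega>] by blast
  ultimately show ?thesis by meson
qed

text \<open>The functional \<phi> \<mapsto> -(\<tau>, \<nabla>\<phi>) is L2-bounded, so its Riesz
  representative is div \<tau>. Testing it with divergences of test fields identifies its gradient
  as \<nabla>div \<tau>.\<close>

lemma div_of_Hgd:
  fixes \<Omega> :: "'a::euclidean_space set"
  assumes lip: "lipschitz_domain \<Omega>" and bdd: "bounded \<Omega>" and \<tau>: "\<tau> \<in> Hgd \<Omega>"
  obtains p where "p \<in> L2 \<Omega>" "has_weak_div \<Omega> \<tau> p" "has_weak_grad \<Omega> p (wgrad_div \<Omega> \<tau>)"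
proof -
  have op: "open \<Omega>" using lip by (simp add: lipschitz_domain_def)
  have wgd: "has_weak_grad_div \<Omega> \<tau> (wgrad_div \<Omega> \<tau>)" using HgdD[OF op \<tau>] by blast
  obtain C where C: "\<And>\<phi>. \<phi> \<in> test_fun \<Omega> \<Longrightarrow> \<bar>\<tau> \<bullet> l2_of (grad \<phi>)\<bar> \<le> C * norm (l2_of \<phi>)"
    using global_div_bound[OF wgd lip bdd] by blast
  define G where "G = (\<lambda>\<phi> :: 'a \<Rightarrow> real. (l2_of \<phi>, - (\<tau> \<bullet> l2_of (grad \<phi>)))) ` test_fun \<Omega>"
  have "subspace G"
    unfolding subspace_def
  proof (intro conjI ballI allI)
    have "grad (\<lambda>x::'a. 0) = (\<lambda>x. 0)"
      using grad_cmult[OF smooth_fun_const, of 0 "0 :: real"] by simp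
    then show "0 \<in> G"
      unfolding G_def by (intro image_eqI[OF _ test_fun_zero]) (simp add: l2_of_zero zero_prod_def)
  next
    fix a b assume "a \<in> G" "b \<in> G"
    then obtain \<phi> \<psi> where *: "\<phi> \<in> test_fun \<Omega>" "a = (l2_of \<phi>, - (\<tau> \<bullet> l2_of (grad \<phi>)))"
      "\<psi> \<in> test_fun \<Omega>" "b = (l2_of \<psi>, - (\<tau> \<bullet> l2_of (grad \<psi>)))" by (auto simp: G_def)
    then show "a + b \<in> G"
      unfolding G_def
      by (intro image_eqI[OF _ test_fun_add[OF *(1,3)]])
        (simp add: grad_add test_fun_smooth[OF *(1)] test_fun_smooth[OF *(3)] l2_of_add
          test_fun_L2[OF test_fun_grad[OF *(1)]] test_fun_L2[OF *(1)]
          test_fun_L2[OF test_fun_grad[OF *(3)]] test_fun_L2[OF *(3)] inner_add_right)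
  next
    fix c a assume "a \<in> G"
    then obtain \<phi> where *: "\<phi> \<in> test_fun \<Omega>" "a = (l2_of \<phi>, - (\<tau> \<bullet> l2_of (grad \<phi>)))" by (auto simp: G_def)
    then show "c *\<^sub>R a \<in> G"
      unfolding G_def
      using l2_of_scaleR[OF test_fun_L2[OF *(1)], of c]
      by (intro image_eqI[OF _ test_fun_scaleR_right[OF smooth_fun_const[of c] *(1)]])
        (simp add: grad_cmult test_fun_smooth[OF *(1)] l2_of_scaleR test_fun_L2[OF test_fun_grad[OF *(1)]])
  qed
  then obtain p0 where p0: "\<And>x t. (x, t) \<in> G \<Longrightarrow> t = p0 \<bullet> x"
    by (rule bounded_functional_graph_representable[of G C]) (use C in \<open>auto simp: G_def\<close>)
  \<comment> \<open>The representative may be nonzero off \<Omega>, where test functions do not see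
    it.\<close>
  define p where "p = l2_restrict \<Omega> p0"
  have p: "- (\<tau> \<bullet> l2_of (grad \<phi>)) = p \<bullet> l2_of \<phi>" if "\<phi> \<in> test_fun \<Omega>" for \<phi>
    using p0[of "l2_of \<phi>" "- (\<tau> \<bullet> l2_of (grad \<phi>))"] that inner_l2_restrict_test_fun[OF op that, of p0]
    by (auto simp: G_def p_def)
  show thesis
  proof (rule that[of p])
    show "p \<in> L2 \<Omega>" unfolding p_def using op by (intro l2_restrict_in_L2) simp
    show "has_weak_div \<Omega> \<tau> p" unfolding has_weak_div_def using p by (metis minus_equation_iff)
    show "has_weak_grad \<Omega> p (wgrad_div \<Omega> \<tau>)"
      using wgd p[OF test_fun_dvg] by (auto simp: has_weak_grad_def has_weak_grad_div_def)
  qed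
qed

text \<open>The two boundary conditions act in turn. With p = div \<tau> in H1 and q = div u, the
  zero normal trace of u gives (u, \<nabla>p) = -(q, p), and the approximation of q by test
  functions gives (p, q) = -(\<tau>, \<nabla>q).\<close>

lemma grad_div_symmetric:
  fixes \<Omega> :: "'a::euclidean_space set"
  assumes lip: "lipschitz_domain \<Omega>" and bdd: "bounded \<Omega>" and u: "u \<in> Hgd_0 \<Omega>" and \<tau>: "\<tau> \<in> Hgd \<Omega>"
  shows "u \<bullet> wgrad_div \<Omega> \<tau> = wgrad_div \<Omega> u \<bullet> \<tau>"
proof -
  have op: "open \<Omega>" using lip by (simp add: lipschitz_domain_def)
  obtain p where p: "p \<in> L2 \<Omega>" "has_weak_div \<Omega> \<tau> p" "has_weak_grad \<Omega> p (wgrad_div \<Omega> \<tau>)"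
    using lip bdd \<tau> by (rule div_of_Hgd)
  have A\<tau>: "wgrad_div \<Omega> \<tau> \<in> L2 \<Omega>" using HgdD[OF op \<tau>] by blast
  have wp: "wgrad \<Omega> p = wgrad_div \<Omega> \<tau>" using wgrad_eqI[OF op A\<tau> p(3)] .
  have "p \<in> H1 \<Omega>" using p A\<tau> by (auto simp: H1_def)
  define q where "q = wdiv \<Omega> u"
  have q: "has_weak_div \<Omega> u q" "q \<in> H1_0 \<Omega>" using u HdivD[OF op, of u] by (auto simp: q_def Hgd_0_def)
  then have qH: "q \<in> H1 \<Omega>" by (simp add: H1_0_def)
  note qD = H1D[OF op qH]
  have "has_weak_grad_div \<Omega> u (wgrad \<Omega> q)"
    using q(1) qD(3) test_fun_dvg by (fastforce simp: has_weak_grad_div_def has_weak_grad_def has_weak_div_def)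
  then have Au: "wgrad_div \<Omega> u = wgrad \<Omega> q" by (intro wgrad_div_eqI op qD)
  have tr: "u \<bullet> wgrad_div \<Omega> \<tau> + q \<bullet> p = 0"
    using u \<open>p \<in> H1 \<Omega>\<close> by (auto simp: Hgd_0_def normal_trace_def wp q_def)
  \<comment> \<open>The same expression vanishes for a test function in place of q, so only the
    approximation error is left.\<close>
  have "\<bar>p \<bullet> q + \<tau> \<bullet> wgrad \<Omega> q\<bar> \<le> (norm p + norm \<tau>) * \<epsilon>" if "\<epsilon> > 0" for \<epsilon>
  proof -
    obtain \<phi> where \<phi>: "\<phi> \<in> test_fun \<Omega>"
      "(norm (q - l2_of \<phi>))\<^sup>2 + (norm (wgrad \<Omega> q - l2_of (grad \<phi>)))\<^sup>2 < \<epsilon>\<^sup>2"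
      using q(2) \<open>\<epsilon> > 0\<close> by (auto simp: H1_0_def)
    have "(norm (q - l2_of \<phi>))\<^sup>2 \<le> \<epsilon>\<^sup>2" "(norm (wgrad \<Omega> q - l2_of (grad \<phi>)))\<^sup>2 \<le> \<epsilon>\<^sup>2"
      using \<phi>(2) zero_le_power2[of "norm (q - l2_of \<phi>)"]
        zero_le_power2[of "norm (wgrad \<Omega> q - l2_of (grad \<phi>))"] by linarith+
    then have n: "norm (q - l2_of \<phi>) \<le> \<epsilon>" "norm (wgrad \<Omega> q - l2_of (grad \<phi>)) \<le> \<epsilon>"
      using power2_le_imp_le \<open>\<epsilon> > 0\<close> less_imp_le by blast+
    have "p \<bullet> q + \<tau> \<bullet> wgrad \<Omega> q = p \<bullet> (q - l2_of \<phi>) + \<tau> \<bullet> (wgrad \<Omega> q - l2_of (grad \<phi>))"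
      using p(2) \<phi>(1) by (simp add: has_weak_div_def inner_diff_right)
    also have "\<bar>\<dots>\<bar> \<le> norm p * norm (q - l2_of \<phi>) + norm \<tau> * norm (wgrad \<Omega> q - l2_of (grad \<phi>))"
      using Cauchy_Schwarz_ineq2[of p "q - l2_of \<phi>"] Cauchy_Schwarz_ineq2[of \<tau> "wgrad \<Omega> q - l2_of (grad \<phi>)"]
      by linarith
    also have "\<dots> \<le> norm p * \<epsilon> + norm \<tau> * \<epsilon>" using n by (intro add_mono mult_left_mono) auto
    finally show ?thesis by (simp add: algebra_simps)
  qed
  then have "\<bar>p \<bullet> q + \<tau> \<bullet> wgrad \<Omega> q\<bar> \<le> 0"
  proof (rule_tac field_le_epsilon)
    fix e :: real assume "e > 0"
    define \<epsilon> where "\<epsilon> = e / (norm p + norm \<tau> + 1)"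
    have "norm p + norm \<tau> + 1 > 0" by (intro add_nonneg_pos) auto
    then have "\<epsilon> > 0" "(norm p + norm \<tau>) * \<epsilon> \<le> e" using \<open>e > 0\<close> by (auto simp: \<epsilon>_def field_simps)
    then show "\<bar>p \<bullet> q + \<tau> \<bullet> wgrad \<Omega> q\<bar> \<le> 0 + e"
      using \<open>\<And>\<epsilon>. 0 < \<epsilon> \<Longrightarrow> \<bar>p \<bullet> q + \<tau> \<bullet> wgrad \<Omega> q\<bar> \<le> (norm p + norm \<tau>) * \<epsilon>\<close>[of \<epsilon>] by linarith
  qed
  then show ?thesis using tr by (simp add: Au inner_commute)
qed

section \<open>Integration by parts\<close>

lemma inner_l2_of_translation:
  fixes F G :: "'a::euclidean_space \<Rightarrow> real"
  assumes "F \<in> test_fun UNIV" "G \<in> test_fun UNIV"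
  shows "l2_of (\<lambda>x. F (x - k)) \<bullet> l2_of G = l2_of F \<bullet> l2_of (\<lambda>x. G (x + k))"
proof -
  have t: "(\<lambda>x. F (x - k)) \<in> test_fun UNIV" "(\<lambda>x. G (x + k)) \<in> test_fun UNIV"
    using test_fun_translation[OF assms(1), of k] test_fun_translation[OF assms(2), of "- k"] by auto
  have [measurable]: "F \<in> borel_measurable borel" "G \<in> borel_measurable borel"
    using test_fun_L2 assms by (auto simp: square_integrable_def)
  have "l2_of F \<bullet> l2_of (\<lambda>x. G (x + k)) = (\<integral>x. F x * G (x + k) \<partial>distr lborel borel ((+) (- k)))"
    by (simp add: lborel_distr_plus inner_l2_of test_fun_L2[OF assms(1)] test_fun_L2[OF t(2)])
  also have "\<dots> = (\<integral>x. F (- k + x) * G (- k + x + k) \<partial>lborel)"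
    by (rule integral_distr) auto
  also have "\<dots> = l2_of (\<lambda>x. F (x - k)) \<bullet> l2_of G"
    by (simp add: inner_l2_of test_fun_L2[OF assms(2)] test_fun_L2[OF t(1)])
  finally show ?thesis by simp
qed

text \<open>With \<open>h\<close> replaced by \<open>t h\<close>, the difference is an average of the derivative \<open>D\<close> along \<open>t h\<close>, and
  \<open>D\<close> minus its average is itself a weighted average of a second derivative.\<close>

lemma norm_difference_minus_dir_deriv_le:
  fixes F :: "'a::euclidean_space \<Rightarrow> real"
  assumes F: "F \<in> test_fun UNIV"
  shows "norm (l2_of F - l2_of (\<lambda>x. F (x - t *\<^sub>R h)) - t *\<^sub>R l2_of (dir_deriv F h))
    \<le> t\<^sup>2 * norm (l2_of (dir_deriv (dir_deriv F h) h))"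
proof -
  define k where "k = t *\<^sub>R h"
  define D where "D = dir_deriv F k"
  have sF: "smooth_fun F" using F by (rule test_fun_smooth)
  have tD: "D \<in> test_fun UNIV" unfolding D_def using F by (rule test_fun_dir_deriv)
  have sD: "smooth_fun D" using tD by (rule test_fun_smooth)
  have Dk: "D = (\<lambda>x. t *\<^sub>R dir_deriv F h x)"
    by (simp add: D_def k_def dir_deriv_grad[OF sF, abs_def])
  have DDk: "dir_deriv D k = (\<lambda>x. (t * t) *\<^sub>R dir_deriv (dir_deriv F h) h x)"
    unfolding Dk dir_deriv_scaleR_const[OF smooth_fun_dir_deriv[OF sF]]
    by (simp add: k_def dir_deriv_grad[OF smooth_fun_dir_deriv[OF sF], abs_def] mult.assoc)
  have c: "continuous_on {0..1::real} (\<lambda>s. 1 - s)" by (intro continuous_intros)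
  have si: "square_integrable F" "square_integrable (\<lambda>x. F (x - k))" "square_integrable (dir_deriv F h)"
    "square_integrable D" "square_integrable (dir_deriv (dir_deriv F h) h)"
    by (rule test_fun_L2[OF F] test_fun_L2[OF test_fun_translation[OF F]]
      test_fun_L2[OF tD] test_fun_L2[OF test_fun_dir_deriv[OF F]]
      test_fun_L2[OF test_fun_dir_deriv[OF test_fun_dir_deriv[OF F]]])+
  have "avg_along (\<lambda>s. 1 - s) k (dir_deriv D k) = (\<lambda>x. D x - (F x - F (x - k)))"
  proof
    fix x
    have "F x - F (x - k) = avg_along (\<lambda>s. 1) k D x"
      unfolding D_def using dir_deriv_avg_along_1[OF sF, of k x] dir_deriv_avg_along[OF _ sF, of "\<lambda>s. 1" k k] by simp
    then show "avg_along (\<lambda>s. 1 - s) k (dir_deriv D k) x = D x - (F x - F (x - k))"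
      using dir_deriv_avg_along_1_minus[OF sD, of k x] dir_deriv_avg_along[OF c sD, of k k] by simp
  qed
  moreover have "norm (l2_of (avg_along (\<lambda>s. 1 - s) k (dir_deriv D k))) \<le> norm (l2_of (dir_deriv D k))"
    by (rule norm_l2_of_avg_along_le[OF c])
      (auto intro: test_fun_dir_deriv tD avg_along_test_fun_UNIV c)
  ultimately have "norm (l2_of D - (l2_of F - l2_of (\<lambda>x. F (x - k)))) \<le> norm (l2_of (dir_deriv D k))"
    using si by (simp add: l2_of_diff square_integrable_diff)
  also have "\<dots> = t\<^sup>2 * norm (l2_of (dir_deriv (dir_deriv F h) h))"
    unfolding DDk l2_of_scaleR[OF si(5)] by (simp add: power2_eq_square)
  also have "l2_of D = t *\<^sub>R l2_of (dir_deriv F h)" unfolding Dk by (rule l2_of_scaleR[OF si(3)])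
  finally show ?thesis by (simp add: k_def norm_minus_commute)
qed

text \<open>Summation by parts for differences: moving a translation from F to G is exact, and
  replacing differences by derivatives costs O(t^2) in L2. After division by t the error tends to
  0.\<close>

lemma dir_deriv_by_parts:
  fixes F G :: "'a::euclidean_space \<Rightarrow> real"
  assumes F: "F \<in> test_fun UNIV" and G: "G \<in> test_fun UNIV"
  shows "l2_of (dir_deriv F h) \<bullet> l2_of G = - (l2_of F \<bullet> l2_of (dir_deriv G h))"
proof -
  define s where "s = l2_of (dir_deriv F h) \<bullet> l2_of G + l2_of F \<bullet> l2_of (dir_deriv G h)"
  define C where "C = norm (l2_of (dir_deriv (dir_deriv F h) h)) * norm (l2_of G)
    + norm (l2_of F) * norm (l2_of (dir_deriv (dir_deriv G h) h))"
  have C: "C \<ge> 0" by (simp add: C_def)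
  have "\<bar>s\<bar> \<le> t * C" if "t > 0" for t
  proof -
    define a where "a = l2_of F - l2_of (\<lambda>x. F (x - t *\<^sub>R h)) - t *\<^sub>R l2_of (dir_deriv F h)"
    \<comment> \<open>The step is -t, because the shift changes sign when it moves to the other
      factor.\<close>
    define b where "b = l2_of G - l2_of (\<lambda>x. G (x - (- t) *\<^sub>R h)) - (- t) *\<^sub>R l2_of (dir_deriv G h)"
    have "\<bar>a \<bullet> l2_of G\<bar> \<le> t\<^sup>2 * norm (l2_of (dir_deriv (dir_deriv F h) h)) * norm (l2_of G)"
      using norm_difference_minus_dir_deriv_le[OF F, of t h]
      by (intro order_trans[OF Cauchy_Schwarz_ineq2] mult_right_mono) (auto simp: a_def)
    moreover have "\<bar>l2_of F \<bullet> b\<bar> \<le> norm (l2_of F) * (t\<^sup>2 * norm (l2_of (dir_deriv (dir_deriv G h) h)))"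
      using norm_difference_minus_dir_deriv_le[OF G, of "- t" h]
      by (intro order_trans[OF Cauchy_Schwarz_ineq2] mult_left_mono) (auto simp: b_def)
    moreover have "a \<bullet> l2_of G - l2_of F \<bullet> b = - (t * s)"
      using inner_l2_of_translation[OF F G, of "t *\<^sub>R h"]
      by (simp add: a_def b_def s_def inner_simps algebra_simps)
    ultimately have "\<bar>t * s\<bar> \<le> t * (t * C)"
      by (simp add: C_def power2_eq_square algebra_simps)
    then show ?thesis using that by (simp add: abs_mult)
  qed
  then have "\<bar>s\<bar> \<le> 0 + e" if "e > 0" for e
  proof -
    have "e / (C + 1) * C \<le> e" using that C by (simp add: field_simps)
    moreover have "\<bar>s\<bar> \<le> e / (C + 1) * C" using that C by (intro \<open>\<And>t. t > 0 \<Longrightarrow> \<bar>s\<bar> \<le> t * C\<close>) simp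
    ultimately show ?thesis by simp
  qed
  then have "\<bar>s\<bar> \<le> 0" by (rule field_le_epsilon)
  then show ?thesis by (simp add: s_def)
qed

lemma test_fun_inner_basis:
  assumes "\<psi> \<in> test_fun U"
  shows "(\<lambda>x. \<psi> x \<bullet> i) \<in> test_fun U"
  by (rule test_fun_bounded_linear[OF bounded_linear_inner_left assms])

lemma dir_deriv_inner: "smooth_fun \<psi> \<Longrightarrow> dir_deriv (\<lambda>x. \<psi> x \<bullet> i) h = (\<lambda>x. dir_deriv \<psi> h x \<bullet> i)"
  by (rule ext, rule dir_deriv_eqI[where D="\<lambda>h. dir_deriv \<psi> h x \<bullet> i" for x])
    (intro bounded_linear.has_derivative[OF bounded_linear_inner_left] smooth_fun_has_derivative)

lemma grad_dvg_by_parts: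
  fixes p :: "'a::euclidean_space \<Rightarrow> real"
  assumes p: "p \<in> test_fun UNIV" and \<psi>: "\<psi> \<in> test_fun UNIV"
  shows "l2_of (grad p) \<bullet> l2_of \<psi> = - (l2_of p \<bullet> l2_of (dvg \<psi>))"
proof -
  note si = test_fun_L2
  have *: "integrable lborel (\<lambda>x. F x * G x)" if "F \<in> test_fun UNIV" "G \<in> test_fun UNIV" for F G :: "'a \<Rightarrow> real"
    using square_integrable_inner[OF si[OF that(1)] si[OF that(2)]] by simp
  have "l2_of (grad p) \<bullet> l2_of \<psi> = (\<integral>x. (\<Sum>i\<in>Basis. dir_deriv p i x * (\<psi> x \<bullet> i)) \<partial>lborel)"
    unfolding inner_l2_of[OF si[OF test_fun_grad[OF p]] si[OF \<psi>]]
    by (simp add: grad_eq inner_sum_right inner_commute[of _ "\<psi> _"])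
  also have "\<dots> = (\<Sum>i\<in>Basis. \<integral>x. dir_deriv p i x * (\<psi> x \<bullet> i) \<partial>lborel)"
    by (intro Bochner_Integration.integral_sum * test_fun_dir_deriv test_fun_inner_basis p \<psi>)
  also have "\<dots> = (\<Sum>i\<in>Basis. - (\<integral>x. p x * (dir_deriv \<psi> i x \<bullet> i) \<partial>lborel))"
  proof (rule sum.cong)
    fix i :: 'a
    show "(\<integral>x. dir_deriv p i x * (\<psi> x \<bullet> i) \<partial>lborel) = - (\<integral>x. p x * (dir_deriv \<psi> i x \<bullet> i) \<partial>lborel)"
      using dir_deriv_by_parts[OF p test_fun_inner_basis[OF \<psi>, of i], of i]
      unfolding inner_l2_of[OF si[OF test_fun_dir_deriv[OF p]] si[OF test_fun_inner_basis[OF \<psi>]]]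
        dir_deriv_inner[OF test_fun_smooth[OF \<psi>]]
        inner_l2_of[OF si[OF p] si[OF test_fun_dir_deriv[OF test_fun_inner_basis[OF \<psi>]]],
          unfolded dir_deriv_inner[OF test_fun_smooth[OF \<psi>]]]
      by simp
  qed simp
  also have "\<dots> = - (\<integral>x. (\<Sum>i\<in>Basis. p x * (dir_deriv \<psi> i x \<bullet> i)) \<partial>lborel)"
    unfolding sum_negf
    by (intro arg_cong[of _ _ uminus] Bochner_Integration.integral_sum[symmetric] * test_fun_dir_deriv test_fun_inner_basis p \<psi>)
  also have "\<dots> = - (l2_of p \<bullet> l2_of (dvg \<psi>))"
    unfolding inner_l2_of[OF si[OF p] si[OF test_fun_dvg[OF \<psi>]]] by (simp add: dvg_eq sum_distrib_left)
  finally show ?thesis .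
qed

text \<open>\<phi> need not vanish on the boundary of T, but the test fields on T do. Extended by
  zero, both are test functions on the whole space, where two integrations by parts leave no
  boundary term.\<close>

lemma test_fun_grad_div_graph:
  fixes \<phi> :: "'a::euclidean_space \<Rightarrow> 'a"
  assumes \<phi>: "\<phi> \<in> test_fun \<Omega>"
  shows "(l2_of \<phi>, l2_of (grad (dvg \<phi>))) \<in> grad_div_graph \<Omega> \<T>"
proof -
  have U: "\<psi> \<in> test_fun UNIV" if "\<psi> \<in> test_fun T" for \<psi> :: "'a \<Rightarrow> 'a" and T
    using that test_fun_mono by blast
  have "has_weak_grad_div T (l2_of \<phi>) (l2_of (grad (dvg \<phi>)))" for T
    unfolding has_weak_grad_div_def
  proof
    fix \<psi> :: "'a \<Rightarrow> 'a" assume \<psi>: "\<psi> \<in> test_fun T"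
    show "l2_of \<phi> \<bullet> l2_of (grad (dvg \<psi>)) = l2_of (grad (dvg \<phi>)) \<bullet> l2_of \<psi>"
      using grad_dvg_by_parts[OF test_fun_dvg[OF U[OF \<psi>]] U[OF \<phi>]]
        grad_dvg_by_parts[OF test_fun_dvg[OF U[OF \<phi>]] U[OF \<psi>]] by (simp add: inner_commute)
  qed
  then show ?thesis
    by (simp add: grad_div_graph_def l2_of_test_fun_in_L2 \<phi> test_fun_grad test_fun_dvg)
qed

text \<open>The maximal operator is the adjoint of \<nabla>div on test fields; in terms of graphs,
  orthogonality to that restriction is the weak equation \<nabla>div b = -a.\<close>

lemma grad_div_graph_orthogonal:
  fixes a b :: "('a::euclidean_space, 'a) l2"
  assumes "a \<in> L2 \<Omega>" "b \<in> L2 \<Omega>" "open \<Omega>"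
    and orth: "\<And>\<phi>. \<phi> \<in> test_fun \<Omega> \<Longrightarrow> (a, b) \<bullet> (l2_of \<phi>, l2_of (grad (dvg \<phi>))) = 0"
  shows "(b, - a) \<in> grad_div_graph \<Omega> {\<Omega>}"
proof -
  have "has_weak_grad_div \<Omega> b (- a)"
    unfolding has_weak_grad_div_def
  proof
    fix \<phi> :: "'a \<Rightarrow> 'a" assume "\<phi> \<in> test_fun \<Omega>"
    from orth[OF this] show "b \<bullet> l2_of (grad (dvg \<phi>)) = - a \<bullet> l2_of \<phi>" by (simp add: add_eq_0_iff)
  qed
  then show ?thesis using assms subspace_neg[OF subspace_L2[OF assms(3)]] by (simp add: grad_div_graph_def)
qed

section \<open>Equivalence of the energy norm and the trial norm\<close>

text \<open>Gram-Schmidt gives the projection explicitly, so completeness and closedness of the span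
  do not come up.\<close>

lemma ex_projection_on_span:
  fixes B :: "'a::real_inner set"
  assumes "finite B"
  shows "\<exists>y\<in>span B. \<forall>z\<in>span B. (x - y) \<bullet> z = 0"
proof -
  obtain C where C: "finite C" "span C = span B" "pairwise orthogonal C"
    using basis_orthogonal[OF assms] by blast
  \<comment> \<open>\<open>C\<close> may contain 0; division by zero makes that coefficient
    0.\<close>
  define y where "y = (\<Sum>c\<in>C. (x \<bullet> c / (c \<bullet> c)) *\<^sub>R c)"
  have "(x - y) \<bullet> z = 0" if z: "z \<in> span C" for z
    using z
  proof (rule span_induct)
    show "subspace {z. (x - y) \<bullet> z = 0}" by (auto simp: subspace_def inner_add_right)
    fix c assume c: "c \<in> C"
    have "y \<bullet> c = (\<Sum>d\<in>C. (x \<bullet> d / (d \<bullet> d)) * (d \<bullet> c))" by (simp add: y_def inner_sum_left)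
    also have "\<dots> = (\<Sum>d\<in>C. if d = c then (x \<bullet> c / (c \<bullet> c)) * (c \<bullet> c) else 0)"
      using C(3) c by (intro sum.cong) (auto simp: pairwise_def orthogonal_def)
    also have "\<dots> = x \<bullet> c" using C(1) c by simp
    finally show "(x - y) \<bullet> c = 0" by (simp add: inner_diff_left)
  qed
  moreover have "y \<in> span C" unfolding y_def by (intro span_sum span_scale span_base)
  ultimately show ?thesis using C(2) by blast
qed

lemma norm_Pair_power2: "(norm (a, b))\<^sup>2 = (norm a)\<^sup>2 + (norm b)\<^sup>2"
  by (simp add: norm_Pair)

context open_partition
begin

abbreviation "\<V> \<equiv> test_space \<Omega> \<T>"
abbreviation "\<H> \<equiv> broken_Hgd \<Omega> \<T>"
abbreviation "\<G> \<equiv> grad_div_graph \<Omega> \<T>"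
abbreviation "\<A> \<equiv> broken_grad_div \<T>"
abbreviation "tr \<equiv> tr_gd \<Omega> \<T>"
abbreviation "\<S> \<equiv> skel_Hgd \<Omega> \<T>"
abbreviation "trace_norm \<equiv> skel_norm \<Omega> \<T>"
abbreviation "\<TT> \<equiv> trial_to_test \<Omega> \<T>"

text \<open>An isometry of the test space into a product of four L2 spaces:
  \<open>test_inner\<close> becomes the inner product there, with its Cauchy-Schwarz
  inequality.\<close>

definition embed :: "'a test \<Rightarrow> (('a, 'a) l2 \<times> ('a, 'a) l2) \<times> (('a, 'a) l2 \<times> ('a, 'a) l2)" where
  "embed = (\<lambda>(v, \<tau>). ((v, \<A> v), (\<tau>, \<A> \<tau>)))"

text \<open>The condition on the third component replaces the explicit boundary conditions in
  \<^const>\<open>skel_Hgd_0\<close>.\<close>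

definition weak_trial_space :: "'a trial set" where
  "weak_trial_space = {(u, w, uh, wh). u \<in> L2 \<Omega> \<and> w \<in> L2 \<Omega> \<and> uh \<in> \<S> \<and> wh \<in> \<S> \<and>
     (\<forall>\<tau>\<in>Hgd \<Omega>. uh \<tau> = 0)}"

lemma graph_broken: "v \<in> \<H> \<Longrightarrow> (v, \<A> v) \<in> \<G>"
  by (simp add: grad_div_graph_iff)

lemma graph_Hgd: "v \<in> Hgd \<Omega> \<Longrightarrow> (v, wgrad_div \<Omega> v) \<in> \<G>"
  using grad_div_graph_unbroken[OF open_domain, of v] grad_div_graph_unbroken_subset by blast

lemma Hgd_broken:
  assumes "v \<in> Hgd \<Omega>"
  shows "v \<in> \<H>" "\<A> v = wgrad_div \<Omega> v"
  using graph_Hgd[OF assms] by (auto simp: grad_div_graph_iff)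

lemma graph_L2: "(v, a) \<in> \<G> \<Longrightarrow> v \<in> L2 \<Omega> \<and> a \<in> L2 \<Omega>"
  by (simp add: grad_div_graph_def)

text \<open>Places traces in the geometry of graphs: (-\<nabla>div v, v) is the graph element of v
  turned by a right angle, and its length is \<open>norm_gd \<Omega> v\<close>.\<close>

lemma tr_gd_eq:
  assumes "v \<in> Hgd \<Omega>" "\<tau> \<in> \<H>"
  shows "tr v \<tau> = (- wgrad_div \<Omega> v, v) \<bullet> (\<tau>, \<A> \<tau>)"
  using assms graph_L2[OF graph_Hgd[OF assms(1)]]
  by (simp add: tr_gd_def Hgd_broken mesh_inner_eq)

lemma tr_gd_off: "\<tau> \<notin> \<H> \<Longrightarrow> tr v \<tau> = 0"
  by (simp add: tr_gd_def)

lemma skel_zero_off: "vh \<in> \<S> \<Longrightarrow> \<tau> \<notin> \<H> \<Longrightarrow> vh \<tau> = 0"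
  by (auto simp: skel_Hgd_def tr_gd_def)

lemma skel_eqI:
  assumes "vh \<in> \<S>" "v \<in> Hgd \<Omega>"
    and "\<And>\<tau>. \<tau> \<in> \<H> \<Longrightarrow> vh \<tau> = (- wgrad_div \<Omega> v, v) \<bullet> (\<tau>, \<A> \<tau>)"
  shows "tr v = vh"
proof
  fix \<tau> show "tr v \<tau> = vh \<tau>"
    using assms skel_zero_off[OF assms(1), of \<tau>] tr_gd_eq[OF assms(2), of \<tau>]
    by (cases "\<tau> \<in> \<H>") (auto simp: tr_gd_off)
qed

lemma subspace_skel_Hgd: "subspace (\<S>)"
proof -
  note sub = subspace_grad_div_graph[OF open_domain, of "{\<Omega>}"] and iff = grad_div_graph_unbroken[OF open_domain]
  show ?thesis
    unfolding subspace_def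
  proof (intro conjI ballI allI)
    have "0 \<in> Hgd \<Omega>" "wgrad_div \<Omega> 0 = 0" using subspace_0[OF sub] by (auto simp: zero_prod_def iff)
    then have "tr 0 = 0" using tr_gd_eq[of 0] by (auto simp: fun_eq_iff tr_gd_def)
    then show "0 \<in> \<S>" using \<open>0 \<in> Hgd \<Omega>\<close> unfolding skel_Hgd_def by force
  next
    fix x y assume "x \<in> \<S>" "y \<in> \<S>"
    then obtain v w where v: "v \<in> Hgd \<Omega>" "x = tr v" and w: "w \<in> Hgd \<Omega>" "y = tr w"
      by (auto simp: skel_Hgd_def)
    have "(v, wgrad_div \<Omega> v) + (w, wgrad_div \<Omega> w) \<in> grad_div_graph \<Omega> {\<Omega>}"
      by (intro subspace_add[OF sub]) (simp_all add: iff v w)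
    then have vw: "v + w \<in> Hgd \<Omega>" "wgrad_div \<Omega> (v + w) = wgrad_div \<Omega> v + wgrad_div \<Omega> w" by (auto simp: iff)
    have "tr (v + w) \<tau> = (x + y) \<tau>" for \<tau>
      using tr_gd_eq[OF vw(1), of \<tau>] tr_gd_eq[OF v(1), of \<tau>] tr_gd_eq[OF w(1), of \<tau>] v w vw
      by (cases "\<tau> \<in> \<H>") (auto simp: inner_simps tr_gd_off)
    then show "x + y \<in> \<S>" using vw(1) unfolding skel_Hgd_def by (metis ext image_eqI)
  next
    fix c x assume "x \<in> \<S>"
    then obtain v where v: "v \<in> Hgd \<Omega>" "x = tr v" by (auto simp: skel_Hgd_def)
    have "c *\<^sub>R (v, wgrad_div \<Omega> v) \<in> grad_div_graph \<Omega> {\<Omega>}"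
      by (intro subspace_scale[OF sub]) (simp add: iff v)
    then have cv: "c *\<^sub>R v \<in> Hgd \<Omega>" "wgrad_div \<Omega> (c *\<^sub>R v) = c *\<^sub>R wgrad_div \<Omega> v" by (auto simp: iff)
    have "tr (c *\<^sub>R v) \<tau> = (c *\<^sub>R x) \<tau>" for \<tau>
      by (cases "\<tau> \<in> \<H>")
        (auto simp: scaleR_fun_def v(2) cv(2) tr_gd_eq[OF cv(1)] tr_gd_eq[OF v(1)] algebra_simps tr_gd_off)
    then show "c *\<^sub>R x \<in> \<S>" using cv(1) unfolding skel_Hgd_def by (metis ext image_eqI)
  qed
qed

lemma subspace_weak_trial_space: "subspace weak_trial_space"
  using subspace_skel_Hgd subspace_L2[OF open_domain, where 'b='a]
  unfolding weak_trial_space_def subspace_def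
  by (auto simp: zero_prod_def scaleR_fun_def)

text \<open>Sorted by test component, each half of \<open>bform\<close> is an inner product with a
  fixed pair plus a trace, which is itself such an inner product.\<close>

lemma bform_eq:
  assumes "(u, w, uh, wh) \<in> weak_trial_space"
  shows "bform \<T> (u, w, uh, wh) (v, \<tau>) =
    (u, - w) \<bullet> (v, \<A> v) + (- w, - u) \<bullet> (\<tau>, \<A> \<tau>) + uh \<tau> + wh v"
  using assms by (simp add: weak_trial_space_def bform_def mesh_inner_eq inner_simps)

lemma test_inner_eq:
  assumes "s \<in> \<V>"
  shows "test_inner \<T> t s = embed t \<bullet> embed s"
  using assms graph_L2[OF graph_broken]
  by (cases t; cases s) (auto simp: test_inner_def test_space_def embed_def mesh_inner_eq)

lemma embed_lincomb:
  assumes "s \<in> \<V>" "t \<in> \<V>"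
  shows "s + t \<in> \<V>" "embed (s + t) = embed s + embed t"
    "c *\<^sub>R s \<in> \<V>" "embed (c *\<^sub>R s) = c *\<^sub>R embed s"
    "s - t \<in> \<V>" "embed (s - t) = embed s - embed t"
proof -
  note sub = subspace_grad_div_graph[OF open_domain, of \<T>]
  have "(v + w, \<A> v + \<A> w) \<in> \<G>"
    "(v - w, \<A> v - \<A> w) \<in> \<G>"
    "(c *\<^sub>R v, c *\<^sub>R \<A> v) \<in> \<G>"
    if "v \<in> \<H>" "w \<in> \<H>" for v w
    using subspace_add[OF sub graph_broken[OF that(1)] graph_broken[OF that(2)]]
      subspace_diff[OF sub graph_broken[OF that(1)] graph_broken[OF that(2)]]
      subspace_scale[OF sub graph_broken[OF that(1)]] by simp_all
  then show "s + t \<in> \<V>" "embed (s + t) = embed s + embed t"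
    "c *\<^sub>R s \<in> \<V>" "embed (c *\<^sub>R s) = c *\<^sub>R embed s"
    "s - t \<in> \<V>" "embed (s - t) = embed s - embed t"
    using assms by (auto simp: grad_div_graph_iff test_space_def embed_def)
qed

lemma embed_eqI:
  assumes "s \<in> \<V>" "t \<in> \<V>"
    and "\<And>r. r \<in> \<V> \<Longrightarrow> embed s \<bullet> embed r = embed t \<bullet> embed r"
  shows "s = t"
proof -
  have "embed (s - t) \<bullet> embed (s - t) = 0"
    using assms(3)[OF embed_lincomb(5)[OF assms(1,2)]] embed_lincomb(6)[OF assms(1,2)]
    by (simp add: inner_diff_left)
  then have "embed (s - t) = 0" by (simp only: inner_eq_zero_iff)
  then have "s - t = 0" by (cases "s - t") (auto simp: embed_def zero_prod_def)
  then show ?thesis by simp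
qed

text \<open>Existence behind the \<open>THE\<close>: with preimages u0, w0 of the traces, each half
  of \<open>bform\<close> is the inner product of a fixed pair with a broken graph element.
  Projecting the pair onto the broken graph keeps these products and yields the test
  function.\<close>

lemma trial_to_test_props:
  assumes x: "x \<in> weak_trial_space"
  shows "\<TT> x \<in> \<V>"
    and "\<And>s. s \<in> \<V> \<Longrightarrow> embed (\<TT> x) \<bullet> embed s = bform \<T> x s"
proof -
  obtain u w uh wh where x_eq: "x = (u, w, uh, wh)" by (cases x) auto
  obtain u0 w0 where u0: "u0 \<in> Hgd \<Omega>" "uh = tr u0" and w0: "w0 \<in> Hgd \<Omega>" "wh = tr w0"
    using x by (auto simp: x_eq weak_trial_space_def skel_Hgd_def)
  note proj = ex_orthogonal_projection[OF subspace_grad_div_graph[OF open_domain] closed_grad_div_graph[OF open_domain]]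
  define z1 where "z1 = (u, - w) + (- wgrad_div \<Omega> w0, w0)"
  define z2 where "z2 = (- w, - u) + (- wgrad_div \<Omega> u0, u0)"
  obtain q1 where q1: "q1 \<in> \<G>" "\<And>g. g \<in> \<G> \<Longrightarrow> (z1 - q1) \<bullet> g = 0"
    using proj[of \<T> z1] by blast
  obtain q2 where q2: "q2 \<in> \<G>" "\<And>g. g \<in> \<G> \<Longrightarrow> (z2 - q2) \<bullet> g = 0"
    using proj[of \<T> z2] by blast
  define t where "t = (fst q1, fst q2)"
  have t: "t \<in> \<V>" "embed t = (q1, q2)"
    using q1(1) q2(1) grad_div_graph_iff[of "fst q1" "snd q1"] grad_div_graph_iff[of "fst q2" "snd q2"]
    by (auto simp: t_def test_space_def embed_def)
  have ts: "embed t \<bullet> embed s = bform \<T> x s" if s: "s \<in> \<V>" for s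
  proof -
    obtain v \<tau> where s_eq: "s = (v, \<tau>)" by (cases s)
    have v: "v \<in> \<H>" "\<tau> \<in> \<H>" using s by (auto simp: s_eq test_space_def)
    have "embed t \<bullet> embed s = q1 \<bullet> (v, \<A> v) + q2 \<bullet> (\<tau>, \<A> \<tau>)"
      unfolding t(2) by (simp add: embed_def s_eq)
    also have "\<dots> = z1 \<bullet> (v, \<A> v) + z2 \<bullet> (\<tau>, \<A> \<tau>)"
      using q1(2)[OF graph_broken[OF v(1)]] q2(2)[OF graph_broken[OF v(2)]] by (simp add: inner_diff_left)
    also have "\<dots> = bform \<T> x s"
      using bform_eq[OF x[unfolded x_eq], of v \<tau>] tr_gd_eq[OF u0(1) v(2)] tr_gd_eq[OF w0(1) v(1)]
      unfolding x_eq s_eq z1_def z2_def inner_add_left u0(2) w0(2) by linarith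
    finally show ?thesis .
  qed
  have "\<TT> x = t"
    unfolding trial_to_test_def
  proof (rule the_equality)
    show "t \<in> \<V> \<and> (\<forall>s\<in>\<V>. test_inner \<T> t s = bform \<T> x s)"
      using t ts by (auto simp: test_inner_eq)
    fix t' assume t': "t' \<in> \<V> \<and> (\<forall>s\<in>\<V>. test_inner \<T> t' s = bform \<T> x s)"
    show "t' = t"
      by (rule embed_eqI) (use t t' ts in \<open>auto simp: test_inner_eq\<close>)
  qed
  then show "\<TT> x \<in> \<V>"
    and "\<And>s. s \<in> \<V> \<Longrightarrow> embed (\<TT> x) \<bullet> embed s = bform \<T> x s"
    using t ts by simp_all
qed

text \<open>The optimal test function in embedded form. Its norm is the energy norm of the trial
  function, and the discrete problem becomes a least squares problem in the image.\<close>

definition energy :: "'a trial \<Rightarrow> (('a, 'a) l2 \<times> ('a, 'a) l2) \<times> (('a, 'a) l2 \<times> ('a, 'a) l2)" where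
  "energy x = embed (\<TT> x)"

lemma inner_energy: "x \<in> weak_trial_space \<Longrightarrow> s \<in> \<V> \<Longrightarrow> energy x \<bullet> embed s = bform \<T> x s"
  unfolding energy_def by (rule trial_to_test_props)

lemma bform_lincomb:
  assumes "x \<in> weak_trial_space" "y \<in> weak_trial_space"
  shows "bform \<T> (x + y) s = bform \<T> x s + bform \<T> y s" "bform \<T> (c *\<^sub>R x) s = c * bform \<T> x s"
proof -
  note add = subspace_add[OF subspace_weak_trial_space assms]
    and scale = subspace_scale[OF subspace_weak_trial_space assms(1), of c]
  obtain u w uh wh u' w' uh' wh' v \<tau> where eq: "x = (u, w, uh, wh)" "y = (u', w', uh', wh')" "s = (v, \<tau>)"
    by (cases x; cases y; cases s) auto
  show "bform \<T> (x + y) s = bform \<T> x s + bform \<T> y s"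
    using add assms unfolding eq by (simp add: bform_eq inner_simps)
  show "bform \<T> (c *\<^sub>R x) s = c * bform \<T> x s"
    using scale assms unfolding eq by (simp add: bform_eq scaleR_fun_def inner_simps algebra_simps)
qed

lemma energy_lincomb:
  assumes "x \<in> weak_trial_space" "y \<in> weak_trial_space"
  shows "energy (x + y) = energy x + energy y" "energy (c *\<^sub>R x) = c *\<^sub>R energy x"
proof -
  note add = subspace_add[OF subspace_weak_trial_space assms]
    and scale = subspace_scale[OF subspace_weak_trial_space assms(1), of c]
  note tt = trial_to_test_props(1)
  note ttx = embed_lincomb(3,4)[OF tt[OF assms(1)] tt[OF assms(1)]]
  have "\<TT> (x + y) = \<TT> x + \<TT> y"
    by (rule embed_eqI)
      (use assms add tt in \<open>auto simp: embed_lincomb trial_to_test_props bform_lincomb inner_add_left\<close>)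
  then show "energy (x + y) = energy x + energy y"
    by (simp add: energy_def embed_lincomb tt assms)
  have "\<TT> (c *\<^sub>R x) = c *\<^sub>R \<TT> x"
    by (rule embed_eqI)
      (use assms scale tt ttx in \<open>auto simp: trial_to_test_props bform_lincomb\<close>)
  then show "energy (c *\<^sub>R x) = c *\<^sub>R energy x"
    by (simp add: energy_def ttx)
qed

lemma energy_diff:
  assumes "x \<in> weak_trial_space" "y \<in> weak_trial_space"
  shows "energy (x - y) = energy x - energy y"
proof -
  have "- y \<in> weak_trial_space" using subspace_neg[OF subspace_weak_trial_space assms(2)] .
  then show ?thesis
    using energy_lincomb(1)[OF assms(1), of "- y"] energy_lincomb(2)[OF assms(2) assms(2), of "-1"] by simp
qed

section \<open>The trace norm as a dual norm\<close>

lemma skel_norm_nonneg: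
  assumes "vh \<in> \<S>"
  shows "0 \<le> trace_norm vh"
  unfolding skel_norm_def
  by (rule cInf_greatest) (use assms in \<open>auto simp: skel_Hgd_def norm_gd_def\<close>)

text \<open>By Cauchy-Schwarz every preimage v bounds the functional with factor
  \<open>norm_gd \<Omega> v\<close>, and the infimum over preimages inherits the bound.\<close>

lemma abs_skel_le:
  assumes vh: "vh \<in> \<S>" and \<tau>: "\<tau> \<in> \<H>"
  shows "\<bar>vh \<tau>\<bar> \<le> trace_norm vh * norm (\<tau>, \<A> \<tau>)"
proof -
  define n where "n = norm (\<tau>, \<A> \<tau>)"
  have le: "\<bar>vh \<tau>\<bar> \<le> norm_gd \<Omega> v * n" if "v \<in> Hgd \<Omega>" "tr v = vh" for v
    using Cauchy_Schwarz_ineq2[of "(- wgrad_div \<Omega> v, v)" "(\<tau>, \<A> \<tau>)"]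
      tr_gd_eq[OF that(1) \<tau>] that(2)
    by (simp add: n_def norm_gd_def norm_Pair add.commute)
  obtain v0 where v0: "v0 \<in> Hgd \<Omega>" "tr v0 = vh" using vh by (auto simp: skel_Hgd_def)
  show ?thesis
  proof (cases "n = 0")
    case True
    then show ?thesis using le[OF v0] by (simp add: n_def)
  next
    case False
    then have n: "n > 0" by (simp add: n_def)
    have "\<bar>vh \<tau>\<bar> / n \<le> trace_norm vh"
      unfolding skel_norm_def
      by (rule cInf_greatest) (use v0 le n in \<open>auto simp: pos_divide_le_eq\<close>)
    then show ?thesis using n by (simp add: n_def pos_divide_le_eq)
  qed
qed

text \<open>The Riesz representative \<open>(\<tau>, \<nabla>div \<tau>)\<close> of \<open>vh\<close> in the broken space has \<open>\<nabla>div \<tau> \<in> H(\<nabla>div, \<Omega>)\<close>,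
  because \<open>vh\<close> vanishes on test functions on all of \<open>\<Omega>\<close>, and \<open>\<nabla>div \<tau>\<close> is a preimage of \<open>vh\<close>
  under the trace.\<close>

lemma skel_norm_le:
  assumes vh: "vh \<in> \<S>" and "C \<ge> 0"
    and bound: "\<And>\<tau>. \<tau> \<in> \<H> \<Longrightarrow> \<bar>vh \<tau>\<bar> \<le> C * norm (\<tau>, \<A> \<tau>)"
  shows "trace_norm vh \<le> C"
proof -
  obtain v0 where v0: "v0 \<in> Hgd \<Omega>" "vh = tr v0" using vh by (auto simp: skel_Hgd_def)
  obtain q where q: "q \<in> \<G>"
      "\<And>g. g \<in> \<G> \<Longrightarrow> ((- wgrad_div \<Omega> v0, v0) - q) \<bullet> g = 0"
    using ex_orthogonal_projection[OF subspace_grad_div_graph[OF open_domain] closed_grad_div_graph[OF open_domain]]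
    by blast
  obtain \<tau> w where q_eq: "q = (\<tau>, w)" by (cases q)
  have \<tau>: "\<tau> \<in> \<H>" "\<A> \<tau> = w" "\<tau> \<in> L2 \<Omega>" "w \<in> L2 \<Omega>"
    using q(1) graph_L2 by (auto simp: q_eq grad_div_graph_iff)
  have rep: "vh \<sigma> = (\<tau>, w) \<bullet> (\<sigma>, \<A> \<sigma>)" if "\<sigma> \<in> \<H>" for \<sigma>
    using q(2)[OF graph_broken[OF that]] tr_gd_eq[OF v0(1) that] v0(2)
    by (simp add: q_eq inner_diff_left)
  have "(w, - \<tau>) \<in> grad_div_graph \<Omega> {\<Omega>}"
  proof (rule grad_div_graph_orthogonal[OF \<tau>(3,4) open_domain])
    fix \<phi> :: "'a \<Rightarrow> 'a" assume \<phi>: "\<phi> \<in> test_fun \<Omega>"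
    have "(- wgrad_div \<Omega> v0, v0) \<bullet> (l2_of \<phi>, l2_of (grad (dvg \<phi>))) = 0"
      using HgdD(3)[OF open_domain v0(1)] \<phi> by (simp add: has_weak_grad_div_def)
    then show "(\<tau>, w) \<bullet> (l2_of \<phi>, l2_of (grad (dvg \<phi>))) = 0"
      using q(2)[OF test_fun_grad_div_graph[OF \<phi>]] unfolding q_eq inner_diff_left by linarith
  qed
  then have w: "w \<in> Hgd \<Omega>" "wgrad_div \<Omega> w = - \<tau>" by (auto simp: grad_div_graph_unbroken[OF open_domain])
  have "tr w = vh"
    by (rule skel_eqI[OF vh w(1)]) (simp add: rep w(2))
  then have "trace_norm vh \<le> norm_gd \<Omega> w"
    unfolding skel_norm_def using w(1)
    by (intro cInf_lower) (auto intro!: bdd_belowI[of _ 0] simp: norm_gd_def)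
  \<comment> \<open>(w, -\<tau>) is \<open>q\<close> rotated, so this preimage is exactly as long as
    the Riesz representative.\<close>
  also have "norm_gd \<Omega> w = norm q" by (simp add: norm_gd_def w(2) q_eq norm_Pair add.commute)
  also have "norm q \<le> C"
  proof (cases "norm q = 0")
    case False
    \<comment> \<open>A functional attains its norm at its own representative.\<close>
    have "norm q * norm q = vh \<tau>"
      using rep[OF \<tau>(1)] by (simp add: \<tau>(2) q_eq power2_norm_eq_inner power2_eq_square[symmetric])
    also have "\<dots> \<le> C * norm q" using bound[OF \<tau>(1)] by (simp add: \<tau>(2) q_eq)
    finally show ?thesis using False by simp
  qed (use \<open>C \<ge> 0\<close> in simp)
  finally show ?thesis .
qed

text \<open>The test function solves the adjoint problem on \<open>\<Omega>\<close>; it comes from the orthogonal splitting of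
  \<open>L\<^sub>2 \<times> L\<^sub>2\<close> into the graph of \<open>\<nabla>div\<close> and the rotated graph of its adjoint.\<close>

lemma norm_L2_components_le_energy:
  assumes x: "(u, w, uh, wh) \<in> weak_trial_space"
  shows "norm (u, w) \<le> norm (energy (u, w, uh, wh))"
proof -
  obtain w0 where w0: "w0 \<in> Hgd \<Omega>" "wh = tr w0"
    using x by (auto simp: weak_trial_space_def skel_Hgd_def)
  have uw: "u \<in> L2 \<Omega>" "w \<in> L2 \<Omega>" "\<And>\<tau>. \<tau> \<in> Hgd \<Omega> \<Longrightarrow> uh \<tau> = 0"
    using x by (auto simp: weak_trial_space_def)
  note iff = grad_div_graph_unbroken[OF open_domain]
  obtain q where q: "q \<in> grad_div_graph \<Omega> {\<Omega>}"
      "\<And>g. g \<in> grad_div_graph \<Omega> {\<Omega>} \<Longrightarrow> ((- w, - u) - q) \<bullet> g = 0"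
    using ex_orthogonal_projection[OF subspace_grad_div_graph[OF open_domain] closed_grad_div_graph[OF open_domain]]
    by blast
  define \<tau> where "\<tau> = fst q"
  \<comment> \<open>Write A = \<nabla>div and v = -b, for which A v = a is shown below. The
    splitting then reads v - A \<tau> = u and \<tau> + A v = -w, the adjoint system with data (u,
    w).\<close>
  define a where "a = - w - \<tau>"
  define b where "b = - u - wgrad_div \<Omega> \<tau>"
  have \<tau>: "\<tau> \<in> Hgd \<Omega>" "q = (\<tau>, wgrad_div \<Omega> \<tau>)" using q(1) iff[of \<tau> "snd q"] by (auto simp: \<tau>_def)
  have ab: "(- w, - u) - q = (a, b)" by (simp add: a_def b_def \<tau>(2))
  have "a \<in> L2 \<Omega>" "b \<in> L2 \<Omega>"
    unfolding a_def b_def using uw HgdD[OF open_domain \<tau>(1)] subspace_L2[OF open_domain, where 'b='a]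
    by (auto intro!: subspace_diff subspace_neg)
  then have "(b, - a) \<in> grad_div_graph \<Omega> {\<Omega>}"
    by (rule grad_div_graph_orthogonal[OF _ _ open_domain]) (use q(2) test_fun_grad_div_graph ab in metis)
  then have "- (b, - a) \<in> grad_div_graph \<Omega> {\<Omega>}"
    by (rule subspace_neg[OF subspace_grad_div_graph[OF open_domain]])
  then have v: "- b \<in> Hgd \<Omega>" "wgrad_div \<Omega> (- b) = a" by (auto simp: iff)
  have s: "(- b, \<tau>) \<in> \<V>" using v \<tau> by (simp add: test_space_def Hgd_broken)
  \<comment> \<open>The residual (a, b) is orthogonal to the whole graph; orthogonality to the graph
    element of w0 says that the trace of w0 vanishes at -b. The trace uh vanishes at \<tau> because
    \<tau> is unbroken.\<close>
  have "wh (- b) = 0"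
    using q(2)[of "(w0, wgrad_div \<Omega> w0)"] w0 iff tr_gd_eq[OF w0(1) Hgd_broken(1)[OF v(1)]]
    by (simp add: ab Hgd_broken(2)[OF v(1)] v(2) inner_commute)
  then have "bform \<T> (u, w, uh, wh) (- b, \<tau>) = (u, - w) \<bullet> (- b, a) + (- w, - u) \<bullet> (\<tau>, wgrad_div \<Omega> \<tau>)"
    by (simp add: bform_eq[OF x] Hgd_broken v \<tau>(1) uw(3))
  also have "\<dots> = (norm (u, w))\<^sup>2"
    by (simp add: a_def b_def norm_Pair_power2 power2_norm_eq_inner inner_simps)
  finally have eq: "(norm (u, w))\<^sup>2 = energy (u, w, uh, wh) \<bullet> embed (- b, \<tau>)"
    using inner_energy[OF x s] by simp
  \<comment> \<open>Pythagoras for the splitting: the test function has the same norm as the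
    data.\<close>
  have "(norm (embed (- b, \<tau>)))\<^sup>2 = (norm (a, b))\<^sup>2 + (norm q)\<^sup>2"
    by (simp add: embed_def norm_Pair_power2 Hgd_broken v \<tau>)
  also have "\<dots> = (norm ((a, b) + q))\<^sup>2"
    using q(2)[OF q(1)] by (simp add: ab power2_norm_eq_inner inner_simps inner_commute)
  also have "(a, b) + q = (- w, - u)" by (simp add: a_def b_def \<tau>(2))
  also have "(norm (- w, - u))\<^sup>2 = (norm (u, w))\<^sup>2" by (simp add: norm_Pair_power2)
  finally have "norm (embed (- b, \<tau>)) = norm (u, w)" by (simp add: power2_eq_iff_nonneg)
  then have "norm (u, w) * norm (u, w) \<le> norm (energy (u, w, uh, wh)) * norm (u, w)"
    using norm_cauchy_schwarz[of "energy (u, w, uh, wh)" "embed (- b, \<tau>)"] eq by (simp add: power2_eq_square)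
  then show ?thesis by (cases "norm (u, w) = 0") auto
qed

text \<open>3 is the square root of 1 + 4 + 4: the L2 components together are at most the energy
  norm N, and each trace is at most 2 N.\<close>

lemma trial_norm_le_energy:
  assumes x: "x \<in> weak_trial_space"
  shows "trial_norm \<Omega> \<T> x \<le> 3 * norm (energy x)"
proof -
  obtain u w uh wh where x_eq: "x = (u, w, uh, wh)" by (cases x) auto
  define N where "N = norm (energy x)"
  have N: "N \<ge> 0" by (simp add: N_def)
  have uw: "norm (u, w) \<le> N" unfolding N_def x_eq by (rule norm_L2_components_le_energy[OF x[unfolded x_eq]])
  have sk: "uh \<in> \<S>" "wh \<in> \<S>" using x by (auto simp: x_eq weak_trial_space_def)
  note z = subspace_0[OF subspace_grad_div_graph[OF open_domain, of \<T>], unfolded zero_prod_def grad_div_graph_iff]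
  have z_skel: "vh 0 = 0" if "vh \<in> \<S>" for vh
    using that tr_gd_eq[of _ 0] z by (auto simp: skel_Hgd_def)
  \<comment> \<open>Testing with (0, \<tau>) isolates \<open>uh\<close>; the energy product and the
    L2 components contribute N each.\<close>
  have uh: "\<bar>uh \<tau>\<bar> \<le> 2 * N * norm (\<tau>, \<A> \<tau>)" if \<tau>: "\<tau> \<in> \<H>" for \<tau>
  proof -
    have s: "(0, \<tau>) \<in> \<V>" using \<tau> z by (simp add: test_space_def)
    have "uh \<tau> = energy x \<bullet> embed (0, \<tau>) - (- w, - u) \<bullet> (\<tau>, \<A> \<tau>)"
      using inner_energy[OF x s] bform_eq[OF x[unfolded x_eq], of 0 \<tau>] z z_skel[OF sk(2)] by (simp add: x_eq)
    moreover have "\<bar>energy x \<bullet> embed (0, \<tau>)\<bar> \<le> N * norm (\<tau>, \<A> \<tau>)"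
      using Cauchy_Schwarz_ineq2[of "energy x" "embed (0, \<tau>)"] z by (simp add: embed_def norm_Pair N_def)
    moreover have "\<bar>(- w, - u) \<bullet> (\<tau>, \<A> \<tau>)\<bar> \<le> N * norm (\<tau>, \<A> \<tau>)"
      using uw by (intro order_trans[OF Cauchy_Schwarz_ineq2] mult_right_mono) (auto simp: norm_Pair add.commute)
    ultimately show ?thesis by linarith
  qed
  have wh: "\<bar>wh v\<bar> \<le> 2 * N * norm (v, \<A> v)" if v: "v \<in> \<H>" for v
  proof -
    have s: "(v, 0) \<in> \<V>" using v z by (simp add: test_space_def)
    have "wh v = energy x \<bullet> embed (v, 0) - (u, - w) \<bullet> (v, \<A> v)"
      using inner_energy[OF x s] bform_eq[OF x[unfolded x_eq], of v 0] z z_skel[OF sk(1)] by (simp add: x_eq)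
    moreover have "\<bar>energy x \<bullet> embed (v, 0)\<bar> \<le> N * norm (v, \<A> v)"
      using Cauchy_Schwarz_ineq2[of "energy x" "embed (v, 0)"] z by (simp add: embed_def norm_Pair N_def)
    moreover have "\<bar>(u, - w) \<bullet> (v, \<A> v)\<bar> \<le> N * norm (v, \<A> v)"
      using uw by (intro order_trans[OF Cauchy_Schwarz_ineq2] mult_right_mono) (auto simp: norm_Pair add.commute)
    ultimately show ?thesis by linarith
  qed
  have le: "trace_norm uh \<le> 2 * N" "trace_norm wh \<le> 2 * N"
    using skel_norm_le[OF sk(1) _ uh] skel_norm_le[OF sk(2) _ wh] N by auto
  note power_mono[OF le(1) skel_norm_nonneg[OF sk(1)], of 2] power_mono[OF le(2) skel_norm_nonneg[OF sk(2)], of 2]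
  moreover have "(norm u)\<^sup>2 + (norm w)\<^sup>2 \<le> N\<^sup>2"
    unfolding norm_Pair_power2[symmetric] using uw by (intro power_mono) auto
  ultimately have "(norm u)\<^sup>2 + (norm w)\<^sup>2 + (trace_norm uh)\<^sup>2 + (trace_norm wh)\<^sup>2 \<le> (3 * N)\<^sup>2"
    by (simp add: power_mult_distrib)
  then show ?thesis using N unfolding x_eq trial_norm_def N_def[symmetric, unfolded x_eq] by (simp add: real_le_lsqrt)
qed

text \<open>Tested with its own optimal test function, \<open>bform\<close> gives the square of the
  energy norm N, and each of its four terms is at most N times the trial norm.\<close>

lemma energy_le_trial_norm:
  assumes x: "x \<in> weak_trial_space"
  shows "norm (energy x) \<le> 4 * trial_norm \<Omega> \<T> x"
proof -
  obtain u w uh wh where x_eq: "x = (u, w, uh, wh)" by (cases x) auto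
  obtain v \<tau> where s: "\<TT> x = (v, \<tau>)" by (cases "\<TT> x")
  have st: "(v, \<tau>) \<in> \<V>" using trial_to_test_props(1)[OF x] by (simp add: s)
  then have br: "v \<in> \<H>" "\<tau> \<in> \<H>" by (auto simp: test_space_def)
  define N where "N = norm (energy x)"
  define t where "t = trial_norm \<Omega> \<T> x"
  define p where "p = (v, \<A> v)"
  define q where "q = (\<tau>, \<A> \<tau>)"
  have e: "energy x = (p, q)" by (simp add: energy_def s embed_def p_def q_def)
  have pq: "norm p \<le> N" "norm q \<le> N"
    unfolding N_def e using norm_fst_le[of p q] norm_snd_le[of q p] by auto
  have sk: "uh \<in> \<S>" "wh \<in> \<S>" using x by (auto simp: x_eq weak_trial_space_def)
  have t0: "t = sqrt ((norm u)\<^sup>2 + (norm w)\<^sup>2 + (trace_norm uh)\<^sup>2 + (trace_norm wh)\<^sup>2)"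
    by (simp add: t_def x_eq trial_norm_def)
  have t: "norm (u, w) \<le> t" "trace_norm uh \<le> t" "trace_norm wh \<le> t" "0 \<le> t"
    unfolding t0 norm_Pair by (auto intro!: real_le_rsqrt)
  have N: "N \<ge> 0" by (simp add: N_def)
  have prod: "a * b \<le> t * N" if "a \<le> t" "0 \<le> b" "b \<le> N" for a b
    using that t(4) by (intro mult_mono) auto
  have "N * N = bform \<T> x (v, \<tau>)"
    using inner_energy[OF x st] by (simp add: N_def energy_def s power2_norm_eq_inner flip: power2_eq_square)
  also have "\<dots> = (u, - w) \<bullet> p + (- w, - u) \<bullet> q + uh \<tau> + wh v"
    unfolding x_eq bform_eq[OF x[unfolded x_eq]] p_def q_def by simp
  also have "\<dots> \<le> t * N + t * N + t * N + t * N"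
  proof (intro add_mono)
    show "(u, - w) \<bullet> p \<le> t * N"
      using norm_cauchy_schwarz[of "(u, - w)" p] prod[OF t(1) _ pq(1)] by (simp add: norm_Pair)
    show "(- w, - u) \<bullet> q \<le> t * N"
      using norm_cauchy_schwarz[of "(- w, - u)" q] prod[OF t(1) _ pq(2)] by (simp add: norm_Pair add.commute)
    show "uh \<tau> \<le> t * N"
      using abs_skel_le[OF sk(1) br(2)] prod[OF t(2) _ pq(2)] by (simp add: q_def)
    show "wh v \<le> t * N"
      using abs_skel_le[OF sk(2) br(1)] prod[OF t(3) _ pq(1)] by (simp add: p_def)
  qed
  finally have "N * N \<le> 4 * t * N" by (simp add: algebra_simps)
  then show ?thesis using N t(4) by (cases "N = 0") (auto simp: N_def t_def)
qed

text \<open>All four parts of the trial norm vanish. A functional with trace norm 0 is zero on the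
  broken space by \<open>abs_skel_le\<close>, and off it by normalisation.\<close>

lemma eq_0_if_energy_eq_0:
  assumes x: "x \<in> weak_trial_space" and "energy x = 0"
  shows "x = 0"
proof -
  obtain u w uh wh where x_eq: "x = (u, w, uh, wh)" by (cases x) auto
  have sk: "uh \<in> \<S>" "wh \<in> \<S>" using x by (auto simp: x_eq weak_trial_space_def)
  have "sqrt ((norm u)\<^sup>2 + (norm w)\<^sup>2 + (trace_norm uh)\<^sup>2 + (trace_norm wh)\<^sup>2) \<le> 0"
    using trial_norm_le_energy[OF x] assms(2) by (simp add: x_eq trial_norm_def)
  then have "(norm u)\<^sup>2 + (norm w)\<^sup>2 + (trace_norm uh)\<^sup>2 + (trace_norm wh)\<^sup>2 \<le> 0" by simp
  then have *: "(norm u)\<^sup>2 = 0" "(norm w)\<^sup>2 = 0" "(trace_norm uh)\<^sup>2 = 0" "(trace_norm wh)\<^sup>2 = 0"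
    using zero_le_power2[of "norm u"] zero_le_power2[of "norm w"]
      zero_le_power2[of "trace_norm uh"] zero_le_power2[of "trace_norm wh"] by linarith+
  have "vh = 0" if "vh \<in> \<S>" "trace_norm vh = 0" for vh
  proof
    fix \<tau> show "vh \<tau> = 0 \<tau>"
      using abs_skel_le[OF that(1), of \<tau>] skel_zero_off[OF that(1), of \<tau>] that(2) by (cases "\<tau> \<in> \<H>") auto
  qed
  then show ?thesis using * sk by (simp add: x_eq zero_prod_def)
qed

text \<open>Tested with \<open>\<TT> \<delta>\<close>, both the continuous and the discrete equation
  become inner products with \<open>energy \<delta>\<close>. The discrete one is thus the normal
  equation of a projection onto the image of \<open>U\<^sub>h\<close>; injectivity of
  \<open>energy\<close> gives uniqueness.\<close>

lemma quasi_optimality: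
  assumes sol: "is_solution \<Omega> \<T> f \<uu>" and \<uu>: "\<uu> \<in> weak_trial_space"
    and Uh: "finite_dim_subspace U\<^sub>h" "U\<^sub>h \<subseteq> weak_trial_space"
  shows "\<exists>!\<uu>\<^sub>h. is_discrete_solution \<Omega> \<T> f U\<^sub>h \<uu>\<^sub>h"
    and "\<And>\<uu>\<^sub>h \<ww>. is_discrete_solution \<Omega> \<T> f U\<^sub>h \<uu>\<^sub>h \<Longrightarrow> \<ww> \<in> U\<^sub>h \<Longrightarrow>
      trial_norm \<Omega> \<T> (\<uu> - \<uu>\<^sub>h) \<le> 12 * trial_norm \<Omega> \<T> (\<uu> - \<ww>)"
proof -
  have sub: "subspace U\<^sub>h" using Uh(1) by (simp add: finite_dim_subspace_def)
  obtain B where B: "finite B" "U\<^sub>h = span B" using Uh(1) by (auto simp: finite_dim_subspace_def)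
  have disc: "is_discrete_solution \<Omega> \<T> f U\<^sub>h x \<longleftrightarrow> x \<in> U\<^sub>h \<and> (\<forall>\<delta>\<in>U\<^sub>h. (energy \<uu> - energy x) \<bullet> energy \<delta> = 0)" for x
  proof -
    have "bform \<T> x (\<TT> \<delta>) = Lform f (\<TT> \<delta>) \<longleftrightarrow> (energy \<uu> - energy x) \<bullet> energy \<delta> = 0"
      if "x \<in> U\<^sub>h" "\<delta> \<in> U\<^sub>h" for \<delta>
    proof -
      have t: "\<TT> \<delta> \<in> \<V>" using that Uh(2) by (intro trial_to_test_props) auto
      have "Lform f (\<TT> \<delta>) = energy \<uu> \<bullet> energy \<delta>"
        using sol t inner_energy[OF \<uu> t] by (simp add: is_solution_def energy_def)
      moreover have "bform \<T> x (\<TT> \<delta>) = energy x \<bullet> energy \<delta>"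
        using that Uh(2) inner_energy[OF _ t, of x] by (auto simp: energy_def)
      ultimately show ?thesis by (auto simp: inner_diff_left)
    qed
    then show ?thesis by (auto simp: is_discrete_solution_def)
  qed
  have lin: "energy (x + y) = energy x + energy y" "energy (c *\<^sub>R x) = c *\<^sub>R energy x" "energy (x - y) = energy x - energy y"
    if "x \<in> U\<^sub>h" "y \<in> U\<^sub>h" for x y c
    using that Uh(2) energy_lincomb[of x y] energy_diff[of x y] by auto
  have e0: "energy 0 = 0" using lin(3)[of 0 0] subspace_0[OF sub] by simp
  \<comment> \<open>Linearity of \<open>energy\<close> is available only inside the weak trial
    space, so the image of the span is computed from both sides by minimality of spans.\<close>
  have image: "energy ` U\<^sub>h = span (energy ` B)"
  proof
    have "U\<^sub>h \<subseteq> {x \<in> U\<^sub>h. energy x \<in> span (energy ` B)}"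
      unfolding B(2)
    proof (rule span_minimal)
      show "subspace {x \<in> span B. energy x \<in> span (energy ` B)}"
      proof (rule subspaceI)
        show "0 \<in> {x \<in> span B. energy x \<in> span (energy ` B)}" using e0 by (simp add: span_zero)
      next
        fix x y assume "x \<in> {x \<in> span B. energy x \<in> span (energy ` B)}"
          "y \<in> {x \<in> span B. energy x \<in> span (energy ` B)}"
        then show "x + y \<in> {x \<in> span B. energy x \<in> span (energy ` B)}"
          using lin(1)[of x y] B(2) by (simp add: span_add)
      next
        fix c x assume "x \<in> {x \<in> span B. energy x \<in> span (energy ` B)}"
        then show "c *\<^sub>R x \<in> {x \<in> span B. energy x \<in> span (energy ` B)}"
          using lin(2)[of x x c] B(2) by (simp add: span_scale)
      qed
    qed (auto intro: span_base)
    then show "energy ` U\<^sub>h \<subseteq> span (energy ` B)" by auto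
    show "span (energy ` B) \<subseteq> energy ` U\<^sub>h"
    proof (rule span_minimal)
      show "subspace (energy ` U\<^sub>h)"
      proof (rule subspaceI)
        show "0 \<in> energy ` U\<^sub>h" using e0 subspace_0[OF sub] by (metis image_eqI)
      next
        fix x y assume "x \<in> energy ` U\<^sub>h" "y \<in> energy ` U\<^sub>h"
        then obtain a b where ab: "a \<in> U\<^sub>h" "x = energy a" "b \<in> U\<^sub>h" "y = energy b" by blast
        have "energy (a + b) \<in> energy ` U\<^sub>h" using subspace_add[OF sub ab(1,3)] by (rule imageI)
        then show "x + y \<in> energy ` U\<^sub>h" using lin(1)[OF ab(1,3)] ab by simp
      next
        fix c x assume "x \<in> energy ` U\<^sub>h"
        then obtain a where a: "a \<in> U\<^sub>h" "x = energy a" by blast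
        have "energy (c *\<^sub>R a) \<in> energy ` U\<^sub>h" using subspace_scale[OF sub a(1)] by (rule imageI)
        then show "c *\<^sub>R x \<in> energy ` U\<^sub>h" using lin(2)[OF a(1) a(1)] a by simp
      qed
    qed (auto simp: B(2) intro: span_base)
  qed
  obtain y where "y \<in> span (energy ` B)" "\<forall>z\<in>span (energy ` B). (energy \<uu> - y) \<bullet> z = 0"
    using ex_projection_on_span[of "energy ` B" "energy \<uu>"] B(1) by auto
  then obtain uh where uh: "uh \<in> U\<^sub>h" "\<forall>\<delta>\<in>U\<^sub>h. (energy \<uu> - energy uh) \<bullet> energy \<delta> = 0"
    unfolding image[symmetric] by auto
  show "\<exists>!\<uu>\<^sub>h. is_discrete_solution \<Omega> \<T> f U\<^sub>h \<uu>\<^sub>h"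
  proof (rule ex1I[of _ uh])
    show "is_discrete_solution \<Omega> \<T> f U\<^sub>h uh" using uh disc by blast
    fix x assume "is_discrete_solution \<Omega> \<T> f U\<^sub>h x"
    then have x: "x \<in> U\<^sub>h" "\<forall>\<delta>\<in>U\<^sub>h. (energy \<uu> - energy x) \<bullet> energy \<delta> = 0" using disc by auto
    have d: "x - uh \<in> U\<^sub>h" using x uh subspace_diff[OF sub] by blast
    have "energy (x - uh) \<bullet> energy (x - uh) = 0"
      using bspec[OF x(2) d] bspec[OF uh(2) d] lin(3)[OF x(1) uh(1)] by (simp add: inner_simps)
    then have "x - uh = 0" using d Uh(2) by (intro eq_0_if_energy_eq_0) auto
    then show "x = uh" by simp
  qed
  show "trial_norm \<Omega> \<T> (\<uu> - x) \<le> 12 * trial_norm \<Omega> \<T> (\<uu> - \<ww>)"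
    if x: "is_discrete_solution \<Omega> \<T> f U\<^sub>h x" and \<ww>: "\<ww> \<in> U\<^sub>h" for x \<ww>
  proof -
    have xU: "x \<in> U\<^sub>h" and orth: "(energy \<uu> - energy x) \<bullet> energy (x - \<ww>) = 0"
      using x \<ww> subspace_diff[OF sub] disc by auto
    have W: "x \<in> weak_trial_space" "\<ww> \<in> weak_trial_space" using xU \<ww> Uh(2) by auto
    have "(norm (energy \<uu> - energy \<ww>))\<^sup>2 = (norm (energy \<uu> - energy x))\<^sup>2 + (norm (energy x - energy \<ww>))\<^sup>2"
      using orth unfolding lin(3)[OF xU \<ww>] power2_norm_eq_inner by (simp add: inner_simps inner_commute)
    then have "(norm (energy \<uu> - energy x))\<^sup>2 \<le> (norm (energy \<uu> - energy \<ww>))\<^sup>2" by simp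
    then have "norm (energy \<uu> - energy x) \<le> norm (energy \<uu> - energy \<ww>)" by (rule power2_le_imp_le) simp
    then have "norm (energy (\<uu> - x)) \<le> norm (energy (\<uu> - \<ww>))"
      by (simp add: energy_diff \<uu> W)
    then show ?thesis
      using trial_norm_le_energy[of "\<uu> - x"] energy_le_trial_norm[of "\<uu> - \<ww>"]
        subspace_diff[OF subspace_weak_trial_space \<uu>] W by fastforce
  qed
qed

end

text \<open>On an unbroken \<tau> the trace of u is (u, \<nabla>div \<tau>) - (\<nabla>div u,
  \<tau>) over \<Omega>, and the boundary conditions of \<open>Hgd_0\<close> make it vanish.\<close>

lemma trial_space_subset:
  assumes lip: "lipschitz_domain \<Omega>" and bdd: "bounded \<Omega>" and "open_partition \<Omega> \<T>"
  shows "trial_space \<Omega> \<T> \<subseteq> open_partition.weak_trial_space \<Omega> \<T>"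
proof -
  interpret open_partition \<Omega> \<T> by fact
  have "uh \<tau> = 0" if uh: "uh \<in> skel_Hgd_0 \<Omega> \<T>" and \<tau>: "\<tau> \<in> Hgd \<Omega>" for uh \<tau>
  proof -
    obtain u where u: "u \<in> Hgd_0 \<Omega>" "uh = tr_gd \<Omega> \<T> u" using uh by (auto simp: skel_Hgd_0_def)
    then have "u \<in> Hgd \<Omega>" by (simp add: Hgd_0_def)
    then show ?thesis
      using u grad_div_symmetric[OF lip bdd u(1) \<tau>] tr_gd_eq[of u \<tau>] Hgd_broken[OF \<tau>] by simp
  qed
  moreover have "skel_Hgd_0 \<Omega> \<T> \<subseteq> skel_Hgd \<Omega> \<T>" by (auto simp: skel_Hgd_0_def skel_Hgd_def Hgd_0_def)
  ultimately show ?thesis by (auto simp: trial_space_def weak_trial_space_def)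
qed

theorem theorem13:
  fixes \<Omega> :: "(real ^ 'n) set"
  assumes "CARD('n) \<ge> 2"
    and "lipschitz_domain \<Omega>" and "bounded \<Omega>" and "simply_connected \<Omega>"
  shows "\<exists>C>0. \<forall>\<T> f \<uu> U\<^sub>h.
    mesh \<Omega> \<T> \<longrightarrow> f \<in> L2 \<Omega> \<longrightarrow> is_solution \<Omega> \<T> f \<uu> \<longrightarrow>
    finite_dim_subspace U\<^sub>h \<longrightarrow> U\<^sub>h \<subseteq> trial_space \<Omega> \<T> \<longrightarrow>
    (\<exists>!\<uu>\<^sub>h. is_discrete_solution \<Omega> \<T> f U\<^sub>h \<uu>\<^sub>h) \<and>
    (\<forall>\<uu>\<^sub>h. is_discrete_solution \<Omega> \<T> f U\<^sub>h \<uu>\<^sub>h \<longrightarrow>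
      (\<forall>\<ww>\<in>U\<^sub>h. trial_norm \<Omega> \<T> (\<uu> - \<uu>\<^sub>h) \<le> C * trial_norm \<Omega> \<T> (\<uu> - \<ww>)))"
\<comment> \<open>12 = 3 * 4, the product of the two constants in the norm equivalence; it depends
  on neither the mesh nor \<Omega>.\<close>
proof (intro exI[of _ 12] conjI allI impI)
  fix \<T> f \<uu> U\<^sub>h
  assume *: "mesh \<Omega> \<T>" "is_solution \<Omega> \<T> f \<uu>" "finite_dim_subspace U\<^sub>h" "U\<^sub>h \<subseteq> trial_space \<Omega> \<T>"
  have "open \<Omega>" using assms(2) by (simp add: lipschitz_domain_def)
  then interpret open_partition \<Omega> \<T> using assms(3) *(1) by (rule open_partition_mesh)
  have sub: "trial_space \<Omega> \<T> \<subseteq> weak_trial_space"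
    by (rule trial_space_subset[OF assms(2,3)]) unfold_locales
  then have u: "\<uu> \<in> weak_trial_space" using *(2) by (auto simp: is_solution_def)
  note qo = quasi_optimality[OF *(2) u *(3) order_trans[OF *(4) sub]]
  show "\<exists>!\<uu>\<^sub>h. is_discrete_solution \<Omega> \<T> f U\<^sub>h \<uu>\<^sub>h" by (rule qo(1))
  show "\<forall>\<ww>\<in>U\<^sub>h. trial_norm \<Omega> \<T> (\<uu> - \<uu>\<^sub>h) \<le> 12 * trial_norm \<Omega> \<T> (\<uu> - \<ww>)"
    if "is_discrete_solution \<Omega> \<T> f U\<^sub>h \<uu>\<^sub>h" for \<uu>\<^sub>h using qo(2)[OF that] by blast
qed simp

end
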